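(* Let $A$ be a finite-dimensional Hopf algebra over $\Bbbk$ with a triangular decomposition $A=A^-\otimes A_0\otimes A^+$ satisfying the conditions listed in the context. For a simple left $A_0$-module $V$ let $L(V)=Z(V)/R(V)$, where $Z(V)=A\otimes_{A^{\ge 0}}V$ and $R(V)$ is the unique maximal $A$-submodule of $Z(V)$. Then the mapping $V\mapsto L(V)$ sets up a bijection between the isomorphism classes of simple $A_0$-modules and the isomorphism classes of simple $A$-modules.
   Context: $\Bbbk$ is a field of characteristic $0$ containing all roots of $1$. Modules are left modules. The conditions on $A$ are: (i) $A_0$ is a Hopf subalgebra of $A$, $A^-$ and $A^+$ are subalgebras of $A$, and the multiplication map $A^-\otimes A_0\otimes A^+\to A$ is a linear isomorphism; (ii) $A^-$ and $A^+$ are stable under both the left and the right adjoint actions of $A_0$, that is under $(\mathrm{ad}_\ell a)(x)=\sum a_1xS(a_2)$ and $(\mathrm{ad}_r a)(x)=\sum S(a_1)xa_2$ for $a\in A_0$; (iii) $A^-=\Bbbk\oplus J^-$ and $A^+=\Bbbk\oplus J^+$, where $J^-$, $J^+$ are nilpotent ideals of $A^-$, $A^+$, respectively. Under these conditions $A^{\ge 0}:=A_0A^+=A^+A_0$ is a subalgebra of $A$, $A^{\ge 0}=A_0\oplus A_0J^+$, and $A_0J^+$ is a nilpotent ideal of $A^{\ge 0}$. Every simple $A_0$-module $V$ is regarded as an $A^{\ge 0}$-module by pullback along the projection $A^{\ge 0}\to A_0$ with kernel $A_0J^+$ (and these are all the simple $A^{\ge0}$-modules). One sets $Z(V)=A\otimes_{A^{\ge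 0}}V$; it has a unique maximal $A$-submodule, denoted $R(V)$, and it is contained in $J^-V$. *)

theory Defs
  imports "HOL-Algebra.Algebra"
begin

section \<open>Left modules over a not necessarily commutative ring\<close>

text \<open>
  The library locale \<open>module\<close> requires a commutative ring of scalars; the record type
  \<open>module\<close> and the locale \<open>submodule\<close> do not, and are used here.  As in the
  library, the multiplication and unit fields of a record that serves only as a module
  carry no meaning.
\<close>

locale left_module = R?: ring R + M?: abelian_group M
  for R :: "('r, 'a) ring_scheme" (structure) and M :: "('r, 'm, 'b) module_scheme" (structure) +
  assumes smult_closed:
      "\<lbrakk>a \<in> carrier R; x \<in> carrier M\<rbrakk> \<Longrightarrow> a \<odot>\<^bsub>M\<^esub> x \<in> carrier M"
    and smult_l_distr:
      "\<lbrakk>a \<in> carrier R; b \<in> carrier R; x \<in> carrier M\<rbrakk> \<Longrightarrow>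
        (a \<oplus> b) \<odot>\<^bsub>M\<^esub> x = a \<odot>\<^bsub>M\<^esub> x \<oplus>\<^bsub>M\<^esub> b \<odot>\<^bsub>M\<^esub> x"
    and smult_r_distr:
      "\<lbrakk>a \<in> carrier R; x \<in> carrier M; y \<in> carrier M\<rbrakk> \<Longrightarrow>
        a \<odot>\<^bsub>M\<^esub> (x \<oplus>\<^bsub>M\<^esub> y) = a \<odot>\<^bsub>M\<^esub> x \<oplus>\<^bsub>M\<^esub> a \<odot>\<^bsub>M\<^esub> y"
    and smult_assoc:
      "\<lbrakk>a \<in> carrier R; b \<in> carrier R; x \<in> carrier M\<rbrakk> \<Longrightarrow>
        (a \<otimes> b) \<odot>\<^bsub>M\<^esub> x = a \<odot>\<^bsub>M\<^esub> (b \<odot>\<^bsub>M\<^esub> x)"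
    and smult_one:
      "x \<in> carrier M \<Longrightarrow> \<one> \<odot>\<^bsub>M\<^esub> x = x"

definition lmod_hom ::
    "('r, 'a) ring_scheme \<Rightarrow> ('r, 'm, 'b) module_scheme \<Rightarrow> ('r, 'n, 'c) module_scheme \<Rightarrow> ('m \<Rightarrow> 'n) set"
  where "lmod_hom R M N =
    {h \<in> carrier M \<rightarrow> carrier N.
       (\<forall>x\<in>carrier M. \<forall>y\<in>carrier M. h (x \<oplus>\<^bsub>M\<^esub> y) = h x \<oplus>\<^bsub>N\<^esub> h y) \<and>
       (\<forall>r\<in>carrier R. \<forall>x\<in>carrier M. h (r \<odot>\<^bsub>M\<^esub> x) = r \<odot>\<^bsub>N\<^esub> h x)}"

definition lmod_iso ::
    "('r, 'a) ring_scheme \<Rightarrow> ('r, 'm, 'b) module_scheme \<Rightarrow> ('r, 'n, 'c) module_scheme \<Rightarrow> ('m \<Rightarrow> 'n) set"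
  where "lmod_iso R M N = {h \<in> lmod_hom R M N. bij_betw h (carrier M) (carrier N)}"

definition simple_module :: "('r, 'a) ring_scheme \<Rightarrow> ('r, 'm, 'b) module_scheme \<Rightarrow> bool"
  where "simple_module R M \<longleftrightarrow>
    left_module R M \<and> carrier M \<noteq> {\<zero>\<^bsub>M\<^esub>} \<and>
    (\<forall>N. submodule N R M \<longrightarrow> N = {\<zero>\<^bsub>M\<^esub>} \<or> N = carrier M)"

definition maximal_submodule ::
    "'m set \<Rightarrow> ('r, 'a) ring_scheme \<Rightarrow> ('r, 'm, 'b) module_scheme \<Rightarrow> bool"
  where "maximal_submodule N R M \<longleftrightarrow>
    submodule N R M \<and> N \<noteq> carrier M \<and>
    (\<forall>N'. submodule N' R M \<longrightarrow> N \<subseteq> N' \<longrightarrow> N' = N \<or> N' = carrier M)"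

definition quotient_module :: "('r, 'm, 'b) module_scheme \<Rightarrow> 'm set \<Rightarrow> ('r, 'm set) module"
  where "quotient_module M N =
    \<lparr>carrier = a_rcosets\<^bsub>M\<^esub> N, monoid.mult = undefined, monoid.one = undefined,
     ring.zero = N, ring.add = set_add M, smult = (\<lambda>r t. \<Union>x\<in>t. N +>\<^bsub>M\<^esub> (r \<odot>\<^bsub>M\<^esub> x))\<rparr>"

text \<open>
  The isomorphism class of \<open>M\<close>, taken among the modules whose elements belong to the
  type \<open>'u\<close>; the elements of \<open>M\<close> itself need not belong to \<open>'u\<close>.  A simple
  \<open>R\<close>-module is a quotient of \<open>R\<close>, so every simple module is represented in \<open>'u\<close> as
  soon as \<open>carrier R\<close> injects into \<open>'u\<close>.
\<close>

definition iso_class ::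
    "('r, 'a) ring_scheme \<Rightarrow> ('r, 'm, 'b) module_scheme \<Rightarrow> ('r, 'u) module set"
  where "iso_class R M = {N. left_module R N \<and> lmod_iso R M N \<noteq> {}}"

definition simple_classes :: "('r, 'a) ring_scheme \<Rightarrow> ('r, 'u) module set set"
  where "simple_classes R =
    {iso_class R M | M :: ('r, 'u) module. simple_module R M}"


section \<open>Tensor products\<close>

text \<open>
  The tensor product over \<open>R\<close> of a right \<open>R\<close>-module \<open>M\<close>, with right action \<open>\<rho>\<close>,
  and a left \<open>R\<close>-module \<open>N\<close> is the quotient of the free abelian group on
  \<open>M \<times> N\<close> by the subgroup generated by the usual relations.
\<close>

definition tensor_rel ::
    "('r, 'a) ring_scheme \<Rightarrow> ('m \<Rightarrow> 'r \<Rightarrow> 'm) \<Rightarrow> ('m, 'b) ring_scheme \<Rightarrow>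
     ('r, 'n, 'c) module_scheme \<Rightarrow> ('m \<times> 'n \<Rightarrow>\<^sub>0 int) set"
  where "tensor_rel R \<rho> M N =
    generate (free_Abelian_group (carrier M \<times> carrier N))
      ({frag_of (m \<oplus>\<^bsub>M\<^esub> m', n) - frag_of (m, n) - frag_of (m', n) | m m' n.
          m \<in> carrier M \<and> m' \<in> carrier M \<and> n \<in> carrier N} \<union>
       {frag_of (m, n \<oplus>\<^bsub>N\<^esub> n') - frag_of (m, n) - frag_of (m, n') | m n n'.
          m \<in> carrier M \<and> n \<in> carrier N \<and> n' \<in> carrier N} \<union>
       {frag_of (\<rho> m r, n) - frag_of (m, r \<odot>\<^bsub>N\<^esub> n) | m r n.
          m \<in> carrier M \<and> r \<in> carrier R \<and> n \<in> carrier N})"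

definition pure_tensor ::
    "('r, 'a) ring_scheme \<Rightarrow> ('m \<Rightarrow> 'r \<Rightarrow> 'm) \<Rightarrow> ('m, 'b) ring_scheme \<Rightarrow>
     ('r, 'n, 'c) module_scheme \<Rightarrow> 'm \<Rightarrow> 'n \<Rightarrow> ('m \<times> 'n \<Rightarrow>\<^sub>0 int) set"
  where "pure_tensor R \<rho> M N m n =
    tensor_rel R \<rho> M N #>\<^bsub>free_Abelian_group (carrier M \<times> carrier N)\<^esub> frag_of (m, n)"

text \<open>
  The additive map from a tensor product to the abelian group \<open>G\<close> induced by a balanced
  biadditive map \<open>f\<close>: every formal sum in the coset \<open>t\<close> has the same value in \<open>G\<close>.
\<close>

definition tensor_lift :: "('g, 'a) ring_scheme \<Rightarrow> ('m \<Rightarrow> 'n \<Rightarrow> 'g) \<Rightarrow> ('m \<times> 'n \<Rightarrow>\<^sub>0 int) set \<Rightarrow> 'g"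
  where "tensor_lift G f t =
    the_elem ((\<lambda>c. \<Oplus>\<^bsub>G\<^esub>p\<in>Poly_Mapping.keys c.
                      add_pow G (Poly_Mapping.lookup c p) (f (fst p) (snd p))) ` t)"

definition tensor_group ::
    "('r, 'a) ring_scheme \<Rightarrow> ('m \<Rightarrow> 'r \<Rightarrow> 'm) \<Rightarrow> ('m, 'b) ring_scheme \<Rightarrow>
     ('r, 'n, 'c) module_scheme \<Rightarrow> ('m \<times> 'n \<Rightarrow>\<^sub>0 int) set ring"
  where "tensor_group R \<rho> M N =
    (let Q = free_Abelian_group (carrier M \<times> carrier N) Mod tensor_rel R \<rho> M N
     in \<lparr>carrier = carrier Q, monoid.mult = undefined, monoid.one = undefined,
         ring.zero = monoid.one Q, ring.add = monoid.mult Q\<rparr>)"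

text \<open>If \<open>M\<close> also has a left action \<open>\<sigma>\<close> commuting with \<open>\<rho>\<close>, the tensor product inherits it.\<close>

definition tensor_module ::
    "('r, 'a) ring_scheme \<Rightarrow> ('m \<Rightarrow> 'r \<Rightarrow> 'm) \<Rightarrow> ('s \<Rightarrow> 'm \<Rightarrow> 'm) \<Rightarrow> ('m, 'b) ring_scheme \<Rightarrow>
     ('r, 'n, 'c) module_scheme \<Rightarrow> ('s, ('m \<times> 'n \<Rightarrow>\<^sub>0 int) set) module"
  where "tensor_module R \<rho> \<sigma> M N =
    (let T = tensor_group R \<rho> M N
     in \<lparr>carrier = carrier T, monoid.mult = undefined, monoid.one = undefined,
         ring.zero = ring.zero T, ring.add = ring.add T,
         smult = (\<lambda>s. tensor_lift T (\<lambda>m n. pure_tensor R \<rho> M N (\<sigma> s m) n))\<rparr>)"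

definition vtensor ::
    "('k, 'a) ring_scheme \<Rightarrow> ('k, 'm, 'b) module_scheme \<Rightarrow> ('k, 'n, 'c) module_scheme \<Rightarrow>
     ('k, ('m \<times> 'n \<Rightarrow>\<^sub>0 int) set) module"
  where "vtensor K M N = tensor_module K (\<lambda>m c. c \<odot>\<^bsub>M\<^esub> m) (smult M) M N"

definition vpure ::
    "('k, 'a) ring_scheme \<Rightarrow> ('k, 'm, 'b) module_scheme \<Rightarrow> ('k, 'n, 'c) module_scheme \<Rightarrow>
     'm \<Rightarrow> 'n \<Rightarrow> ('m \<times> 'n \<Rightarrow>\<^sub>0 int) set"
  where "vpure K M N = pure_tensor K (\<lambda>m c. c \<odot>\<^bsub>M\<^esub> m) M N"

definition tensor_algebra ::
    "('k, 'a) ring_scheme \<Rightarrow> ('k, 'm, 'b) module_scheme \<Rightarrow> ('k, 'n, 'c) module_scheme \<Rightarrow>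
     ('k, ('m \<times> 'n \<Rightarrow>\<^sub>0 int) set) module"
  where "tensor_algebra K A B =
    (vtensor K A B)
      \<lparr>monoid.mult := (\<lambda>s t. tensor_lift (vtensor K A B)
                  (\<lambda>a b. tensor_lift (vtensor K A B)
                     (\<lambda>a' b'. vpure K A B (a \<otimes>\<^bsub>A\<^esub> a') (b \<otimes>\<^bsub>B\<^esub> b')) t) s),
       monoid.one := vpure K A B \<one>\<^bsub>A\<^esub> \<one>\<^bsub>B\<^esub>\<rparr>"


section \<open>Hopf algebras\<close>

locale field_algebra = K: field K + module K A + A: ring A
  for K :: "('k, 'x) ring_scheme" (structure) and A :: "('k, 'a, 'y) module_scheme" (structure) +
  assumes smult_mult_left:
      "\<lbrakk>c \<in> carrier K; x \<in> carrier A; y \<in> carrier A\<rbrakk> \<Longrightarrow>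
        (c \<odot>\<^bsub>A\<^esub> x) \<otimes>\<^bsub>A\<^esub> y = c \<odot>\<^bsub>A\<^esub> (x \<otimes>\<^bsub>A\<^esub> y)"
    and smult_mult_right:
      "\<lbrakk>c \<in> carrier K; x \<in> carrier A; y \<in> carrier A\<rbrakk> \<Longrightarrow>
        x \<otimes>\<^bsub>A\<^esub> (c \<odot>\<^bsub>A\<^esub> y) = c \<odot>\<^bsub>A\<^esub> (x \<otimes>\<^bsub>A\<^esub> y)"

definition finite_dimensional :: "('k, 'a) ring_scheme \<Rightarrow> ('k, 'm, 'b) module_scheme \<Rightarrow> bool"
  where "finite_dimensional K M \<longleftrightarrow>
    (\<exists>S. finite S \<and> S \<subseteq> carrier M \<and>
       (\<forall>x\<in>carrier M. \<exists>c\<in>S \<rightarrow> carrier K. x = (\<Oplus>\<^bsub>M\<^esub>s\<in>S. c s \<odot>\<^bsub>M\<^esub> s)))"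

definition is_subalgebra :: "'a set \<Rightarrow> ('k, 'x) ring_scheme \<Rightarrow> ('k, 'a, 'y) module_scheme \<Rightarrow> bool"
  where "is_subalgebra B K A \<longleftrightarrow> subring B A \<and> submodule B K A"

record ('k, 'a) hopf = "('k, 'a) module" +
  comult :: "'a \<Rightarrow> ('a \<times> 'a \<Rightarrow>\<^sub>0 int) set"
  counit :: "'a \<Rightarrow> 'k"
  antipode :: "'a \<Rightarrow> 'a"

text \<open>
  Below, Sweedler sums over the comultiplication of \<open>a\<close> are values of \<^const>\<open>tensor_lift\<close>
  at \<open>comult A a\<close>.  Coassociativity is stated after identifying \<open>(A \<otimes> A) \<otimes> A\<close>
  with \<open>A \<otimes> (A \<otimes> A)\<close>.
\<close>

definition tensor_assoc ::
    "('k, 'x) ring_scheme \<Rightarrow> ('k, 'a, 'y) module_scheme \<Rightarrow>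
     (('a \<times> 'a \<Rightarrow>\<^sub>0 int) set \<times> 'a \<Rightarrow>\<^sub>0 int) set \<Rightarrow>
     ('a \<times> ('a \<times> 'a \<Rightarrow>\<^sub>0 int) set \<Rightarrow>\<^sub>0 int) set"
  where "tensor_assoc K A =
    (let T = vtensor K A (vtensor K A A)
     in tensor_lift T (\<lambda>t c. tensor_lift T
          (\<lambda>a b. vpure K A (vtensor K A A) a (vpure K A A b c)) t))"

locale hopf_algebra = field_algebra K A
  for K :: "('k, 'x) ring_scheme" (structure) and A :: "('k, 'a, 'y) hopf_scheme" (structure) +
  assumes comult_linear: "comult A \<in> lmod_hom K A (vtensor K A A)"
    and comult_hom: "comult A \<in> ring_hom A (tensor_algebra K A A)"
    and counit_hom: "counit A \<in> ring_hom A K"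
    and counit_smult:
      "\<lbrakk>c \<in> carrier K; a \<in> carrier A\<rbrakk> \<Longrightarrow> counit A (c \<odot>\<^bsub>A\<^esub> a) = c \<otimes>\<^bsub>K\<^esub> counit A a"
    and coassoc: "a \<in> carrier A \<Longrightarrow>
      tensor_assoc K A
        (tensor_lift (vtensor K (vtensor K A A) A)
           (\<lambda>x y. vpure K (vtensor K A A) A (comult A x) y) (comult A a)) =
      tensor_lift (vtensor K A (vtensor K A A))
        (\<lambda>x y. vpure K A (vtensor K A A) x (comult A y)) (comult A a)"
    and counit_left: "a \<in> carrier A \<Longrightarrow>
      tensor_lift A (\<lambda>x y. counit A x \<odot>\<^bsub>A\<^esub> y) (comult A a) = a"
    and counit_right: "a \<in> carrier A \<Longrightarrow>
      tensor_lift A (\<lambda>x y. counit A y \<odot>\<^bsub>A\<^esub> x) (comult A a) = a"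
    and antipode_linear: "antipode A \<in> lmod_hom K A A"
    and antipode_left: "a \<in> carrier A \<Longrightarrow>
      tensor_lift A (\<lambda>x y. antipode A x \<otimes>\<^bsub>A\<^esub> y) (comult A a) = counit A a \<odot>\<^bsub>A\<^esub> \<one>\<^bsub>A\<^esub>"
    and antipode_right: "a \<in> carrier A \<Longrightarrow>
      tensor_lift A (\<lambda>x y. x \<otimes>\<^bsub>A\<^esub> antipode A y) (comult A a) = counit A a \<odot>\<^bsub>A\<^esub> \<one>\<^bsub>A\<^esub>"

text \<open>The requirement on \<open>comult\<close> is that it maps \<open>B\<close> into the image of \<open>B \<otimes> B\<close> in \<open>A \<otimes> A\<close>.\<close>

definition hopf_subalgebra :: "'a set \<Rightarrow> ('k, 'x) ring_scheme \<Rightarrow> ('k, 'a, 'y) hopf_scheme \<Rightarrow> bool"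
  where "hopf_subalgebra B K A \<longleftrightarrow>
    is_subalgebra B K A \<and>
    comult A ` B \<subseteq> tensor_lift (vtensor K A A) (vpure K A A) `
                    carrier (vtensor K (A\<lparr>carrier := B\<rparr>) (A\<lparr>carrier := B\<rparr>)) \<and>
    antipode A ` B \<subseteq> B"

definition left_adjoint :: "('k, 'a, 'y) hopf_scheme \<Rightarrow> 'a \<Rightarrow> 'a \<Rightarrow> 'a"
  where "left_adjoint A a x =
    tensor_lift A (\<lambda>a\<^sub>1 a\<^sub>2. a\<^sub>1 \<otimes>\<^bsub>A\<^esub> x \<otimes>\<^bsub>A\<^esub> antipode A a\<^sub>2) (comult A a)"

definition right_adjoint :: "('k, 'a, 'y) hopf_scheme \<Rightarrow> 'a \<Rightarrow> 'a \<Rightarrow> 'a"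
  where "right_adjoint A a x =
    tensor_lift A (\<lambda>a\<^sub>1 a\<^sub>2. antipode A a\<^sub>1 \<otimes>\<^bsub>A\<^esub> x \<otimes>\<^bsub>A\<^esub> a\<^sub>2) (comult A a)"


section \<open>Triangular decompositions\<close>

text \<open>
  The library's \<^const>\<open>ideal_prod\<close> is the set of finite sums of products and makes sense for
  arbitrary additive subgroups; the iterate below is the power \<open>J\<^sup>n\<^sup>+\<^sup>1\<close>.
\<close>

definition nilpotent_ideal :: "'a set \<Rightarrow> ('a, 'x) ring_scheme \<Rightarrow> bool"
  where "nilpotent_ideal J R \<longleftrightarrow>
    ideal J R \<and> (\<exists>n. (ideal_prod R J ^^ n) J = {\<zero>\<^bsub>R\<^esub>})"

definition scalars :: "('k, 'x) ring_scheme \<Rightarrow> ('k, 'a, 'y) module_scheme \<Rightarrow> 'a set"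
  where "scalars K A = (\<lambda>c. c \<odot>\<^bsub>A\<^esub> \<one>\<^bsub>A\<^esub>) ` carrier K"

definition triangular_mult ::
    "('k, 'x) ring_scheme \<Rightarrow> ('k, 'a, 'y) module_scheme \<Rightarrow>
     (('a \<times> 'a \<Rightarrow>\<^sub>0 int) set \<times> 'a \<Rightarrow>\<^sub>0 int) set \<Rightarrow> 'a"
  where "triangular_mult K A =
    tensor_lift A (\<lambda>t z. tensor_lift A (\<lambda>x y. x \<otimes>\<^bsub>A\<^esub> y) t \<otimes>\<^bsub>A\<^esub> z)"

locale triangular_hopf_algebra = hopf_algebra K A
  for K :: "('k, 'x) ring_scheme" (structure) and A :: "('k, 'a, 'y) hopf_scheme" (structure) +
  fixes A\<^sub>m A\<^sub>0 A\<^sub>p J\<^sub>m J\<^sub>p :: "'a set"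
  assumes A0_hopf: "hopf_subalgebra A\<^sub>0 K A"
    and Am_subalgebra: "is_subalgebra A\<^sub>m K A"
    and Ap_subalgebra: "is_subalgebra A\<^sub>p K A"
    and decomposition:
      "triangular_mult K A \<in>
         lmod_iso K (vtensor K (vtensor K (A\<lparr>carrier := A\<^sub>m\<rparr>) (A\<lparr>carrier := A\<^sub>0\<rparr>))
                       (A\<lparr>carrier := A\<^sub>p\<rparr>)) A"
    and Am_left_stable: "\<lbrakk>a \<in> A\<^sub>0; x \<in> A\<^sub>m\<rbrakk> \<Longrightarrow> left_adjoint A a x \<in> A\<^sub>m"
    and Am_right_stable: "\<lbrakk>a \<in> A\<^sub>0; x \<in> A\<^sub>m\<rbrakk> \<Longrightarrow> right_adjoint A a x \<in> A\<^sub>m"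
    and Ap_left_stable: "\<lbrakk>a \<in> A\<^sub>0; x \<in> A\<^sub>p\<rbrakk> \<Longrightarrow> left_adjoint A a x \<in> A\<^sub>p"
    and Ap_right_stable: "\<lbrakk>a \<in> A\<^sub>0; x \<in> A\<^sub>p\<rbrakk> \<Longrightarrow> right_adjoint A a x \<in> A\<^sub>p"
    and Jm_nilpotent: "nilpotent_ideal J\<^sub>m (A\<lparr>carrier := A\<^sub>m\<rparr>)"
    and Jp_nilpotent: "nilpotent_ideal J\<^sub>p (A\<lparr>carrier := A\<^sub>p\<rparr>)"
    and Am_direct_sum: "A\<^sub>m = scalars K A <+>\<^bsub>A\<^esub> J\<^sub>m" "scalars K A \<inter> J\<^sub>m = {\<zero>\<^bsub>A\<^esub>}"
    and Ap_direct_sum: "A\<^sub>p = scalars K A <+>\<^bsub>A\<^esub> J\<^sub>p" "scalars K A \<inter> J\<^sub>p = {\<zero>\<^bsub>A\<^esub>}"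

definition nonneg_part :: "('k, 'a, 'y) hopf_scheme \<Rightarrow> 'a set \<Rightarrow> 'a set \<Rightarrow> 'a set"
  where "nonneg_part A A\<^sub>0 A\<^sub>p = ideal_prod A A\<^sub>0 A\<^sub>p"

text \<open>The projection of \<open>A\<^sub>0 A\<^sub>p = A\<^sub>0 \<oplus> A\<^sub>0 J\<^sub>p\<close> onto \<open>A\<^sub>0\<close> with kernel \<open>A\<^sub>0 J\<^sub>p\<close>.\<close>

definition nonneg_proj :: "('k, 'a, 'y) hopf_scheme \<Rightarrow> 'a set \<Rightarrow> 'a set \<Rightarrow> 'a \<Rightarrow> 'a"
  where "nonneg_proj A A\<^sub>0 J\<^sub>p x =
    (THE a. a \<in> A\<^sub>0 \<and> x \<ominus>\<^bsub>A\<^esub> a \<in> ideal_prod A A\<^sub>0 J\<^sub>p)"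

definition inflation ::
    "('k, 'a, 'y) hopf_scheme \<Rightarrow> 'a set \<Rightarrow> 'a set \<Rightarrow> ('a, 'v) module \<Rightarrow> ('a, 'v) module"
  where "inflation A A\<^sub>0 J\<^sub>p V = V\<lparr>smult := (\<lambda>x v. nonneg_proj A A\<^sub>0 J\<^sub>p x \<odot>\<^bsub>V\<^esub> v)\<rparr>"

definition standard_module ::
    "('k, 'a, 'y) hopf_scheme \<Rightarrow> 'a set \<Rightarrow> 'a set \<Rightarrow> 'a set \<Rightarrow> ('a, 'v) module \<Rightarrow>
     ('a, ('a \<times> 'v \<Rightarrow>\<^sub>0 int) set) module"
  where "standard_module A A\<^sub>0 A\<^sub>p J\<^sub>p V =
    tensor_module (A\<lparr>carrier := nonneg_part A A\<^sub>0 A\<^sub>p\<rparr>) (monoid.mult A) (monoid.mult A)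
      A (inflation A A\<^sub>0 J\<^sub>p V)"

definition standard_radical ::
    "('k, 'a, 'y) hopf_scheme \<Rightarrow> 'a set \<Rightarrow> 'a set \<Rightarrow> 'a set \<Rightarrow> ('a, 'v) module \<Rightarrow>
     ('a \<times> 'v \<Rightarrow>\<^sub>0 int) set set"
  where "standard_radical A A\<^sub>0 A\<^sub>p J\<^sub>p V =
    (THE N. maximal_submodule N A (standard_module A A\<^sub>0 A\<^sub>p J\<^sub>p V))"

definition standard_head ::
    "('k, 'a, 'y) hopf_scheme \<Rightarrow> 'a set \<Rightarrow> 'a set \<Rightarrow> 'a set \<Rightarrow> ('a, 'v) module \<Rightarrow>
     ('a, ('a \<times> 'v \<Rightarrow>\<^sub>0 int) set set) module"
  where "standard_head A A\<^sub>0 A\<^sub>p J\<^sub>p V =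
    quotient_module (standard_module A A\<^sub>0 A\<^sub>p J\<^sub>p V) (standard_radical A A\<^sub>0 A\<^sub>p J\<^sub>p V)"


section \<open>The ground field\<close>

definition characteristic_zero :: "('k, 'x) ring_scheme \<Rightarrow> bool"
  where "characteristic_zero K \<longleftrightarrow> (\<forall>n::nat. n > 0 \<longrightarrow> [n] \<cdot>\<^bsub>K\<^esub> \<one>\<^bsub>K\<^esub> \<noteq> \<zero>\<^bsub>K\<^esub>)"

text \<open>All roots of unity lie in \<open>K\<close>: every polynomial \<open>X\<^sup>n - 1\<close> splits over \<open>K\<close>.\<close>

definition contains_roots_of_unity :: "('k, 'x) ring_scheme \<Rightarrow> bool"
  where "contains_roots_of_unity K \<longleftrightarrow>
    (\<forall>n::nat. n > 0 \<longrightarrow>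
       ring.splitted K
         ((X\<^bsub>K\<^esub> [^]\<^bsub>poly_ring K\<^esub> n) \<ominus>\<^bsub>poly_ring K\<^esub> \<one>\<^bsub>poly_ring K\<^esub>))"

end

theory Submission
  imports Defs
begin

text \<open>
  The correspondence is highest weight theory, with \<open>A\<^sub>0\<close> in the role of the Cartan subalgebra.

  Everything rests on two facts about \<open>J\<^sub>m\<close> and \<open>J\<^sub>p\<close>.  The counit is multiplicative with values
  in a field, so it kills the nilpotent ideals \<open>J\<^sub>m\<close> and \<open>J\<^sub>p\<close>, which are therefore the
  augmentation ideals of \<open>A\<^sub>m\<close> and \<open>A\<^sub>p\<close> and are stable under the adjoint actions used.
  Coassociativity gives \<open>a x = \<Sum> (ad\<^sub>l a\<^sub>1)(x) a\<^sub>2\<close> and \<open>x a = \<Sum> a\<^sub>1 (ad\<^sub>r a\<^sub>2)(x)\<close>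
  (\<open>mult_eq_left_adjoint\<close>, \<open>mult_eq_right_adjoint\<close>), whence \<open>A\<^sub>0 J\<^sub>m \<subseteq> J\<^sub>m A\<^sub>0\<close> and
  \<open>J\<^sub>p A\<^sub>0 \<subseteq> A\<^sub>0 J\<^sub>p\<close>.  So the map \<open>p : x a y \<mapsto> \<epsilon>(x) \<epsilon>(y) a\<close>, which the triangular
  decomposition makes well defined, is the projection of \<open>A\<close> onto \<open>A\<^sub>0\<close> along
  \<open>J\<^sub>m A + A\<^sub>0 J\<^sub>p\<close>; it is left \<open>A\<^sub>0\<close>-linear, and \<open>p(x b) = p(x) p(b)\<close> for \<open>b\<close> in
  \<open>A\<^sub>0 A\<^sub>p\<close> (\<open>mid_proj_left_linear\<close>, \<open>mid_proj_right_linear\<close>).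

  Consequently \<open>x \<otimes> v \<mapsto> p(x) v\<close> is an \<open>A\<^sub>0\<close>-linear retraction \<open>Z(V) \<rightarrow> V\<close> with kernel
  \<open>J\<^sub>m Z(V)\<close>.  As \<open>V\<close> is simple and \<open>J\<^sub>m\<close> is nilpotent, Nakayama's argument puts every proper
  submodule of \<open>Z(V)\<close> into this kernel (\<open>proper_submodule_ret\<close>).  The largest submodule in the
  kernel is therefore the largest proper submodule, and its quotient \<open>L(V)\<close> is simple.

  The retraction descends to \<open>L(V)\<close>, which identifies \<open>V\<close> with \<open>L(V) / J\<^sub>m L(V)\<close>; so \<open>L(V)\<close>
  determines \<open>V\<close> (\<open>standard_head_iso_imp_iso\<close>).  Conversely a simple \<open>A\<close>-module \<open>M\<close> has nonzero
  vectors killed by the nilpotent ideal \<open>J\<^sub>p\<close>.  They form an \<open>A\<^sub>0\<close>-submodule, which contains a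
  simple one, \<open>V\<close>, by finite dimensionality (\<open>simple_highest_weight_submodule\<close>); by Frobenius
  reciprocity the inclusion of \<open>V\<close> extends to a surjection \<open>Z(V) \<rightarrow> M\<close>, and \<open>M\<close> is \<open>L(V)\<close>
  (\<open>Z_universal\<close>, \<open>L_unique\<close>).

  The tensor products are quotients of free abelian groups, so additive maps out of them are
  compared on pure tensors, and inclusions such as \<open>A\<^sub>0 J\<^sub>m \<subseteq> J\<^sub>m A\<^sub>0\<close> are stated by testing
  membership in additive subgroups, which avoids choosing representatives of Sweedler sums.
\<close>

section \<open>Additive maps and additive subgroups\<close>

abbreviation additive_map ::
    "('m, 'a) ring_scheme \<Rightarrow> ('n, 'b) ring_scheme \<Rightarrow> ('m \<Rightarrow> 'n) set"
  where "additive_map M N \<equiv> hom (add_monoid M) (add_monoid N)"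

lemma additive_mapI:
  assumes "\<And>x. x \<in> carrier M \<Longrightarrow> f x \<in> carrier N"
    and "\<And>x y. \<lbrakk>x \<in> carrier M; y \<in> carrier M\<rbrakk> \<Longrightarrow> f (x \<oplus>\<^bsub>M\<^esub> y) = f x \<oplus>\<^bsub>N\<^esub> f y"
  shows "f \<in> additive_map M N"
  using assms by (auto simp: hom_def)

lemma additive_map_closed:
  "\<lbrakk>f \<in> additive_map M N; x \<in> carrier M\<rbrakk> \<Longrightarrow> f x \<in> carrier N"
  by (auto simp: hom_def)

lemma additive_map_add:
  "\<lbrakk>f \<in> additive_map M N; x \<in> carrier M; y \<in> carrier M\<rbrakk> \<Longrightarrow>
    f (x \<oplus>\<^bsub>M\<^esub> y) = f x \<oplus>\<^bsub>N\<^esub> f y"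
  by (auto simp: hom_def)

lemma additive_map_comp:
  "\<lbrakk>f \<in> additive_map M N; g \<in> additive_map N P\<rbrakk> \<Longrightarrow> (\<lambda>x. g (f x)) \<in> additive_map M P"
  by (auto simp: hom_def Pi_iff)

lemma additive_map_group_hom:
  assumes "abelian_group M" "abelian_group N" "f \<in> additive_map M N"
  shows "group_hom (add_monoid M) (add_monoid N) f"
  using assms by (simp add: group_hom_def group_hom_axioms_def abelian_group.a_group)

lemma additive_map_zero:
  assumes "abelian_group M" "abelian_group N" "f \<in> additive_map M N"
  shows "f \<zero>\<^bsub>M\<^esub> = \<zero>\<^bsub>N\<^esub>"
  using group_hom.hom_one[OF additive_map_group_hom[OF assms]] by simp

lemma additive_map_a_inv:
  assumes "abelian_group M" "abelian_group N" "f \<in> additive_map M N" "x \<in> carrier M"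
  shows "f (\<ominus>\<^bsub>M\<^esub> x) = \<ominus>\<^bsub>N\<^esub> f x"
  using group_hom.hom_inv[OF additive_map_group_hom[OF assms(1-3)], of x] assms(4)
  by (simp add: a_inv_def)

lemma additive_map_minus:
  assumes "abelian_group M" "abelian_group N" "f \<in> additive_map M N"
    and "x \<in> carrier M" "y \<in> carrier M"
  shows "f (x \<ominus>\<^bsub>M\<^esub> y) = f x \<ominus>\<^bsub>N\<^esub> f y"
  using assms by (simp add: a_minus_def additive_map_add additive_map_a_inv
      abelian_group.a_inv_closed)

lemma (in abelian_group) additive_subgroupI':
  assumes "H \<subseteq> carrier G" "\<zero> \<in> H"
    and "\<And>x y. \<lbrakk>x \<in> H; y \<in> H\<rbrakk> \<Longrightarrow> x \<oplus> y \<in> H"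
    and "\<And>x. x \<in> H \<Longrightarrow> \<ominus> x \<in> H"
  shows "additive_subgroup H G"
  using assms
  by (intro additive_subgroupI subgroup.intro) (auto simp: a_inv_def)

lemma additive_subgroup_vimage:
  assumes "abelian_group M" "abelian_group N" "f \<in> additive_map M N" "additive_subgroup H N"
  shows "additive_subgroup {x \<in> carrier M. f x \<in> H} M"
proof -
  interpret M: abelian_group M by fact
  interpret N: abelian_group N by fact
  interpret H: additive_subgroup H N by fact
  show ?thesis
    using additive_map_zero[OF assms(1-3)] additive_map_a_inv[OF assms(1-3)]
      additive_map_add[OF assms(3)]
    by (intro M.additive_subgroupI') auto
qed

lemma (in abelian_group) zero_additive_subgroup: "additive_subgroup {\<zero>} G"
  by (intro additive_subgroupI') auto

lemma additive_subgroup_kernel: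
  assumes "abelian_group M" "abelian_group N" "f \<in> additive_map M N"
  shows "additive_subgroup {x \<in> carrier M. f x = \<zero>\<^bsub>N\<^esub>} M"
  using additive_subgroup_vimage[OF assms abelian_group.zero_additive_subgroup[OF assms(2)]] by simp

lemma additive_subgroup_equalizer:
  assumes "abelian_group M" "abelian_group N" "f \<in> additive_map M N" "g \<in> additive_map M N"
  shows "additive_subgroup {x \<in> carrier M. f x = g x} M"
proof -
  interpret M: abelian_group M by fact
  interpret N: abelian_group N by fact
  show ?thesis
    using additive_map_zero[OF assms(1,2,3)] additive_map_a_inv[OF assms(1,2,3)]
      additive_map_add[OF assms(3)] additive_map_zero[OF assms(1,2,4)]
      additive_map_a_inv[OF assms(1,2,4)] additive_map_add[OF assms(4)]
    by (intro M.additive_subgroupI') auto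
qed

section \<open>The universal property of tensor products\<close>

definition balanced ::
    "('r, 'a) ring_scheme \<Rightarrow> ('m \<Rightarrow> 'r \<Rightarrow> 'm) \<Rightarrow> ('m, 'b) ring_scheme \<Rightarrow>
     ('r, 'n, 'c) module_scheme \<Rightarrow> ('g, 'd) ring_scheme \<Rightarrow> ('m \<Rightarrow> 'n \<Rightarrow> 'g) \<Rightarrow> bool"
  where "balanced R \<rho> M N G f \<longleftrightarrow>
    (\<forall>n\<in>carrier N. (\<lambda>m. f m n) \<in> additive_map M G) \<and>
    (\<forall>m\<in>carrier M. f m \<in> additive_map N G) \<and>
    (\<forall>m\<in>carrier M. \<forall>r\<in>carrier R. \<forall>n\<in>carrier N. f (\<rho> m r) n = f m (r \<odot>\<^bsub>N\<^esub> n))"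

lemma balancedI:
  assumes "\<And>m n. \<lbrakk>m \<in> carrier M; n \<in> carrier N\<rbrakk> \<Longrightarrow> f m n \<in> carrier G"
    and "\<And>m m' n. \<lbrakk>m \<in> carrier M; m' \<in> carrier M; n \<in> carrier N\<rbrakk> \<Longrightarrow>
           f (m \<oplus>\<^bsub>M\<^esub> m') n = f m n \<oplus>\<^bsub>G\<^esub> f m' n"
    and "\<And>m n n'. \<lbrakk>m \<in> carrier M; n \<in> carrier N; n' \<in> carrier N\<rbrakk> \<Longrightarrow>
           f m (n \<oplus>\<^bsub>N\<^esub> n') = f m n \<oplus>\<^bsub>G\<^esub> f m n'"
    and "\<And>m r n. \<lbrakk>m \<in> carrier M; r \<in> carrier R; n \<in> carrier N\<rbrakk> \<Longrightarrow>
           f (\<rho> m r) n = f m (r \<odot>\<^bsub>N\<^esub> n)"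
  shows "balanced R \<rho> M N G f"
  using assms by (auto simp: balanced_def hom_def)

lemma balancedD:
  assumes "balanced R \<rho> M N G f"
  shows "\<lbrakk>m \<in> carrier M; n \<in> carrier N\<rbrakk> \<Longrightarrow> f m n \<in> carrier G"
    and "\<lbrakk>m \<in> carrier M; m' \<in> carrier M; n \<in> carrier N\<rbrakk> \<Longrightarrow>
           f (m \<oplus>\<^bsub>M\<^esub> m') n = f m n \<oplus>\<^bsub>G\<^esub> f m' n"
    and "\<lbrakk>m \<in> carrier M; n \<in> carrier N; n' \<in> carrier N\<rbrakk> \<Longrightarrow>
           f m (n \<oplus>\<^bsub>N\<^esub> n') = f m n \<oplus>\<^bsub>G\<^esub> f m n'"
    and "\<lbrakk>m \<in> carrier M; r \<in> carrier R; n \<in> carrier N\<rbrakk> \<Longrightarrow> f (\<rho> m r) n = f m (r \<odot>\<^bsub>N\<^esub> n)"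
  using assms by (auto simp: balanced_def hom_def)

text \<open>The homomorphism out of the free abelian group behind \<^const>\<open>tensor_lift\<close>.\<close>

definition free_extension :: "('g, 'd) monoid_scheme \<Rightarrow> ('c \<Rightarrow> 'g) \<Rightarrow> ('c \<Rightarrow>\<^sub>0 int) \<Rightarrow> 'g"
  where "free_extension G f c =
    (\<Otimes>\<^bsub>G\<^esub>p\<in>Poly_Mapping.keys c. f p [^]\<^bsub>G\<^esub> Poly_Mapping.lookup c p)"

lemma (in comm_group) free_extension_hom:
  assumes f: "f \<in> S \<rightarrow> carrier G"
  shows "free_extension G f \<in> hom (free_Abelian_group S) G"
proof (rule homI)
  fix x y :: "'c \<Rightarrow>\<^sub>0 int"
  assume "x \<in> carrier (free_Abelian_group S)" "y \<in> carrier (free_Abelian_group S)"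
  then have xS: "Poly_Mapping.keys x \<subseteq> S" and yS: "Poly_Mapping.keys y \<subseteq> S" by auto
  let ?U = "Poly_Mapping.keys x \<union> Poly_Mapping.keys y"
  have ext: "free_extension G f z = (\<Otimes>p\<in>?U. f p [^] Poly_Mapping.lookup z p)"
    if "Poly_Mapping.keys z \<subseteq> ?U" for z
    unfolding free_extension_def using that xS yS f
    by (intro finprod_mono_neutral_cong_left) (auto simp: Pi_iff not_in_keys_iff_lookup_eq_zero)
  have "free_extension G f (x + y)
      = (\<Otimes>p\<in>?U. f p [^] Poly_Mapping.lookup x p \<otimes> f p [^] Poly_Mapping.lookup y p)"
    using xS yS f keys_add[of x y]
    by (subst ext) (auto intro!: finprod_cong simp: lookup_add int_pow_mult Pi_iff subset_iff simp_implies_def)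
  also have "\<dots> = free_extension G f x \<otimes> free_extension G f y"
    using xS yS f by (subst finprod_multf) (auto simp: ext Pi_iff subset_iff)
  finally show "free_extension G f (x \<otimes>\<^bsub>free_Abelian_group S\<^esub> y)
      = free_extension G f x \<otimes> free_extension G f y" by simp
qed (use f in \<open>auto simp: free_extension_def intro!: finprod_closed\<close>)

lemma (in comm_group) free_extension_frag_of:
  "f p \<in> carrier G \<Longrightarrow> free_extension G f (frag_of p) = f p"
  by (simp add: free_extension_def)


text \<open>
  The hypotheses are those that put the defining relations into the free abelian group.  This
  generality lets one tensor over \<open>A\<^sub>0 A\<^sub>p\<close> with an inflated module knowing only how the elements
  of \<open>A\<^sub>0 A\<^sub>p\<close> act.
\<close>

locale tensor_factors = M: abelian_group M + N: abelian_group N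
  for R :: "('r, 'a) ring_scheme" and \<rho> :: "'m \<Rightarrow> 'r \<Rightarrow> 'm"
    and M :: "('m, 'b) ring_scheme" and N :: "('r, 'n, 'c) module_scheme" +
  assumes right_closed: "\<lbrakk>m \<in> carrier M; r \<in> carrier R\<rbrakk> \<Longrightarrow> \<rho> m r \<in> carrier M"
    and left_closed: "\<lbrakk>r \<in> carrier R; n \<in> carrier N\<rbrakk> \<Longrightarrow> r \<odot>\<^bsub>N\<^esub> n \<in> carrier N"
begin

abbreviation (input) "free_group \<equiv> free_Abelian_group (carrier M \<times> carrier N)"
abbreviation (input) "relations \<equiv> tensor_rel R \<rho> M N"
abbreviation (input) "relators \<equiv>
   {frag_of (m \<oplus>\<^bsub>M\<^esub> m', n) - frag_of (m, n) - frag_of (m', n) | m m' n.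
      m \<in> carrier M \<and> m' \<in> carrier M \<and> n \<in> carrier N} \<union>
   {frag_of (m, n \<oplus>\<^bsub>N\<^esub> n') - frag_of (m, n) - frag_of (m, n') | m n n'.
      m \<in> carrier M \<and> n \<in> carrier N \<and> n' \<in> carrier N} \<union>
   {frag_of (\<rho> m r, n) - frag_of (m, r \<odot>\<^bsub>N\<^esub> n) | m r n.
      m \<in> carrier M \<and> r \<in> carrier R \<and> n \<in> carrier N}"

lemma keys_diff_subset:
  assumes "Poly_Mapping.keys a \<subseteq> S" "Poly_Mapping.keys b \<subseteq> S"
  shows "Poly_Mapping.keys (a - b) \<subseteq> S"
  using keys_diff[of a b] assms by blast

lemma relators_closed: "relators \<subseteq> carrier free_group"
proof -
  have frag: "frag_of (m, n) \<in> carrier free_group" if "m \<in> carrier M" "n \<in> carrier N" for m n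
    using that by simp
  have diff: "a - b \<in> carrier free_group"
    if "a \<in> carrier free_group" "b \<in> carrier free_group" for a b
    using that keys_diff_subset by simp
  show ?thesis
    using frag diff right_closed left_closed
    by (auto simp del: carrier_free_Abelian_group_iff)
qed

lemma tensor_rel_subgroup: "subgroup relations free_group"
  unfolding tensor_rel_def
  by (rule group.generate_is_subgroup[OF group_free_Abelian_group relators_closed])

lemma tensor_rel_normal: "relations \<lhd> free_group"
  by (simp add: comm_group.normal_iff_subgroup[OF abelian_free_Abelian_group] tensor_rel_subgroup)

lemma carrier_tensor_module:
  "carrier (tensor_module R \<rho> \<sigma> M N) = (\<lambda>c. relations #>\<^bsub>free_group\<^esub> c) ` carrier free_group"
  by (auto simp: tensor_module_def tensor_group_def Let_def FactGroup_def RCOSETS_def)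

lemma add_tensor_module:
  "s \<oplus>\<^bsub>tensor_module R \<rho> \<sigma> M N\<^esub> t = s \<otimes>\<^bsub>free_group Mod relations\<^esub> t"
  "\<zero>\<^bsub>tensor_module R \<rho> \<sigma> M N\<^esub> = \<one>\<^bsub>free_group Mod relations\<^esub>"
  "carrier (tensor_module R \<rho> \<sigma> M N) = carrier (free_group Mod relations)"
  by (simp_all add: tensor_module_def tensor_group_def Let_def)

lemma abelian_group_tensor_module: "abelian_group (tensor_module R \<rho> \<sigma> M N)"
proof -
  interpret Q: comm_group "free_group Mod relations"
    by (rule comm_group.abelian_FactGroup[OF abelian_free_Abelian_group tensor_rel_subgroup])
  note [simp del] = mult_FactGroup one_FactGroup
  show ?thesis
  proof (rule abelian_groupI)
    fix x assume "x \<in> carrier (tensor_module R \<rho> \<sigma> M N)"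
    then show "\<exists>y\<in>carrier (tensor_module R \<rho> \<sigma> M N).
        y \<oplus>\<^bsub>tensor_module R \<rho> \<sigma> M N\<^esub> x = \<zero>\<^bsub>tensor_module R \<rho> \<sigma> M N\<^esub>"
      unfolding add_tensor_module using Q.l_inv Q.inv_closed by blast
  qed (simp_all add: add_tensor_module Q.m_ac)
qed

lemma coset_additive:
  "(\<lambda>c. relations #>\<^bsub>free_group\<^esub> c) \<in>
     hom free_group (add_monoid (tensor_module R \<rho> \<sigma> M N))"
  using normal.r_coset_hom_Mod[OF tensor_rel_normal] by (simp add: hom_def add_tensor_module)

lemma pure_tensor_closed:
  assumes "m \<in> carrier M" "n \<in> carrier N"
  shows "pure_tensor R \<rho> M N m n \<in> carrier (tensor_module R \<rho> \<sigma> M N)"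
  using assms unfolding pure_tensor_def carrier_tensor_module by (intro imageI) simp

text \<open>
  Pairs generate the formal sums under subtraction, so an additive subgroup containing the pure
  tensors is everything.
\<close>

lemma tensor_induct:
  assumes H: "additive_subgroup H (tensor_module R \<rho> \<sigma> M N)"
    and pure: "\<And>m n. \<lbrakk>m \<in> carrier M; n \<in> carrier N\<rbrakk> \<Longrightarrow> pure_tensor R \<rho> M N m n \<in> H"
    and t: "t \<in> carrier (tensor_module R \<rho> \<sigma> M N)"
  shows "t \<in> H"
proof -
  let ?T = "tensor_module R \<rho> \<sigma> M N" and ?q = "\<lambda>c. relations #>\<^bsub>free_group\<^esub> c"
  interpret H: additive_subgroup H ?T by fact
  interpret q: group_hom free_group "add_monoid ?T" ?q
    using coset_additive[of \<sigma>] abelian_group.a_group[OF abelian_group_tensor_module[of \<sigma>]]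
    by (simp add: group_hom_def group_hom_axioms_def)
  have "?q c \<in> H" if "Poly_Mapping.keys c \<subseteq> carrier M \<times> carrier N" for c
    using that
  proof (rule free_Abelian_group_induct)
    show "?q 0 \<in> H" using q.hom_one by simp
  next
    fix x y :: "'m \<times> 'n \<Rightarrow>\<^sub>0 int"
    assume 2: "Poly_Mapping.keys x \<subseteq> carrier M \<times> carrier N"
      "Poly_Mapping.keys y \<subseteq> carrier M \<times> carrier N" "?q x \<in> H" "?q y \<in> H"
    have "?q (x - y) = ?q x \<oplus>\<^bsub>?T\<^esub> (\<ominus>\<^bsub>?T\<^esub> ?q y)"
      using 2 q.hom_mult[of x "-y"] q.hom_inv[of y] by (simp add: a_inv_def)
    then show "?q (x - y) \<in> H" using 2 H.a_inv_closed H.a_closed by simp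
  next
    fix a assume "a \<in> carrier M \<times> carrier N"
    then show "?q (frag_of a) \<in> H" using pure[of "fst a" "snd a"] by (auto simp: pure_tensor_def)
  qed
  with t show ?thesis by (auto simp: carrier_tensor_module)
qed

lemma additive_map_eq_on_tensors:
  assumes "abelian_group G" "f \<in> additive_map (tensor_module R \<rho> \<sigma> M N) G"
    and "g \<in> additive_map (tensor_module R \<rho> \<sigma> M N) G"
    and "\<And>m n. \<lbrakk>m \<in> carrier M; n \<in> carrier N\<rbrakk> \<Longrightarrow>
           f (pure_tensor R \<rho> M N m n) = g (pure_tensor R \<rho> M N m n)"
    and "t \<in> carrier (tensor_module R \<rho> \<sigma> M N)"
  shows "f t = g t"
  using tensor_induct[OF additive_subgroup_equalizer[OF abelian_group_tensor_module assms(1-3)]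
      _ assms(5)] assms(4) pure_tensor_closed[of _ _ \<sigma>] by auto

text \<open>
  A balanced map extended to formal sums kills the defining relations, so it is constant on cosets
  and the value chosen by \<^const>\<open>the_elem\<close> is the value at any representative.
\<close>

lemma tensor_lift_coset:
  assumes G: "abelian_group G" and f: "balanced R \<rho> M N G f" and c: "c \<in> carrier free_group"
  shows "tensor_lift G f (relations #>\<^bsub>free_group\<^esub> c)
       = free_extension (add_monoid G) (\<lambda>p. f (fst p) (snd p)) c"
proof -
  interpret G: abelian_group G by fact
  let ?e = "free_extension (add_monoid G) (\<lambda>p. f (fst p) (snd p))"
  note fD = balancedD[OF f]
  have hom: "?e \<in> hom free_group (add_monoid G)"
    by (rule comm_group.free_extension_hom[OF G.a_comm_group]) (auto simp: fD)
  interpret e: group_hom free_group "add_monoid G" ?e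
    using hom G.a_group by (simp add: group_hom_def group_hom_axioms_def)
  have frag: "?e (frag_of (m, n)) = f m n" if "m \<in> carrier M" "n \<in> carrier N" for m n
    using comm_group.free_extension_frag_of[OF G.a_comm_group, of "\<lambda>p. f (fst p) (snd p)" "(m, n)"]
      that fD(1) by simp
  have diff: "?e (a - b) = ?e a \<ominus>\<^bsub>G\<^esub> ?e b"
    if "a \<in> carrier free_group" "b \<in> carrier free_group" for a b
    using that e.hom_mult[of a "-b"] e.hom_inv[of b] by (simp add: a_minus_def a_inv_def)
  have diff_closed: "a - b \<in> carrier free_group"
    if "a \<in> carrier free_group" "b \<in> carrier free_group" for a b
    using that keys_diff_subset by simp
  have fr: "frag_of (m, n) \<in> carrier free_group" if "m \<in> carrier M" "n \<in> carrier N" for m n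
    using that by simp
  have ker: "subgroup {c \<in> carrier free_group. ?e c = \<zero>\<^bsub>G\<^esub>} free_group"
    using e.subgroup_kernel by (simp add: kernel_def)
  have add_cancel: "(x \<oplus>\<^bsub>G\<^esub> y) \<ominus>\<^bsub>G\<^esub> x \<ominus>\<^bsub>G\<^esub> y = \<zero>\<^bsub>G\<^esub>"
    if "x \<in> carrier G" "y \<in> carrier G" for x y
  proof -
    have "(x \<oplus>\<^bsub>G\<^esub> y) \<ominus>\<^bsub>G\<^esub> x \<ominus>\<^bsub>G\<^esub> y = (x \<oplus>\<^bsub>G\<^esub> y) \<oplus>\<^bsub>G\<^esub> \<ominus>\<^bsub>G\<^esub> (x \<oplus>\<^bsub>G\<^esub> y)"
      using that by (simp add: G.minus_eq G.minus_add G.a_assoc)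
    then show ?thesis using that by (simp add: G.r_neg)
  qed
  have "relations \<subseteq> {c \<in> carrier free_group. ?e c = \<zero>\<^bsub>G\<^esub>}"
    unfolding tensor_rel_def
  proof (rule group.generate_subgroup_incl[OF group_free_Abelian_group _ ker], rule subsetI)
    fix x
    assume x: "x \<in> relators"
    then have "x \<in> carrier free_group" using relators_closed by blast
    moreover have "?e x = \<zero>\<^bsub>G\<^esub>"
      using x fD add_cancel
      by (auto simp: diff diff_closed fr frag right_closed left_closed G.minus_eq G.r_neg
          simp del: carrier_free_Abelian_group_iff)
    ultimately show "x \<in> {c \<in> carrier free_group. ?e c = \<zero>\<^bsub>G\<^esub>}" by simp
  qed
  then have "?e (h \<otimes>\<^bsub>free_group\<^esub> c) = ?e c" if "h \<in> relations" for h
    using that c e.hom_mult[of h c] e.hom_closed[OF c] by (auto simp del: mult_free_Abelian_group)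
  moreover have "relations \<noteq> {}"
    using subgroup.one_closed[OF tensor_rel_subgroup] by auto
  ultimately have "?e ` (relations #>\<^bsub>free_group\<^esub> c) = {?e c}"
    by (auto simp: r_coset_def image_iff)
  moreover have "tensor_lift G f t = the_elem (?e ` t)" for t
    by (simp add: tensor_lift_def free_extension_def finsum_def add_pow_def)
  ultimately show ?thesis by simp
qed

lemma tensor_lift_pure:
  assumes G: "abelian_group G" and f: "balanced R \<rho> M N G f"
    and mn: "m \<in> carrier M" "n \<in> carrier N"
  shows "tensor_lift G f (pure_tensor R \<rho> M N m n) = f m n"
  using mn comm_group.free_extension_frag_of[OF abelian_group.a_comm_group[OF G],
      of "\<lambda>p. f (fst p) (snd p)" "(m, n)"] balancedD(1)[OF f mn]
  by (simp add: pure_tensor_def tensor_lift_coset[OF G f])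

lemma tensor_lift_additive:
  assumes G: "abelian_group G" and f: "balanced R \<rho> M N G f"
  shows "tensor_lift G f \<in> additive_map (tensor_module R \<rho> \<sigma> M N) G"
proof -
  let ?e = "free_extension (add_monoid G) (\<lambda>p. f (fst p) (snd p))"
  let ?T = "tensor_module R \<rho> \<sigma> M N" and ?q = "\<lambda>c. relations #>\<^bsub>free_group\<^esub> c"
  interpret G: abelian_group G by fact
  have hom: "?e \<in> hom free_group (add_monoid G)"
    by (rule comm_group.free_extension_hom[OF G.a_comm_group]) (auto simp: balancedD[OF f])
  note lift = tensor_lift_coset[OF G f]
  show ?thesis
  proof (rule additive_mapI)
    fix s t assume s: "s \<in> carrier ?T" and t: "t \<in> carrier ?T"
    obtain c d where c: "c \<in> carrier free_group" "s = ?q c" and d: "d \<in> carrier free_group" "t = ?q d"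
      using s t unfolding carrier_tensor_module by blast
    have cd: "c \<otimes>\<^bsub>free_group\<^esub> d \<in> carrier free_group"
      using c d monoid.m_closed[OF group.is_monoid[OF group_free_Abelian_group]] by blast
    have "s \<oplus>\<^bsub>?T\<^esub> t = ?q (c \<otimes>\<^bsub>free_group\<^esub> d)"
      using hom_mult[OF coset_additive[of \<sigma>] c(1) d(1)] c d by simp
    then show "tensor_lift G f (s \<oplus>\<^bsub>?T\<^esub> t) = tensor_lift G f s \<oplus>\<^bsub>G\<^esub> tensor_lift G f t"
      using lift[OF cd] lift[OF c(1)] lift[OF d(1)] hom_mult[OF hom c(1) d(1)] c d by simp
  next
    fix t assume "t \<in> carrier ?T"
    then show "tensor_lift G f t \<in> carrier G"
      using hom_in_carrier[OF hom] lift unfolding carrier_tensor_module by auto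
  qed
qed

lemma pure_tensor_balanced:
  "balanced R \<rho> M N (tensor_module R \<rho> \<sigma> M N) (pure_tensor R \<rho> M N)"
proof -
  let ?T = "tensor_module R \<rho> \<sigma> M N" and ?q = "\<lambda>c. relations #>\<^bsub>free_group\<^esub> c"
  interpret T: abelian_group ?T by (rule abelian_group_tensor_module)
  interpret q: group_hom free_group "add_monoid ?T" ?q
    using coset_additive[of \<sigma>] T.a_group by (simp add: group_hom_def group_hom_axioms_def)
  have fr: "frag_of (m, n) \<in> carrier free_group" if "m \<in> carrier M" "n \<in> carrier N" for m n
    using that by simp
  have rel: "?q a = ?q b" if "a \<in> carrier free_group" "b \<in> carrier free_group" "a - b \<in> relations"
    for a b
  proof -
    have "a = (a - b) \<otimes>\<^bsub>free_group\<^esub> b" by simp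
    then have "a \<in> ?q b" using that(3) unfolding r_coset_def by blast
    then show ?thesis
      using group.repr_independence[OF group_free_Abelian_group _ that(2) tensor_rel_subgroup] by simp
  qed
  have add: "?q (a + b) = ?q a \<oplus>\<^bsub>?T\<^esub> ?q b"
    if "a \<in> carrier free_group" "b \<in> carrier free_group" for a b
    using q.hom_mult[OF that] by simp
  have add_closed: "a + b \<in> carrier free_group"
    if "a \<in> carrier free_group" "b \<in> carrier free_group" for a b
    using monoid.m_closed[OF group.is_monoid[OF group_free_Abelian_group] that] by simp
  show ?thesis
  proof (rule balancedI)
    fix m m' n assume mn: "m \<in> carrier M" "m' \<in> carrier M" "n \<in> carrier N"
    have "frag_of (m \<oplus>\<^bsub>M\<^esub> m', n) - (frag_of (m, n) + frag_of (m', n)) \<in> relations"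
      unfolding tensor_rel_def diff_diff_eq[symmetric] using mn by (intro generate.incl) blast
    then have "?q (frag_of (m \<oplus>\<^bsub>M\<^esub> m', n)) = ?q (frag_of (m, n) + frag_of (m', n))"
      using mn by (intro rel fr add_closed) auto
    then show "pure_tensor R \<rho> M N (m \<oplus>\<^bsub>M\<^esub> m') n
        = pure_tensor R \<rho> M N m n \<oplus>\<^bsub>?T\<^esub> pure_tensor R \<rho> M N m' n"
      using add[OF fr fr] mn by (simp add: pure_tensor_def)
  next
    fix m n n' assume mn: "m \<in> carrier M" "n \<in> carrier N" "n' \<in> carrier N"
    have "frag_of (m, n \<oplus>\<^bsub>N\<^esub> n') - (frag_of (m, n) + frag_of (m, n')) \<in> relations"
      unfolding tensor_rel_def diff_diff_eq[symmetric] using mn by (intro generate.incl) blast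
    then have "?q (frag_of (m, n \<oplus>\<^bsub>N\<^esub> n')) = ?q (frag_of (m, n) + frag_of (m, n'))"
      using mn by (intro rel fr add_closed) auto
    then show "pure_tensor R \<rho> M N m (n \<oplus>\<^bsub>N\<^esub> n')
        = pure_tensor R \<rho> M N m n \<oplus>\<^bsub>?T\<^esub> pure_tensor R \<rho> M N m n'"
      using add[OF fr fr] mn by (simp add: pure_tensor_def)
  next
    fix m r n assume mn: "m \<in> carrier M" "r \<in> carrier R" "n \<in> carrier N"
    have "frag_of (\<rho> m r, n) - frag_of (m, r \<odot>\<^bsub>N\<^esub> n) \<in> relations"
      unfolding tensor_rel_def using mn by (intro generate.incl) blast
    then show "pure_tensor R \<rho> M N (\<rho> m r) n = pure_tensor R \<rho> M N m (r \<odot>\<^bsub>N\<^esub> n)"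
      unfolding pure_tensor_def using mn right_closed left_closed by (intro rel fr) auto
  qed (rule pure_tensor_closed)
qed

lemma smult_tensor_module:
  "s \<odot>\<^bsub>tensor_module R \<rho> \<sigma> M N\<^esub> t
     = tensor_lift (tensor_module R \<rho> \<sigma> M N) (\<lambda>m n. pure_tensor R \<rho> M N (\<sigma> s m) n) t"
  by (simp add: tensor_module_def tensor_lift_def Let_def finsum_def add_pow_def finprod_def
      int_pow_def nat_pow_def m_inv_def cong: if_cong)

text \<open>A left multiplication that commutes with the right action descends to the tensor product.\<close>

lemma smult_tensor:
  assumes closed: "\<And>m. m \<in> carrier M \<Longrightarrow> \<sigma> s m \<in> carrier M"
    and add: "\<And>m m'. \<lbrakk>m \<in> carrier M; m' \<in> carrier M\<rbrakk> \<Longrightarrow> \<sigma> s (m \<oplus>\<^bsub>M\<^esub> m') = \<sigma> s m \<oplus>\<^bsub>M\<^esub> \<sigma> s m'"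
    and comm: "\<And>m r. \<lbrakk>m \<in> carrier M; r \<in> carrier R\<rbrakk> \<Longrightarrow> \<sigma> s (\<rho> m r) = \<rho> (\<sigma> s m) r"
  shows "(\<lambda>t. s \<odot>\<^bsub>tensor_module R \<rho> \<sigma> M N\<^esub> t)
           \<in> additive_map (tensor_module R \<rho> \<sigma> M N) (tensor_module R \<rho> \<sigma> M N)"
    and "\<lbrakk>m \<in> carrier M; n \<in> carrier N\<rbrakk> \<Longrightarrow>
           s \<odot>\<^bsub>tensor_module R \<rho> \<sigma> M N\<^esub> pure_tensor R \<rho> M N m n = pure_tensor R \<rho> M N (\<sigma> s m) n"
proof -
  let ?T = "tensor_module R \<rho> \<sigma> M N"
  note pD = balancedD[OF pure_tensor_balanced[of \<sigma>]]
  have "balanced R \<rho> M N ?T (\<lambda>m n. pure_tensor R \<rho> M N (\<sigma> s m) n)"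
    by (rule balancedI) (auto simp: closed add comm pD right_closed left_closed)
  from tensor_lift_additive[OF abelian_group_tensor_module this]
    tensor_lift_pure[OF abelian_group_tensor_module this]
  show "(\<lambda>t. s \<odot>\<^bsub>?T\<^esub> t) \<in> additive_map ?T ?T"
    and "\<lbrakk>m \<in> carrier M; n \<in> carrier N\<rbrakk> \<Longrightarrow>
      s \<odot>\<^bsub>?T\<^esub> pure_tensor R \<rho> M N m n = pure_tensor R \<rho> M N (\<sigma> s m) n"
    by (simp_all add: smult_tensor_module)
qed

end

section \<open>Homomorphisms, quotients and simple modules\<close>

context left_module
begin

lemma smult_additive: "a \<in> carrier R \<Longrightarrow> (\<lambda>x. a \<odot>\<^bsub>M\<^esub> x) \<in> additive_map M M"
  by (rule additive_mapI) (auto simp: smult_closed smult_r_distr)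

lemma smult_additive_left: "x \<in> carrier M \<Longrightarrow> (\<lambda>a. a \<odot>\<^bsub>M\<^esub> x) \<in> additive_map R M"
  by (rule additive_mapI) (auto simp: smult_closed smult_l_distr)

lemma smult_zero: "a \<in> carrier R \<Longrightarrow> a \<odot>\<^bsub>M\<^esub> \<zero>\<^bsub>M\<^esub> = \<zero>\<^bsub>M\<^esub>"
  using additive_map_zero[OF M.abelian_group_axioms M.abelian_group_axioms smult_additive] .

lemma zero_smult: "x \<in> carrier M \<Longrightarrow> \<zero> \<odot>\<^bsub>M\<^esub> x = \<zero>\<^bsub>M\<^esub>"
  using additive_map_zero[OF R.abelian_group_axioms M.abelian_group_axioms smult_additive_left] .

lemma smult_minus_one: "x \<in> carrier M \<Longrightarrow> (\<ominus> \<one>) \<odot>\<^bsub>M\<^esub> x = \<ominus>\<^bsub>M\<^esub> x"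
  using additive_map_a_inv[OF R.abelian_group_axioms M.abelian_group_axioms smult_additive_left,
      of x \<one>] by (simp add: smult_one)

lemma submoduleI:
  assumes "H \<subseteq> carrier M" "\<zero>\<^bsub>M\<^esub> \<in> H"
    and "\<And>x y. \<lbrakk>x \<in> H; y \<in> H\<rbrakk> \<Longrightarrow> x \<oplus>\<^bsub>M\<^esub> y \<in> H"
    and smult: "\<And>a x. \<lbrakk>a \<in> carrier R; x \<in> H\<rbrakk> \<Longrightarrow> a \<odot>\<^bsub>M\<^esub> x \<in> H"
  shows "submodule H R M"
proof (intro submodule.intro submodule_axioms.intro)
  have "\<ominus>\<^bsub>M\<^esub> x \<in> H" if "x \<in> H" for x
    using smult[of "\<ominus> \<one>" x] smult_minus_one[of x] that assms(1) by auto
  then show "subgroup H (add_monoid M)"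
    using M.additive_subgroupI'[OF assms(1-3)] by (simp add: additive_subgroup_def)
qed (rule smult)

lemma submoduleD:
  assumes "submodule H R M"
  shows "additive_subgroup H M"
    and "x \<in> H \<Longrightarrow> x \<in> carrier M"
    and "\<zero>\<^bsub>M\<^esub> \<in> H"
    and "\<lbrakk>x \<in> H; y \<in> H\<rbrakk> \<Longrightarrow> x \<oplus>\<^bsub>M\<^esub> y \<in> H"
    and "\<lbrakk>a \<in> carrier R; x \<in> H\<rbrakk> \<Longrightarrow> a \<odot>\<^bsub>M\<^esub> x \<in> H"
proof -
  show H: "additive_subgroup H M"
    using assms by (simp add: additive_subgroup_def submodule_def)
  interpret H: additive_subgroup H M by fact
  show "x \<in> H \<Longrightarrow> x \<in> carrier M" "\<zero>\<^bsub>M\<^esub> \<in> H"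
    "\<lbrakk>x \<in> H; y \<in> H\<rbrakk> \<Longrightarrow> x \<oplus>\<^bsub>M\<^esub> y \<in> H" using H.a_subset by auto
  show "\<lbrakk>a \<in> carrier R; x \<in> H\<rbrakk> \<Longrightarrow> a \<odot>\<^bsub>M\<^esub> x \<in> H"
    using submodule.smult_closed[OF assms] .
qed

lemma submodule_carrier: "submodule (carrier M) R M"
  by (rule submoduleI) (auto simp: smult_closed)

lemma left_module_submodule:
  assumes "submodule H R M"
  shows "left_module R (M\<lparr>carrier := H\<rparr>)"
proof -
  interpret H: submodule H R M by fact
  have "abelian_group (M\<lparr>carrier := H\<rparr>)"
  proof (rule abelian_groupI)
    fix x assume "x \<in> carrier (M\<lparr>carrier := H\<rparr>)"
    then show "\<exists>y\<in>carrier (M\<lparr>carrier := H\<rparr>). y \<oplus>\<^bsub>M\<lparr>carrier := H\<rparr>\<^esub> x = \<zero>\<^bsub>M\<lparr>carrier := H\<rparr>\<^esub>"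
      using additive_subgroup.a_inv_closed[OF submoduleD(1)[OF assms], of x] M.l_neg
        submoduleD(2)[OF assms] by auto
  qed (use submoduleD[OF assms] in \<open>auto simp: M.a_ac\<close>)
  then show ?thesis
    unfolding left_module_def left_module_axioms_def
    using submoduleD[OF assms] R.ring_axioms
    by (auto simp: smult_l_distr smult_r_distr smult_assoc smult_one)
qed

end

lemma lmod_homI:
  assumes "h \<in> additive_map M N"
    and "\<And>r x. \<lbrakk>r \<in> carrier R; x \<in> carrier M\<rbrakk> \<Longrightarrow> h (r \<odot>\<^bsub>M\<^esub> x) = r \<odot>\<^bsub>N\<^esub> h x"
  shows "h \<in> lmod_hom R M N"
  using assms by (auto simp: lmod_hom_def hom_def)

lemma lmod_homD:
  assumes "h \<in> lmod_hom R M N"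
  shows "h \<in> additive_map M N"
    and "x \<in> carrier M \<Longrightarrow> h x \<in> carrier N"
    and "\<lbrakk>x \<in> carrier M; y \<in> carrier M\<rbrakk> \<Longrightarrow> h (x \<oplus>\<^bsub>M\<^esub> y) = h x \<oplus>\<^bsub>N\<^esub> h y"
    and "\<lbrakk>r \<in> carrier R; x \<in> carrier M\<rbrakk> \<Longrightarrow> h (r \<odot>\<^bsub>M\<^esub> x) = r \<odot>\<^bsub>N\<^esub> h x"
  using assms by (auto simp: lmod_hom_def hom_def)

lemma lmod_hom_zero:
  assumes "left_module R M" "left_module R N" "h \<in> lmod_hom R M N"
  shows "h \<zero>\<^bsub>M\<^esub> = \<zero>\<^bsub>N\<^esub>"
  using assms additive_map_zero[OF _ _ lmod_homD(1)[OF assms(3)]] by (simp add: left_module_def)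

lemma lmod_hom_comp:
  assumes "f \<in> lmod_hom R M N" "g \<in> lmod_hom R N P"
  shows "(\<lambda>x. g (f x)) \<in> lmod_hom R M P"
  using additive_map_comp[OF lmod_homD(1)[OF assms(1)] lmod_homD(1)[OF assms(2)]]
    lmod_homD[OF assms(1)] lmod_homD[OF assms(2)] by (intro lmod_homI) auto

lemma lmod_iso_id: "(\<lambda>x. x) \<in> lmod_iso R M M"
  by (auto simp: lmod_iso_def lmod_hom_def bij_betw_def inj_on_def)

lemma lmod_iso_comp:
  assumes "f \<in> lmod_iso R M N" "g \<in> lmod_iso R N P"
  shows "(\<lambda>x. g (f x)) \<in> lmod_iso R M P"
  using assms lmod_hom_comp[of f R M N g P] bij_betw_trans[of f "carrier M" "carrier N" g]
  by (auto simp: lmod_iso_def comp_def)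

lemma lmod_iso_inv:
  assumes M: "left_module R M" and f: "f \<in> lmod_iso R M N"
  shows "inv_into (carrier M) f \<in> lmod_iso R N M"
proof -
  interpret M: left_module R M by fact
  let ?g = "inv_into (carrier M) f"
  have hom: "f \<in> lmod_hom R M N" and bij: "bij_betw f (carrier M) (carrier N)"
    using f by (auto simp: lmod_iso_def)
  note fD = lmod_homD[OF hom]
  have gf: "?g (f x) = x" if "x \<in> carrier M" for x
    using bij that by (auto simp: bij_betw_def)
  have fg: "f (?g y) = y" and gc: "?g y \<in> carrier M" if "y \<in> carrier N" for y
    using bij that by (auto simp: bij_betw_def f_inv_into_f inv_into_into)
  have "?g \<in> lmod_hom R N M"
  proof (intro lmod_homI additive_mapI)
    fix x y assume "x \<in> carrier N" "y \<in> carrier N"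
    then have "f (?g x \<oplus>\<^bsub>M\<^esub> ?g y) = x \<oplus>\<^bsub>N\<^esub> y" using fD fg gc by simp
    then show "?g (x \<oplus>\<^bsub>N\<^esub> y) = ?g x \<oplus>\<^bsub>M\<^esub> ?g y"
      using gf[of "?g x \<oplus>\<^bsub>M\<^esub> ?g y"] gc \<open>x \<in> _\<close> \<open>y \<in> _\<close> by simp
  next
    fix r x assume "r \<in> carrier R" "x \<in> carrier N"
    then have "f (r \<odot>\<^bsub>M\<^esub> ?g x) = r \<odot>\<^bsub>N\<^esub> x" using fD fg gc by simp
    then show "?g (r \<odot>\<^bsub>N\<^esub> x) = r \<odot>\<^bsub>M\<^esub> ?g x"
      using gf[of "r \<odot>\<^bsub>M\<^esub> ?g x"] gc \<open>r \<in> _\<close> \<open>x \<in> _\<close> M.smult_closed by simp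
  qed (rule gc)
  then show ?thesis using bij_betw_inv_into[OF bij] by (simp add: lmod_iso_def)
qed

text \<open>
  The module axioms are inherited by images under maps that preserve the operations.  Quotients
  and transported copies are both of this kind.
\<close>

lemma left_module_image:
  assumes M: "left_module R M"
    and h: "h ` carrier M = carrier N"
    and h_add: "\<And>x y. \<lbrakk>x \<in> carrier M; y \<in> carrier M\<rbrakk> \<Longrightarrow> h (x \<oplus>\<^bsub>M\<^esub> y) = h x \<oplus>\<^bsub>N\<^esub> h y"
    and h_zero: "h \<zero>\<^bsub>M\<^esub> = \<zero>\<^bsub>N\<^esub>"
    and h_smult: "\<And>r x. \<lbrakk>r \<in> carrier R; x \<in> carrier M\<rbrakk> \<Longrightarrow> h (r \<odot>\<^bsub>M\<^esub> x) = r \<odot>\<^bsub>N\<^esub> h x"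
  shows "left_module R N"
proof -
  interpret M: left_module R M by fact
  have N: "\<exists>x\<in>carrier M. y = h x" if "y \<in> carrier N" for y using that h by blast
  have hN: "h x \<in> carrier N" if "x \<in> carrier M" for x using that h by blast
  have "abelian_group N"
  proof (rule abelian_groupI)
    show "\<zero>\<^bsub>N\<^esub> \<in> carrier N" using hN h_zero by force
  next
    fix x y assume "x \<in> carrier N" "y \<in> carrier N"
    then obtain a b where "a \<in> carrier M" "b \<in> carrier M" "x = h a" "y = h b" using N[of x] N[of y] by auto
    then show "x \<oplus>\<^bsub>N\<^esub> y \<in> carrier N" and "x \<oplus>\<^bsub>N\<^esub> y = y \<oplus>\<^bsub>N\<^esub> x"
      using M.M.a_comm[of a b] by (simp_all flip: h_add add: hN)
  next
    fix x y z assume "x \<in> carrier N" "y \<in> carrier N" "z \<in> carrier N"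
    then obtain a b c where "a \<in> carrier M" "b \<in> carrier M" "c \<in> carrier M"
      "x = h a" "y = h b" "z = h c" using N[of x] N[of y] N[of z] by auto
    then show "x \<oplus>\<^bsub>N\<^esub> y \<oplus>\<^bsub>N\<^esub> z = x \<oplus>\<^bsub>N\<^esub> (y \<oplus>\<^bsub>N\<^esub> z)"
      by (simp flip: h_add add: M.M.a_assoc)
  next
    fix x assume "x \<in> carrier N"
    then obtain a where a: "a \<in> carrier M" "x = h a" using N[of x] by auto
    then show "\<zero>\<^bsub>N\<^esub> \<oplus>\<^bsub>N\<^esub> x = x" by (simp flip: h_add h_zero)
    have "h (\<ominus>\<^bsub>M\<^esub> a) \<in> carrier N" "h (\<ominus>\<^bsub>M\<^esub> a) \<oplus>\<^bsub>N\<^esub> x = \<zero>\<^bsub>N\<^esub>"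
      using a by (simp_all flip: h_add h_zero add: hN M.M.l_neg)
    then show "\<exists>y\<in>carrier N. y \<oplus>\<^bsub>N\<^esub> x = \<zero>\<^bsub>N\<^esub>" by blast
  qed
  moreover have "left_module_axioms R N"
  proof
    fix a b x assume "a \<in> carrier R" "b \<in> carrier R" "x \<in> carrier N"
    moreover from this obtain m where "m \<in> carrier M" "x = h m" using N[of x] by auto
    ultimately show "(a \<oplus>\<^bsub>R\<^esub> b) \<odot>\<^bsub>N\<^esub> x = a \<odot>\<^bsub>N\<^esub> x \<oplus>\<^bsub>N\<^esub> b \<odot>\<^bsub>N\<^esub> x"
      and "(a \<otimes>\<^bsub>R\<^esub> b) \<odot>\<^bsub>N\<^esub> x = a \<odot>\<^bsub>N\<^esub> (b \<odot>\<^bsub>N\<^esub> x)"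
      by (simp_all flip: h_add h_smult add: M.smult_closed M.smult_l_distr M.smult_assoc)
  next
    fix a x y assume "a \<in> carrier R" "x \<in> carrier N" "y \<in> carrier N"
    moreover from this obtain m n where "m \<in> carrier M" "x = h m" "n \<in> carrier M" "y = h n"
      using N[of x] N[of y] by auto
    ultimately show "a \<odot>\<^bsub>N\<^esub> (x \<oplus>\<^bsub>N\<^esub> y) = a \<odot>\<^bsub>N\<^esub> x \<oplus>\<^bsub>N\<^esub> a \<odot>\<^bsub>N\<^esub> y"
      and "a \<odot>\<^bsub>N\<^esub> x \<in> carrier N"
      by (simp_all flip: h_add h_smult add: hN M.smult_closed M.smult_r_distr)
  next
    fix x assume "x \<in> carrier N"
    then obtain m where "m \<in> carrier M" "x = h m" using N[of x] by auto
    then show "\<one>\<^bsub>R\<^esub> \<odot>\<^bsub>N\<^esub> x = x" by (simp flip: h_smult add: M.smult_one)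
  qed
  ultimately show ?thesis using M.R.ring_axioms by (simp add: left_module_def)
qed

lemma submodule_kernel:
  assumes "left_module R M" "left_module R N" "h \<in> lmod_hom R M N"
  shows "submodule {x \<in> carrier M. h x = \<zero>\<^bsub>N\<^esub>} R M"
proof -
  interpret M: left_module R M by fact
  interpret N: left_module R N by fact
  show ?thesis
    using lmod_homD[OF assms(3)] lmod_hom_zero[OF assms]
    by (intro M.submoduleI) (auto simp: M.smult_closed N.smult_zero)
qed

lemma submodule_vimage:
  assumes "left_module R M" "left_module R N" "h \<in> lmod_hom R M N" "submodule H R N"
  shows "submodule {x \<in> carrier M. h x \<in> H} R M"
proof -
  interpret M: left_module R M by fact
  interpret N: left_module R N by fact
  show ?thesis
    using lmod_homD[OF assms(3)] lmod_hom_zero[OF assms(1-3)] N.submoduleD[OF assms(4)]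
    by (intro M.submoduleI) (auto simp: M.smult_closed)
qed

lemma submodule_image:
  assumes "left_module R M" "left_module R N" "h \<in> lmod_hom R M N" "submodule H R M"
  shows "submodule (h ` H) R N"
proof -
  interpret M: left_module R M by fact
  interpret N: left_module R N by fact
  note H = M.submoduleD[OF assms(4)]
  note h = lmod_homD[OF assms(3)]
  show ?thesis
  proof (rule N.submoduleI)
    show "\<zero>\<^bsub>N\<^esub> \<in> h ` H" using H(3) lmod_hom_zero[OF assms(1-3)] by (metis imageI)
    fix x y assume "x \<in> h ` H" "y \<in> h ` H"
    then obtain a b where "a \<in> H" "x = h a" "b \<in> H" "y = h b" by blast
    then show "x \<oplus>\<^bsub>N\<^esub> y \<in> h ` H"
      using H(2,4) h(3)[of a b] by (intro image_eqI[of _ h "a \<oplus>\<^bsub>M\<^esub> b"]) auto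
  next
    fix a x assume "a \<in> carrier R" "x \<in> h ` H"
    then obtain b where "b \<in> H" "x = h b" by blast
    then show "a \<odot>\<^bsub>N\<^esub> x \<in> h ` H"
      using \<open>a \<in> carrier R\<close> H(2,5) h(4)[of a b] by (intro image_eqI[of _ h "a \<odot>\<^bsub>M\<^esub> b"]) auto
  qed (use H(2) h(2) in auto)
qed

lemma lmod_hom_injI:
  assumes "left_module R M" "left_module R N" "h \<in> lmod_hom R M N"
    and ker: "\<And>x. \<lbrakk>x \<in> carrier M; h x = \<zero>\<^bsub>N\<^esub>\<rbrakk> \<Longrightarrow> x = \<zero>\<^bsub>M\<^esub>"
  shows "inj_on h (carrier M)"
proof (rule inj_onI)
  interpret M: left_module R M by fact
  interpret N: left_module R N by fact
  fix x y assume xy: "x \<in> carrier M" "y \<in> carrier M" "h x = h y"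
  have "h (x \<ominus>\<^bsub>M\<^esub> y) = h x \<ominus>\<^bsub>N\<^esub> h y"
    using additive_map_minus[OF M.M.abelian_group_axioms N.M.abelian_group_axioms
        lmod_homD(1)[OF assms(3)]] xy by blast
  then have "x \<ominus>\<^bsub>M\<^esub> y = \<zero>\<^bsub>M\<^esub>"
    using xy lmod_homD(2)[OF assms(3)] by (intro ker) (auto simp: N.M.r_neg a_minus_def)
  moreover have "x = (x \<ominus>\<^bsub>M\<^esub> y) \<oplus>\<^bsub>M\<^esub> y" using xy by (simp add: M.M.minus_eq M.M.a_assoc M.M.l_neg)
  ultimately show "x = y" using xy by simp
qed

lemma simple_moduleD:
  assumes "simple_module R M"
  shows "left_module R M" "carrier M \<noteq> {\<zero>\<^bsub>M\<^esub>}"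
    and "submodule N R M \<Longrightarrow> N = {\<zero>\<^bsub>M\<^esub>} \<or> N = carrier M"
  using assms by (auto simp: simple_module_def)

lemma simple_module_nonzero:
  assumes "simple_module R M"
  obtains v where "v \<in> carrier M" "v \<noteq> \<zero>\<^bsub>M\<^esub>"
proof -
  interpret left_module R M using simple_moduleD[OF assms] by blast
  show ?thesis using that simple_moduleD(2)[OF assms] M.zero_closed by blast
qed

text \<open>Schur's lemma.\<close>

lemma simple_module_hom_iso:
  assumes M: "simple_module R M" and N: "simple_module R N" and h: "h \<in> lmod_hom R M N"
    and v: "v \<in> carrier M" "h v \<noteq> \<zero>\<^bsub>N\<^esub>"
  shows "h \<in> lmod_iso R M N"
proof -
  note lm = simple_moduleD(1)[OF M] simple_moduleD(1)[OF N]
  interpret M: left_module R M by (rule lm)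
  have "{x \<in> carrier M. h x = \<zero>\<^bsub>N\<^esub>} = {\<zero>\<^bsub>M\<^esub>}"
    using simple_moduleD(3)[OF M submodule_kernel[OF lm h]] v by blast
  then have "inj_on h (carrier M)" by (intro lmod_hom_injI[OF lm h]) blast
  moreover have "h ` carrier M = carrier N"
    using simple_moduleD(3)[OF N submodule_image[OF lm h M.submodule_carrier]] v by blast
  ultimately show ?thesis using h by (simp add: lmod_iso_def bij_betw_def)
qed

lemma simple_module_iso:
  assumes M: "simple_module R M" and N: "left_module R N" and h: "h \<in> lmod_iso R M N"
  shows "simple_module R N"
proof -
  note lm = simple_moduleD(1)[OF M] N
  have hom: "h \<in> lmod_hom R M N" and bij: "bij_betw h (carrier M) (carrier N)"
    using h by (auto simp: lmod_iso_def)
  have img: "h ` carrier M = carrier N" using bij by (simp add: bij_betw_def)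
  have h0: "h \<zero>\<^bsub>M\<^esub> = \<zero>\<^bsub>N\<^esub>" using lmod_hom_zero[OF lm hom] .
  interpret M: left_module R M by (rule lm)
  interpret N: left_module R N by (rule lm)
  obtain v where v: "v \<in> carrier M" "v \<noteq> \<zero>\<^bsub>M\<^esub>" using simple_module_nonzero[OF M] .
  have "h v \<noteq> \<zero>\<^bsub>N\<^esub>"
    using bij v h0 by (metis M.M.zero_closed bij_betw_def inj_on_eq_iff)
  then have "carrier N \<noteq> {\<zero>\<^bsub>N\<^esub>}" using v lmod_homD(2)[OF hom] by blast
  moreover have "H = {\<zero>\<^bsub>N\<^esub>} \<or> H = carrier N" if H: "submodule H R N" for H
  proof -
    have "H \<subseteq> h ` carrier M" using img N.submoduleD(2)[OF H] by blast
    then have "H = h ` {x \<in> carrier M. h x \<in> H}" by blast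
    moreover have "{x \<in> carrier M. h x \<in> H} = {\<zero>\<^bsub>M\<^esub>} \<or> {x \<in> carrier M. h x \<in> H} = carrier M"
      by (rule simple_moduleD(3)[OF M submodule_vimage[OF lm hom H]])
    ultimately show ?thesis using img h0 by auto
  qed
  ultimately show ?thesis using N by (simp add: simple_module_def)
qed

lemma simple_module_cyclic:
  assumes M: "simple_module R M" and v: "v \<in> carrier M" "v \<noteq> \<zero>\<^bsub>M\<^esub>" and m: "m \<in> carrier M"
  obtains a where "a \<in> carrier R" "m = a \<odot>\<^bsub>M\<^esub> v"
proof -
  interpret M: left_module R M by (rule simple_moduleD[OF M])
  have "submodule ((\<lambda>a. a \<odot>\<^bsub>M\<^esub> v) ` carrier R) R M"
  proof (rule M.submoduleI)
    show "\<zero>\<^bsub>M\<^esub> \<in> (\<lambda>a. a \<odot>\<^bsub>M\<^esub> v) ` carrier R"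
      using M.zero_smult[OF v(1)] M.R.zero_closed by (metis imageI)
  next
    fix x y assume "x \<in> (\<lambda>a. a \<odot>\<^bsub>M\<^esub> v) ` carrier R" "y \<in> (\<lambda>a. a \<odot>\<^bsub>M\<^esub> v) ` carrier R"
    then obtain a b where "a \<in> carrier R" "x = a \<odot>\<^bsub>M\<^esub> v" "b \<in> carrier R" "y = b \<odot>\<^bsub>M\<^esub> v" by blast
    then show "x \<oplus>\<^bsub>M\<^esub> y \<in> (\<lambda>a. a \<odot>\<^bsub>M\<^esub> v) ` carrier R"
      using v by (intro image_eqI[of _ _ "a \<oplus>\<^bsub>R\<^esub> b"]) (auto simp: M.smult_l_distr)
  next
    fix r x assume "r \<in> carrier R" "x \<in> (\<lambda>a. a \<odot>\<^bsub>M\<^esub> v) ` carrier R"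
    then obtain a where "a \<in> carrier R" "x = a \<odot>\<^bsub>M\<^esub> v" by blast
    then show "r \<odot>\<^bsub>M\<^esub> x \<in> (\<lambda>a. a \<odot>\<^bsub>M\<^esub> v) ` carrier R"
      using v \<open>r \<in> carrier R\<close> by (intro image_eqI[of _ _ "r \<otimes>\<^bsub>R\<^esub> a"]) (auto simp: M.smult_assoc)
  qed (use v M.smult_closed in auto)
  moreover have "v \<in> (\<lambda>a. a \<odot>\<^bsub>M\<^esub> v) ` carrier R"
    using M.smult_one[OF v(1)] by (metis imageI M.R.one_closed)
  ultimately have "(\<lambda>a. a \<odot>\<^bsub>M\<^esub> v) ` carrier R = carrier M"
    using simple_moduleD(3)[OF M] v by blast
  then show ?thesis using m that by blast
qed

text \<open>A simple module is a quotient of the ring, so it has a copy wherever the ring has one.\<close>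

lemma simple_module_copy:
  assumes M: "simple_module R M" and emb: "inj_on (emb :: 'r \<Rightarrow> 'u) (carrier R)"
  obtains N :: "('r, 'u) module" and f where "left_module R N" "f \<in> lmod_iso R M N"
proof -
  interpret M: left_module R M by (rule simple_moduleD[OF M])
  obtain v where v: "v \<in> carrier M" "v \<noteq> \<zero>\<^bsub>M\<^esub>" using simple_module_nonzero[OF M] .
  define a where "a m = (SOME a. a \<in> carrier R \<and> m = a \<odot>\<^bsub>M\<^esub> v)" for m
  have a: "a m \<in> carrier R \<and> m = a m \<odot>\<^bsub>M\<^esub> v" if m: "m \<in> carrier M" for m
  proof -
    have "\<exists>a. a \<in> carrier R \<and> m = a \<odot>\<^bsub>M\<^esub> v"
      by (rule simple_module_cyclic[OF M v m]) blast
    from someI_ex[OF this] show ?thesis unfolding a_def .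
  qed
  define f where "f m = emb (a m)" for m
  have inj: "inj_on f (carrier M)"
  proof (rule inj_onI)
    fix x y assume x: "x \<in> carrier M" and y: "y \<in> carrier M" and "f x = f y"
    then have "a x = a y" using a[OF x] a[OF y] emb by (auto simp: f_def dest: inj_onD)
    then show "x = y" using a[OF x] a[OF y] by metis
  qed
  define g where "g = inv_into (carrier M) f"
  have g: "g (f m) = m" if "m \<in> carrier M" for m using inj that by (simp add: g_def)
  define N :: "('r, 'u) module" where
    "N = \<lparr>carrier = f ` carrier M, monoid.mult = undefined, monoid.one = undefined,
      ring.zero = f \<zero>\<^bsub>M\<^esub>, ring.add = (\<lambda>x y. f (g x \<oplus>\<^bsub>M\<^esub> g y)),
      smult = (\<lambda>r x. f (r \<odot>\<^bsub>M\<^esub> g x))\<rparr>"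
  have "left_module R N"
    by (rule left_module_image[where h = f, OF M.left_module_axioms]) (auto simp: N_def g)
  moreover have "f \<in> lmod_iso R M N"
    using inj by (auto simp: lmod_iso_def lmod_hom_def bij_betw_def N_def g)
  ultimately show ?thesis by (rule that)
qed

lemma iso_class_eq:
  assumes M: "left_module R M" and f: "f \<in> lmod_iso R M N"
  shows "(iso_class R M :: ('r, 'u) module set) = iso_class R N"
proof -
  have "lmod_iso R M P \<noteq> {} \<longleftrightarrow> lmod_iso R N P \<noteq> {}" for P :: "('r, 'u) module"
    using lmod_iso_comp[OF f, of _ P] lmod_iso_comp[OF lmod_iso_inv[OF M f], of _ P] by blast
  then show ?thesis by (simp add: iso_class_def)
qed

lemma iso_class_eq_iso:
  assumes M: "left_module R M" and N: "left_module R N"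
    and P: "(P :: ('r, 'u) module) \<in> iso_class R M"
    and eq: "(iso_class R M :: ('r, 'u) module set) = iso_class R N"
  obtains f where "f \<in> lmod_iso R M N"
proof -
  have "P \<in> iso_class R N" using P eq by simp
  with P obtain f g where f: "f \<in> lmod_iso R M P" and g: "g \<in> lmod_iso R N P"
    unfolding iso_class_def by blast
  show ?thesis by (rule that[OF lmod_iso_comp[OF f lmod_iso_inv[OF N g]]])
qed

lemma iso_class_self: "left_module R M \<Longrightarrow> M \<in> iso_class R M"
  using lmod_iso_id by (auto simp: iso_class_def)

lemma quotient_module_proj:
  assumes M: "left_module R M" and N: "submodule N R M"
  shows "left_module R (quotient_module M N)"
    and "(\<lambda>x. N +>\<^bsub>M\<^esub> x) \<in> lmod_hom R M (quotient_module M N)"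
    and "(\<lambda>x. N +>\<^bsub>M\<^esub> x) ` carrier M = carrier (quotient_module M N)"
    and "x \<in> carrier M \<Longrightarrow> N +>\<^bsub>M\<^esub> x = \<zero>\<^bsub>quotient_module M N\<^esub> \<longleftrightarrow> x \<in> N"
proof -
  interpret M: left_module R M by fact
  interpret N: abelian_subgroup N M
    using M.submoduleD(1)[OF N] by (intro abelian_subgroupI3) (auto simp: M.M.abelian_group_axioms)
  let ?Q = "quotient_module M N" and ?q = "\<lambda>x. N +>\<^bsub>M\<^esub> x"
  have add: "?q (x \<oplus>\<^bsub>M\<^esub> y) = ?q x \<oplus>\<^bsub>?Q\<^esub> ?q y" if "x \<in> carrier M" "y \<in> carrier M" for x y
    using N.a_rcos_sum[OF that] by (simp add: quotient_module_def)
  have eq: "?q x = ?q y" if "x \<in> N +>\<^bsub>M\<^esub> y" "y \<in> carrier M" for x y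
    using M.M.a_repr_independence[OF that N.a_subgroup] by simp
  have smult: "?q (r \<odot>\<^bsub>M\<^esub> x) = r \<odot>\<^bsub>?Q\<^esub> ?q x" if r: "r \<in> carrier R" and x: "x \<in> carrier M" for r x
  proof -
    have "?q (r \<odot>\<^bsub>M\<^esub> y) = ?q (r \<odot>\<^bsub>M\<^esub> x)" if y: "y \<in> ?q x" for y
    proof (rule eq)
      obtain n where n: "n \<in> N" "y = n \<oplus>\<^bsub>M\<^esub> x" using y by (auto simp: a_r_coset_def')
      then have "r \<odot>\<^bsub>M\<^esub> y = r \<odot>\<^bsub>M\<^esub> n \<oplus>\<^bsub>M\<^esub> r \<odot>\<^bsub>M\<^esub> x"
        using M.smult_r_distr r x M.submoduleD(2)[OF N] by simp
      then show "r \<odot>\<^bsub>M\<^esub> y \<in> N +>\<^bsub>M\<^esub> (r \<odot>\<^bsub>M\<^esub> x)"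
        using M.submoduleD(5)[OF N r n(1)] by (auto simp: a_r_coset_def')
    qed (rule M.smult_closed[OF r x])
    moreover have "x \<in> ?q x" by (rule N.a_rcos_self[OF x])
    ultimately have "(\<Union>y\<in>?q x. ?q (r \<odot>\<^bsub>M\<^esub> y)) = ?q (r \<odot>\<^bsub>M\<^esub> x)"
      by (intro UN_constant_eq) blast+
    then show ?thesis by (simp add: quotient_module_def)
  qed
  have zero: "?q \<zero>\<^bsub>M\<^esub> = \<zero>\<^bsub>?Q\<^esub>"
    using M.submoduleD(2)[OF N] by (auto simp: quotient_module_def a_r_coset_def')
  show img: "?q ` carrier M = carrier ?Q"
    by (auto simp: quotient_module_def A_RCOSETS_def')
  show "left_module R ?Q" by (rule left_module_image[OF M img add zero smult])
  show "?q \<in> lmod_hom R M ?Q"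
  proof (intro lmod_homI additive_mapI)
    fix x assume "x \<in> carrier M"
    then show "?q x \<in> carrier ?Q" unfolding img[symmetric] by (rule imageI)
  qed (fact add, fact smult)
  assume x: "x \<in> carrier M"
  show "?q x = \<zero>\<^bsub>?Q\<^esub> \<longleftrightarrow> x \<in> N"
  proof
    assume "?q x = \<zero>\<^bsub>?Q\<^esub>"
    then show "x \<in> N" using N.a_rcos_self[OF x] by (simp add: quotient_module_def)
  next
    assume "x \<in> N"
    then have "?q x = N" by (rule N.a_rcos_const)
    then show "?q x = \<zero>\<^bsub>?Q\<^esub>" by (simp add: quotient_module_def)
  qed
qed

lemma simple_quotient:
  assumes M: "left_module R M" and N: "maximal_submodule N R M"
  shows "simple_module R (quotient_module M N)"
proof -
  interpret M: left_module R M by fact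
  let ?Q = "quotient_module M N" and ?q = "\<lambda>x. N +>\<^bsub>M\<^esub> x"
  have subN: "submodule N R M" and proper: "N \<noteq> carrier M" using N by (auto simp: maximal_submodule_def)
  note q = quotient_module_proj[OF M subN]
  interpret Q: left_module R ?Q by (rule q)
  have "N \<subseteq> carrier M" using M.submoduleD(2)[OF subN] by (rule subsetI)
  with proper obtain x where "x \<in> carrier M" "x \<notin> N" by blast
  then have "?q x \<noteq> \<zero>\<^bsub>?Q\<^esub>" "?q x \<in> carrier ?Q" using q(4)[of x] lmod_homD(2)[OF q(2)] by simp_all
  then have "carrier ?Q \<noteq> {\<zero>\<^bsub>?Q\<^esub>}" by auto
  moreover have "H = {\<zero>\<^bsub>?Q\<^esub>} \<or> H = carrier ?Q" if H: "submodule H R ?Q" for H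
  proof -
    let ?P = "{x \<in> carrier M. ?q x \<in> H}"
    have "H \<subseteq> ?q ` carrier M" unfolding q(3) using Q.submoduleD(2)[OF H] by (rule subsetI)
    then have H_img: "H = ?q ` ?P" by blast
    have "N \<subseteq> ?P"
    proof
      fix n assume "n \<in> N"
      moreover from this have "n \<in> carrier M" by (rule M.submoduleD(2)[OF subN])
      ultimately show "n \<in> ?P" using q(4)[of n] Q.submoduleD(3)[OF H] by simp
    qed
    then have cases: "?P = N \<or> ?P = carrier M"
      using N submodule_vimage[OF M q(1,2) H] unfolding maximal_submodule_def by blast
    have N_img: "?q ` N = {\<zero>\<^bsub>?Q\<^esub>}"
    proof -
      have "?q x = \<zero>\<^bsub>?Q\<^esub>" if "x \<in> N" for x using q(4)[OF M.submoduleD(2)[OF subN that]] that by blast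
      moreover have "\<zero>\<^bsub>M\<^esub> \<in> N" by (rule M.submoduleD(3)[OF subN])
      ultimately show ?thesis by force
    qed
    from cases show ?thesis
    proof
      assume "?P = N"
      then show ?thesis using H_img N_img by simp
    next
      assume "?P = carrier M"
      then show ?thesis using H_img q(3) by simp
    qed
  qed
  ultimately show ?thesis using q(1) by (simp add: simple_module_def)
qed

lemma left_module_restrict:
  assumes M: "left_module R M" and B: "subring B R"
  shows "left_module (R\<lparr>carrier := B\<rparr>) M"
proof -
  interpret M: left_module R M by fact
  show ?thesis
    using M.R.subring_is_ring[OF B] M.R.subring_iff subringE(1)[OF B] M.M.abelian_group_axioms
    unfolding left_module_def left_module_axioms_def
    by (auto simp: subset_iff M.smult_closed M.smult_l_distr M.smult_r_distr M.smult_assoc M.smult_one)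
qed

section \<open>Tensor products of vector spaces\<close>

text \<open>
  A fragment of the vector space axioms that passes to tensor products, so that tensor products
  can be iterated.
\<close>

locale scalar_space = abelian_group M
  for K :: "('k, 'x) ring_scheme" and M :: "('k, 'm, 'b) module_scheme" (structure) +
  assumes scal_closed: "\<lbrakk>c \<in> carrier K; x \<in> carrier M\<rbrakk> \<Longrightarrow> c \<odot> x \<in> carrier M"
    and scal_add: "\<lbrakk>c \<in> carrier K; x \<in> carrier M; y \<in> carrier M\<rbrakk> \<Longrightarrow> c \<odot> (x \<oplus> y) = c \<odot> x \<oplus> c \<odot> y"
    and scal_comm: "\<lbrakk>c \<in> carrier K; d \<in> carrier K; x \<in> carrier M\<rbrakk> \<Longrightarrow> c \<odot> (d \<odot> x) = d \<odot> (c \<odot> x)"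

locale vector_tensor = M: scalar_space K M + N: scalar_space K N
  for K :: "('k, 'x) ring_scheme" and M :: "('k, 'm, 'b) module_scheme"
    and N :: "('k, 'n, 'c) module_scheme"
begin

sublocale tensor_factors K "\<lambda>m c. c \<odot>\<^bsub>M\<^esub> m" M N
  by unfold_locales (auto simp: M.scal_closed N.scal_closed)

abbreviation vbalanced :: "('g, 'd) ring_scheme \<Rightarrow> ('m \<Rightarrow> 'n \<Rightarrow> 'g) \<Rightarrow> bool"
  where "vbalanced \<equiv> balanced K (\<lambda>m c. c \<odot>\<^bsub>M\<^esub> m) M N"

lemmas vtensor_induct = tensor_induct[of _ "smult M", folded vtensor_def vpure_def]
lemmas additive_map_eq_on_vtensors =
  additive_map_eq_on_tensors[of _ _ "smult M", folded vtensor_def vpure_def]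
lemmas vtensor_lift_pure = tensor_lift_pure[folded vpure_def]
lemmas vtensor_lift_additive = tensor_lift_additive[of _ _ "smult M", folded vtensor_def]
lemmas vpure_balanced = pure_tensor_balanced[of "smult M", folded vtensor_def vpure_def]
lemmas abelian_group_vtensor = abelian_group_tensor_module[of "smult M", folded vtensor_def]

lemma vtensor_smult_additive:
  assumes "c \<in> carrier K"
  shows "(\<lambda>t. c \<odot>\<^bsub>vtensor K M N\<^esub> t) \<in> additive_map (vtensor K M N) (vtensor K M N)"
  unfolding vtensor_def using assms
  by (intro smult_tensor) (auto simp: M.scal_closed M.scal_add M.scal_comm)

lemma vtensor_smult_pure:
  assumes "c \<in> carrier K" "m \<in> carrier M" "n \<in> carrier N"
  shows "c \<odot>\<^bsub>vtensor K M N\<^esub> vpure K M N m n = vpure K M N (c \<odot>\<^bsub>M\<^esub> m) n"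
  unfolding vtensor_def vpure_def using assms
  by (intro smult_tensor) (auto simp: M.scal_closed M.scal_add M.scal_comm)

lemma vpure_closed:
  "\<lbrakk>m \<in> carrier M; n \<in> carrier N\<rbrakk> \<Longrightarrow> vpure K M N m n \<in> carrier (vtensor K M N)"
  by (rule balancedD(1)[OF vpure_balanced])

lemma scalar_space_vtensor: "scalar_space K (vtensor K M N)"
proof -
  interpret T: abelian_group "vtensor K M N" by (rule abelian_group_vtensor)
  note add = vtensor_smult_additive
  show ?thesis
  proof
    fix c d t
    assume c: "c \<in> carrier K" and d: "d \<in> carrier K" and t: "t \<in> carrier (vtensor K M N)"
    show "c \<odot>\<^bsub>vtensor K M N\<^esub> (d \<odot>\<^bsub>vtensor K M N\<^esub> t) = d \<odot>\<^bsub>vtensor K M N\<^esub> (c \<odot>\<^bsub>vtensor K M N\<^esub> t)"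
      using c d
      by (intro additive_map_eq_on_vtensors[OF T.abelian_group_axioms
            additive_map_comp[OF add add] additive_map_comp[OF add add] _ t])
        (auto simp: vtensor_smult_pure M.scal_closed M.scal_comm)
  qed (use additive_map_closed[OF add] additive_map_add[OF add] in auto)
qed

lemma vtensor_lift_comp:
  assumes "abelian_group G" "abelian_group H" "vbalanced G f"
    and \<phi>: "\<phi> \<in> additive_map G H" and t: "t \<in> carrier (vtensor K M N)"
  shows "vbalanced H (\<lambda>m n. \<phi> (f m n))"
    and "\<phi> (tensor_lift G f t) = tensor_lift H (\<lambda>m n. \<phi> (f m n)) t"
proof -
  note fD = balancedD[OF assms(3)]
  show bal: "vbalanced H (\<lambda>m n. \<phi> (f m n))"
    using fD additive_map_closed[OF \<phi>] additive_map_add[OF \<phi>] by (intro balancedI) auto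
  show "\<phi> (tensor_lift G f t) = tensor_lift H (\<lambda>m n. \<phi> (f m n)) t"
    by (rule additive_map_eq_on_vtensors[OF assms(2)
          additive_map_comp[OF vtensor_lift_additive[OF assms(1,3)] \<phi>]
          vtensor_lift_additive[OF assms(2) bal] _ t])
      (simp add: vtensor_lift_pure[OF assms(1,3)] vtensor_lift_pure[OF assms(2) bal])
qed

lemma vtensor_lift_cong:
  assumes "abelian_group G" and f: "vbalanced G f"
    and eq: "\<And>m n. \<lbrakk>m \<in> carrier M; n \<in> carrier N\<rbrakk> \<Longrightarrow> f m n = g m n"
    and t: "t \<in> carrier (vtensor K M N)"
  shows "vbalanced G g"
    and "tensor_lift G f t = tensor_lift G g t"
proof -
  have g: "g m n = f m n" if "m \<in> carrier M" "n \<in> carrier N" for m n using eq[OF that] by simp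
  show bal: "vbalanced G g"
    using balancedD[OF f] by (intro balancedI) (auto simp: g M.scal_closed N.scal_closed)
  show "tensor_lift G f t = tensor_lift G g t"
    by (rule additive_map_eq_on_vtensors[OF assms(1) vtensor_lift_additive[OF assms(1) f]
          vtensor_lift_additive[OF assms(1) bal] _ t])
      (simp add: vtensor_lift_pure[OF assms(1) f] vtensor_lift_pure[OF assms(1) bal] eq)
qed

lemma vtensor_lift_sum:
  assumes G: "abelian_group G"
    and f: "vbalanced G f" and g: "vbalanced G g"
    and h: "\<And>m n. \<lbrakk>m \<in> carrier M; n \<in> carrier N\<rbrakk> \<Longrightarrow> h m n = f m n \<oplus>\<^bsub>G\<^esub> g m n"
    and t: "t \<in> carrier (vtensor K M N)"
  shows "tensor_lift G h t = tensor_lift G f t \<oplus>\<^bsub>G\<^esub> tensor_lift G g t"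
proof -
  interpret G: abelian_group G by fact
  interpret T: abelian_group "vtensor K M N" by (rule abelian_group_vtensor)
  note fD = balancedD[OF f] and gD = balancedD[OF g]
  have bal: "vbalanced G h"
    by (rule balancedI) (auto simp: h fD gD G.a_ac M.scal_closed N.scal_closed)
  note lf = vtensor_lift_additive[OF G f] and lg = vtensor_lift_additive[OF G g]
  have "(\<lambda>t. tensor_lift G f t \<oplus>\<^bsub>G\<^esub> tensor_lift G g t) \<in> additive_map (vtensor K M N) G"
    using additive_map_closed[OF lf] additive_map_closed[OF lg]
      additive_map_add[OF lf] additive_map_add[OF lg]
    by (intro additive_mapI) (auto simp: G.a_ac)
  from additive_map_eq_on_vtensors[OF G vtensor_lift_additive[OF G bal] this _ t] show ?thesis
    by (simp add: vtensor_lift_pure[OF G bal] vtensor_lift_pure[OF G f] vtensor_lift_pure[OF G g] h)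
qed

lemma vtensor_lift_smult:
  assumes G: "abelian_group G"
    and f: "vbalanced G f" and g: "vbalanced G g"
    and c: "c \<in> carrier K"
    and eq: "\<And>m n. \<lbrakk>m \<in> carrier M; n \<in> carrier N\<rbrakk> \<Longrightarrow> g m n = f (c \<odot>\<^bsub>M\<^esub> m) n"
    and t: "t \<in> carrier (vtensor K M N)"
  shows "tensor_lift G g t = tensor_lift G f (c \<odot>\<^bsub>vtensor K M N\<^esub> t)"
  by (rule additive_map_eq_on_vtensors[OF G vtensor_lift_additive[OF G g]
        additive_map_comp[OF vtensor_smult_additive[OF c] vtensor_lift_additive[OF G f]] _ t])
    (use c in \<open>simp add: vtensor_lift_pure[OF G f] vtensor_lift_pure[OF G g] vtensor_smult_pure
      M.scal_closed eq\<close>)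

end

section \<open>Sweedler calculus\<close>

context field_algebra
begin

lemma scalar_space: "scalar_space K A"
proof (intro scalar_space.intro scalar_space_axioms.intro)
  show "abelian_group A" by (rule M.abelian_group_axioms)
next
  fix c d x assume "c \<in> carrier K" "d \<in> carrier K" "x \<in> carrier A"
  then show "c \<odot>\<^bsub>A\<^esub> (d \<odot>\<^bsub>A\<^esub> x) = d \<odot>\<^bsub>A\<^esub> (c \<odot>\<^bsub>A\<^esub> x)"
    by (simp add: smult_assoc1[symmetric] K.m_comm)
qed (auto simp: smult_closed smult_r_distr)

lemma scalar_space_submodule:
  assumes "submodule B K A"
  shows "scalar_space K (A\<lparr>carrier := B\<rparr>)"
proof -
  interpret A: scalar_space K A by (rule scalar_space)
  interpret B: submodule B K A by fact
  interpret AB: module K "A\<lparr>carrier := B\<rparr>" by (rule B.submodule_is_module) (rule module_axioms)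
  have "x \<in> carrier A" if "x \<in> B" for x using B.subset that by auto
  then show ?thesis
    using B.smult_closed
    by (intro scalar_space.intro scalar_space_axioms.intro AB.abelian_group_axioms)
      (auto simp: A.scal_add A.scal_comm)
qed

end

context hopf_algebra
begin

abbreviation mult_A (infixl \<open>\<bullet>\<close> 70)
  where "x \<bullet> y \<equiv> x \<otimes>\<^bsub>A\<^esub> y"

abbreviation smult_A (infixr \<open>\<star>\<close> 75)
  where "c \<star> x \<equiv> c \<odot>\<^bsub>A\<^esub> x"

sublocale AA: vector_tensor K A A
  by (intro vector_tensor.intro scalar_space)

sublocale A_AA: vector_tensor K A "vtensor K A A"
  by (intro vector_tensor.intro scalar_space AA.scalar_space_vtensor)

sublocale AA_A: vector_tensor K "vtensor K A A" A
  by (intro vector_tensor.intro scalar_space AA.scalar_space_vtensor)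

abbreviation bilinear :: "('a \<Rightarrow> 'a \<Rightarrow> 'a) \<Rightarrow> bool"
  where "bilinear \<equiv> AA.vbalanced A"

text \<open>The value of the Sweedler sum \<open>\<Sum> f(a\<^sub>1, a\<^sub>2)\<close>.\<close>

abbreviation sweedler :: "('a \<Rightarrow> 'a \<Rightarrow> 'a) \<Rightarrow> 'a \<Rightarrow> 'a"
  where "sweedler f a \<equiv> tensor_lift A f (comult A a)"

lemmas A_group = M.abelian_group_axioms

lemma comult_additive: "comult A \<in> additive_map A (vtensor K A A)"
  by (rule lmod_homD(1)[OF comult_linear])

lemma comult_closed: "a \<in> carrier A \<Longrightarrow> comult A a \<in> carrier (vtensor K A A)"
  by (rule lmod_homD(2)[OF comult_linear])

lemma comult_smult:
  "\<lbrakk>c \<in> carrier K; a \<in> carrier A\<rbrakk> \<Longrightarrow> comult A (c \<star> a) = c \<odot>\<^bsub>vtensor K A A\<^esub> comult A a"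
  by (rule lmod_homD(4)[OF comult_linear])

lemma antipode_closed: "a \<in> carrier A \<Longrightarrow> antipode A a \<in> carrier A"
  and antipode_add: "\<lbrakk>a \<in> carrier A; b \<in> carrier A\<rbrakk> \<Longrightarrow>
    antipode A (a \<oplus>\<^bsub>A\<^esub> b) = antipode A a \<oplus>\<^bsub>A\<^esub> antipode A b"
  and antipode_smult: "\<lbrakk>c \<in> carrier K; a \<in> carrier A\<rbrakk> \<Longrightarrow>
    antipode A (c \<star> a) = c \<star> antipode A a"
  using lmod_homD[OF antipode_linear] by auto

lemma counit_closed: "a \<in> carrier A \<Longrightarrow> counit A a \<in> carrier K"
  and counit_add: "\<lbrakk>a \<in> carrier A; b \<in> carrier A\<rbrakk> \<Longrightarrow>
    counit A (a \<oplus>\<^bsub>A\<^esub> b) = counit A a \<oplus>\<^bsub>K\<^esub> counit A b"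
  and counit_mult: "\<lbrakk>a \<in> carrier A; b \<in> carrier A\<rbrakk> \<Longrightarrow>
    counit A (a \<bullet> b) = counit A a \<otimes>\<^bsub>K\<^esub> counit A b"
  and counit_one: "counit A \<one>\<^bsub>A\<^esub> = \<one>\<^bsub>K\<^esub>"
  using counit_hom by (auto simp: ring_hom_def)

text \<open>
  Scalars pass between neighbouring arguments: this is what it takes to factor through an iterated
  tensor product.
\<close>

definition trilinear :: "('a \<Rightarrow> 'a \<Rightarrow> 'a \<Rightarrow> 'a) \<Rightarrow> bool"
  where "trilinear g \<longleftrightarrow>
    (\<forall>a\<in>carrier A. \<forall>b\<in>carrier A. g a b \<in> additive_map A A \<and>
       (\<lambda>x. g a x b) \<in> additive_map A A \<and> (\<lambda>x. g x a b) \<in> additive_map A A) \<and>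
    (\<forall>c\<in>carrier K. \<forall>x\<in>carrier A. \<forall>y\<in>carrier A. \<forall>z\<in>carrier A.
       g (c \<star> x) y z = g x (c \<star> y) z \<and> g x (c \<star> y) z = g x y (c \<star> z))"

text \<open>
  Coassociativity in the form \<open>\<Sum> g(a\<^sub>1\<^sub>1, a\<^sub>1\<^sub>2, a\<^sub>2) = \<Sum> g(a\<^sub>1, a\<^sub>2\<^sub>1, a\<^sub>2\<^sub>2)\<close>: a trilinear map
  factors through \<open>A \<otimes> (A \<otimes> A)\<close>, and its two composites with the sides of the coassociativity
  axiom are these two sums.
\<close>

lemma sweedler_coassoc:
  assumes g: "trilinear g"
  shows "bilinear (\<lambda>y z. sweedler (\<lambda>u v. g u v z) y)"
    and "bilinear (\<lambda>y z. sweedler (g y) z)"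
    and "a \<in> carrier A \<Longrightarrow>
      sweedler (\<lambda>y z. sweedler (\<lambda>u v. g u v z) y) a = sweedler (\<lambda>y z. sweedler (g y) z) a"
proof -
  let ?V = "vtensor K A A" and ?p = "vpure K A A"
  let ?W = "vtensor K A ?V" and ?q = "vpure K A ?V"
  let ?W' = "vtensor K ?V A" and ?q' = "vpure K ?V A"
  note V = AA.abelian_group_vtensor and W = A_AA.abelian_group_vtensor
    and W' = AA_A.abelian_group_vtensor
  note closed = AA.M.scal_closed AA.M.scal_add comult_closed
  have gc: "g x y z \<in> carrier A"
    if "x \<in> carrier A" "y \<in> carrier A" "z \<in> carrier A" for x y z
    using g that unfolding trilinear_def by (auto dest: additive_map_closed)
  have ga: "g x y (z \<oplus>\<^bsub>A\<^esub> z') = g x y z \<oplus>\<^bsub>A\<^esub> g x y z'"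
    "g x (z \<oplus>\<^bsub>A\<^esub> z') y = g x z y \<oplus>\<^bsub>A\<^esub> g x z' y"
    "g (z \<oplus>\<^bsub>A\<^esub> z') x y = g z x y \<oplus>\<^bsub>A\<^esub> g z' x y"
    if "x \<in> carrier A" "y \<in> carrier A" "z \<in> carrier A" "z' \<in> carrier A" for x y z z'
    using g that unfolding trilinear_def by (auto simp: hom_def)
  have gs: "g (c \<star> x) y z = g x (c \<star> y) z" "g x (c \<star> y) z = g x y (c \<star> z)"
    if "c \<in> carrier K" "x \<in> carrier A" "y \<in> carrier A" "z \<in> carrier A" for c x y z
    using g that unfolding trilinear_def by auto
  have b1: "bilinear (g y)" if "y \<in> carrier A" for y
    using that by (intro balancedI) (auto simp: gc ga gs)
  have b2: "bilinear (\<lambda>u v. g u v z)" if "z \<in> carrier A" for z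
    using that by (intro balancedI) (auto simp: gc ga gs)
  note l1 = AA.vtensor_lift_additive[OF A_group b1] and l2 = AA.vtensor_lift_additive[OF A_group b2]
  have g1s: "tensor_lift A (g (c \<star> y)) t = tensor_lift A (g y) (c \<odot>\<^bsub>?V\<^esub> t)"
    if "c \<in> carrier K" "y \<in> carrier A" "t \<in> carrier ?V" for c y t
    using that by (intro AA.vtensor_lift_smult[OF A_group]) (auto simp: b1 closed gs)
  have g2s: "tensor_lift A (\<lambda>u v. g u v (c \<star> z)) t = tensor_lift A (\<lambda>u v. g u v z) (c \<odot>\<^bsub>?V\<^esub> t)"
    if "c \<in> carrier K" "z \<in> carrier A" "t \<in> carrier ?V" for c z t
    using that by (intro AA.vtensor_lift_smult[OF A_group]) (auto simp: b2 closed gs)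
  have g1a: "tensor_lift A (g (y \<oplus>\<^bsub>A\<^esub> y')) t = tensor_lift A (g y) t \<oplus>\<^bsub>A\<^esub> tensor_lift A (g y') t"
    if "y \<in> carrier A" "y' \<in> carrier A" "t \<in> carrier ?V" for y y' t
    using that by (intro AA.vtensor_lift_sum[OF A_group]) (auto simp: b1 ga)
  have g2a: "tensor_lift A (\<lambda>u v. g u v (z \<oplus>\<^bsub>A\<^esub> z')) t
      = tensor_lift A (\<lambda>u v. g u v z) t \<oplus>\<^bsub>A\<^esub> tensor_lift A (\<lambda>u v. g u v z') t"
    if "z \<in> carrier A" "z' \<in> carrier A" "t \<in> carrier ?V" for z z' t
    using that by (intro AA.vtensor_lift_sum[OF A_group]) (auto simp: b2 ga)
  note lc = additive_map_closed[OF l1] additive_map_closed[OF l2]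
    and la = additive_map_add[OF l1] additive_map_add[OF l2]
  note \<Delta>a = additive_map_add[OF comult_additive]
  show bal1: "bilinear (\<lambda>y z. sweedler (\<lambda>u v. g u v z) y)"
    by (rule balancedI) (auto simp: comult_closed lc la g2a g2s comult_smult \<Delta>a)
  show bal2: "bilinear (\<lambda>y z. sweedler (g y) z)"
    by (rule balancedI) (auto simp: comult_closed lc la g1a g1s comult_smult \<Delta>a)
  define F where "F = tensor_lift A (\<lambda>u s. tensor_lift A (g u) s)"
  have balF: "A_AA.vbalanced A (\<lambda>u s. tensor_lift A (g u) s)"
    by (rule balancedI) (auto simp: lc la g1a g1s)
  have F: "F \<in> additive_map ?W A"
    unfolding F_def by (rule A_AA.vtensor_lift_additive[OF A_group balF])
  have Fp: "F (?q u s) = tensor_lift A (g u) s" if "u \<in> carrier A" "s \<in> carrier ?V" for u s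
    unfolding F_def by (rule A_AA.vtensor_lift_pure[OF A_group balF that])
  define h where "h t c = tensor_lift ?W (\<lambda>u v. ?q u (?p v c)) t" for t c
  note pb = balancedD[OF AA.vpure_balanced] and qb = balancedD[OF A_AA.vpure_balanced]
    and qb' = balancedD[OF AA_A.vpure_balanced]
  have balh: "AA.vbalanced ?W (\<lambda>u v. ?q u (?p v c))" if "c \<in> carrier A" for c
    using that by (intro balancedI) (auto simp: pb qb closed AA.vtensor_smult_pure)
  have lh: "(\<lambda>t. h t c) \<in> additive_map ?V ?W" if "c \<in> carrier A" for c
    unfolding h_def using AA.vtensor_lift_additive[OF W balh[OF that]] .
  have hs: "h (k \<odot>\<^bsub>?V\<^esub> t) c = h t (k \<star> c)"
    if "k \<in> carrier K" "c \<in> carrier A" "t \<in> carrier ?V" for k c t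
    unfolding h_def using that
    by (intro AA.vtensor_lift_smult[OF W, symmetric])
      (auto simp: balh closed qb pb AA.vtensor_smult_pure)
  have ha: "h t (c \<oplus>\<^bsub>A\<^esub> c') = h t c \<oplus>\<^bsub>?W\<^esub> h t c'"
    if "c \<in> carrier A" "c' \<in> carrier A" "t \<in> carrier ?V" for t c c'
    unfolding h_def using that
    by (intro AA.vtensor_lift_sum[OF W]) (auto simp: balh pb qb)
  have balassoc: "AA_A.vbalanced ?W h"
    by (rule balancedI)
      (auto simp: additive_map_closed[OF lh] additive_map_add[OF lh] ha hs)
  have assoc_eq: "tensor_assoc K A = tensor_lift ?W h"
    unfolding tensor_assoc_def Let_def h_def by (rule refl)
  note assoc = AA_A.vtensor_lift_additive[OF W balassoc, folded assoc_eq]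
  note assoc_pure = AA_A.vtensor_lift_pure[OF W balassoc, folded assoc_eq]
  have Fh: "F (h t z) = tensor_lift A (\<lambda>u v. g u v z) t"
    if t: "t \<in> carrier ?V" and z: "z \<in> carrier A" for t z
    by (rule AA.additive_map_eq_on_vtensors[OF A_group
          additive_map_comp[OF lh[OF z] F] l2[OF z] _ t])
      (use z in \<open>simp add: h_def AA.vtensor_lift_pure[OF W balh] AA.vtensor_lift_pure[OF A_group b2]
        AA.vtensor_lift_pure[OF A_group b1] Fp AA.vpure_closed\<close>)
  have balL: "AA.vbalanced ?W' (\<lambda>x y. ?q' (comult A x) y)"
    by (rule balancedI) (auto simp: comult_closed qb' \<Delta>a comult_smult)
  have balR: "AA.vbalanced ?W (\<lambda>x y. ?q x (comult A y))"
    by (rule balancedI) (auto simp: comult_closed qb \<Delta>a comult_smult)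
  assume a: "a \<in> carrier A"
  have "F (tensor_assoc K A (tensor_lift ?W' (\<lambda>x y. ?q' (comult A x) y) (comult A a)))
      = sweedler (\<lambda>y z. sweedler (\<lambda>u v. g u v z) y) a"
    by (rule AA.additive_map_eq_on_vtensors[OF A_group
          additive_map_comp[OF AA.vtensor_lift_additive[OF W' balL] additive_map_comp[OF assoc F]]
          AA.vtensor_lift_additive[OF A_group bal1] _ comult_closed[OF a]])
      (simp add: AA.vtensor_lift_pure[OF W' balL] AA.vtensor_lift_pure[OF A_group bal1]
        assoc_pure comult_closed Fh)
  moreover have "F (tensor_lift ?W (\<lambda>x y. ?q x (comult A y)) (comult A a))
      = sweedler (\<lambda>y z. sweedler (g y) z) a"
    by (rule AA.additive_map_eq_on_vtensors[OF A_group
          additive_map_comp[OF AA.vtensor_lift_additive[OF W balR] F]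
          AA.vtensor_lift_additive[OF A_group bal2] _ comult_closed[OF a]])
      (simp add: AA.vtensor_lift_pure[OF W balR] AA.vtensor_lift_pure[OF A_group bal2]
        comult_closed Fp)
  ultimately show "sweedler (\<lambda>y z. sweedler (\<lambda>u v. g u v z) y) a = sweedler (\<lambda>y z. sweedler (g y) z) a"
    using coassoc[OF a] by simp
qed

lemma mult_left_additive: "x \<in> carrier A \<Longrightarrow> (\<lambda>y. x \<bullet> y) \<in> additive_map A A"
  by (rule additive_mapI) (auto simp: A.r_distr)

lemma mult_right_additive: "x \<in> carrier A \<Longrightarrow> (\<lambda>y. y \<bullet> x) \<in> additive_map A A"
  by (rule additive_mapI) (auto simp: A.l_distr)

lemma counit_right_bilinear: "bilinear (\<lambda>y z. counit A z \<star> y)"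
  by (rule balancedI) (auto simp: counit_closed counit_add counit_smult smult_closed
      smult_r_distr smult_l_distr smult_assoc1 AA.M.scal_comm)

lemma counit_left_bilinear: "bilinear (\<lambda>y z. counit A y \<star> z)"
  by (rule balancedI) (auto simp: counit_closed counit_add counit_smult smult_closed
      smult_r_distr smult_l_distr smult_assoc1 AA.M.scal_comm)

lemma antipode_left_bilinear: "bilinear (\<lambda>y z. antipode A y \<bullet> z)"
  by (rule balancedI) (auto simp: antipode_closed antipode_add antipode_smult A.l_distr A.r_distr
      smult_mult_left smult_mult_right)

lemma antipode_right_bilinear: "bilinear (\<lambda>y z. y \<bullet> antipode A z)"
  by (rule balancedI) (auto simp: antipode_closed antipode_add antipode_smult A.l_distr A.r_distr
      smult_mult_left smult_mult_right)

lemma left_adjoint_bilinear: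
  "x \<in> carrier A \<Longrightarrow> bilinear (\<lambda>y z. y \<bullet> x \<bullet> antipode A z)"
  by (rule balancedI) (auto simp: antipode_closed antipode_add antipode_smult A.l_distr A.r_distr
      smult_mult_left smult_mult_right smult_closed)

lemma right_adjoint_bilinear:
  "x \<in> carrier A \<Longrightarrow> bilinear (\<lambda>y z. antipode A y \<bullet> x \<bullet> z)"
  by (rule balancedI) (auto simp: antipode_closed antipode_add antipode_smult A.l_distr A.r_distr
      smult_mult_left smult_mult_right smult_closed)

lemma trilinearI:
  assumes "\<And>x y z. \<lbrakk>x \<in> carrier A; y \<in> carrier A; z \<in> carrier A\<rbrakk> \<Longrightarrow> g x y z \<in> carrier A"
    and "\<And>x x' y z. \<lbrakk>x \<in> carrier A; x' \<in> carrier A; y \<in> carrier A; z \<in> carrier A\<rbrakk> \<Longrightarrow>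
      g (x \<oplus>\<^bsub>A\<^esub> x') y z = g x y z \<oplus>\<^bsub>A\<^esub> g x' y z"
    and "\<And>x y y' z. \<lbrakk>x \<in> carrier A; y \<in> carrier A; y' \<in> carrier A; z \<in> carrier A\<rbrakk> \<Longrightarrow>
      g x (y \<oplus>\<^bsub>A\<^esub> y') z = g x y z \<oplus>\<^bsub>A\<^esub> g x y' z"
    and "\<And>x y z z'. \<lbrakk>x \<in> carrier A; y \<in> carrier A; z \<in> carrier A; z' \<in> carrier A\<rbrakk> \<Longrightarrow>
      g x y (z \<oplus>\<^bsub>A\<^esub> z') = g x y z \<oplus>\<^bsub>A\<^esub> g x y z'"
    and "\<And>c x y z. \<lbrakk>c \<in> carrier K; x \<in> carrier A; y \<in> carrier A; z \<in> carrier A\<rbrakk> \<Longrightarrow>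
      g (c \<star> x) y z = g x (c \<star> y) z"
    and "\<And>c x y z. \<lbrakk>c \<in> carrier K; x \<in> carrier A; y \<in> carrier A; z \<in> carrier A\<rbrakk> \<Longrightarrow>
      g x (c \<star> y) z = g x y (c \<star> z)"
  shows "trilinear g"
  using assms by (auto simp: trilinear_def hom_def)

text \<open>
  Moving \<open>a\<close> past \<open>x\<close>: \<open>a x = \<Sum> (ad\<^sub>l a\<^sub>1)(x) a\<^sub>2\<close>, because
  \<open>\<Sum> a\<^sub>1 x S(a\<^sub>2) a\<^sub>3 = \<Sum> a\<^sub>1 x \<epsilon>(a\<^sub>2) = a x\<close>.
\<close>

lemma mult_eq_left_adjoint:
  assumes x: "x \<in> carrier A"
  shows "bilinear (\<lambda>y z. left_adjoint A y x \<bullet> z)"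
    and "a \<in> carrier A \<Longrightarrow> a \<bullet> x = sweedler (\<lambda>y z. left_adjoint A y x \<bullet> z) a"
proof -
  let ?g = "\<lambda>u v w. u \<bullet> x \<bullet> antipode A v \<bullet> w"
  have g: "trilinear ?g"
    using x by (intro trilinearI) (auto simp: antipode_closed antipode_add antipode_smult
        A.l_distr A.r_distr smult_mult_left smult_mult_right smult_closed)
  note co = sweedler_coassoc[OF g]
  have L: "sweedler (\<lambda>u v. ?g u v z) y = left_adjoint A y x \<bullet> z"
    if "y \<in> carrier A" "z \<in> carrier A" for y z
    unfolding left_adjoint_def
    using AA.vtensor_lift_comp(2)[OF A_group A_group left_adjoint_bilinear[OF x]
        mult_right_additive[OF that(2)] comult_closed[OF that(1)]] by simp
  have R: "sweedler (?g y) z = (counit A z \<star> y) \<bullet> x"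
    if y: "y \<in> carrier A" and z: "z \<in> carrier A" for y z
  proof -
    have yx: "y \<bullet> x \<in> carrier A" using x y by simp
    note comp = AA.vtensor_lift_comp[OF A_group A_group antipode_left_bilinear
        mult_left_additive[OF yx] comult_closed[OF z]]
    have "sweedler (?g y) z = sweedler (\<lambda>b c. (y \<bullet> x) \<bullet> (antipode A b \<bullet> c)) z"
      using x y z
      by (intro AA.vtensor_lift_cong(2)[OF A_group comp(1) _ comult_closed[OF z], symmetric])
        (simp add: A.m_assoc antipode_closed)
    also have "\<dots> = (y \<bullet> x) \<bullet> (counit A z \<star> \<one>\<^bsub>A\<^esub>)"
      using comp(2) antipode_left[OF z] by simp
    also have "\<dots> = (counit A z \<star> y) \<bullet> x"
      using x y z by (simp add: smult_mult_right smult_mult_left counit_closed)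
    finally show ?thesis .
  qed
  show "bilinear (\<lambda>y z. left_adjoint A y x \<bullet> z)"
    by (rule AA.vtensor_lift_cong(1)[OF A_group co(1) L comult_closed[OF M.zero_closed]])
  assume a: "a \<in> carrier A"
  have "sweedler (\<lambda>y z. left_adjoint A y x \<bullet> z) a = sweedler (\<lambda>y z. sweedler (\<lambda>u v. ?g u v z) y) a"
    by (rule AA.vtensor_lift_cong(2)[OF A_group co(1) L comult_closed[OF a], symmetric])
  also have "\<dots> = sweedler (\<lambda>y z. sweedler (?g y) z) a" by (rule co(3)[OF a])
  also have "\<dots> = sweedler (\<lambda>y z. (counit A z \<star> y) \<bullet> x) a"
    by (rule AA.vtensor_lift_cong(2)[OF A_group co(2) R comult_closed[OF a]])
  also have "\<dots> = a \<bullet> x"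
    using AA.vtensor_lift_comp(2)[OF A_group A_group counit_right_bilinear
        mult_right_additive[OF x] comult_closed[OF a]] counit_right[OF a] by simp
  finally show "a \<bullet> x = sweedler (\<lambda>y z. left_adjoint A y x \<bullet> z) a" by simp
qed

text \<open>
  The mirror image \<open>x a = \<Sum> a\<^sub>1 (ad\<^sub>r a\<^sub>2)(x)\<close>, from
  \<open>\<Sum> a\<^sub>1 S(a\<^sub>2) x a\<^sub>3 = \<Sum> \<epsilon>(a\<^sub>1) x a\<^sub>2 = x a\<close>.
\<close>

lemma mult_eq_right_adjoint:
  assumes x: "x \<in> carrier A"
  shows "bilinear (\<lambda>y z. y \<bullet> right_adjoint A z x)"
    and "a \<in> carrier A \<Longrightarrow> x \<bullet> a = sweedler (\<lambda>y z. y \<bullet> right_adjoint A z x) a"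
proof -
  let ?g = "\<lambda>u v w. u \<bullet> (antipode A v \<bullet> x \<bullet> w)"
  have g: "trilinear ?g"
    using x by (intro trilinearI) (auto simp: antipode_closed antipode_add antipode_smult
        A.l_distr A.r_distr smult_mult_left smult_mult_right smult_closed)
  note co = sweedler_coassoc[OF g]
  have R: "sweedler (?g y) z = y \<bullet> right_adjoint A z x"
    if "y \<in> carrier A" "z \<in> carrier A" for y z
    unfolding right_adjoint_def
    using AA.vtensor_lift_comp(2)[OF A_group A_group right_adjoint_bilinear[OF x]
        mult_left_additive[OF that(1)] comult_closed[OF that(2)]] by simp
  have L: "sweedler (\<lambda>u v. ?g u v z) y = x \<bullet> (counit A y \<star> z)"
    if y: "y \<in> carrier A" and z: "z \<in> carrier A" for y z
  proof -
    have xz: "x \<bullet> z \<in> carrier A" using x z by simp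
    note comp = AA.vtensor_lift_comp[OF A_group A_group antipode_right_bilinear
        mult_right_additive[OF xz] comult_closed[OF y]]
    have "sweedler (\<lambda>u v. ?g u v z) y = sweedler (\<lambda>b c. (b \<bullet> antipode A c) \<bullet> (x \<bullet> z)) y"
      using x y z
      by (intro AA.vtensor_lift_cong(2)[OF A_group comp(1) _ comult_closed[OF y], symmetric])
        (simp add: A.m_assoc antipode_closed)
    also have "\<dots> = (counit A y \<star> \<one>\<^bsub>A\<^esub>) \<bullet> (x \<bullet> z)"
      using comp(2) antipode_right[OF y] by simp
    also have "\<dots> = x \<bullet> (counit A y \<star> z)"
      using x y z by (simp add: smult_mult_right smult_mult_left counit_closed)
    finally show ?thesis .
  qed
  show "bilinear (\<lambda>y z. y \<bullet> right_adjoint A z x)"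
    by (rule AA.vtensor_lift_cong(1)[OF A_group co(2) R comult_closed[OF M.zero_closed]])
  assume a: "a \<in> carrier A"
  have "x \<bullet> a = sweedler (\<lambda>y z. x \<bullet> (counit A y \<star> z)) a"
    using AA.vtensor_lift_comp(2)[OF A_group A_group counit_left_bilinear
        mult_left_additive[OF x] comult_closed[OF a]] counit_left[OF a] by simp
  also have "\<dots> = sweedler (\<lambda>y z. sweedler (\<lambda>u v. ?g u v z) y) a"
    by (rule AA.vtensor_lift_cong(2)[OF A_group co(1) L comult_closed[OF a], symmetric])
  also have "\<dots> = sweedler (\<lambda>y z. sweedler (?g y) z) a" by (rule co(3)[OF a])
  also have "\<dots> = sweedler (\<lambda>y z. y \<bullet> right_adjoint A z x) a"
    by (rule AA.vtensor_lift_cong(2)[OF A_group co(2) R comult_closed[OF a]])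
  finally show "x \<bullet> a = sweedler (\<lambda>y z. y \<bullet> right_adjoint A z x) a" .
qed

text \<open>
  Over a Hopf subalgebra \<open>B\<close> the tensors \<open>a\<^sub>1 \<otimes> a\<^sub>2\<close> can be taken from \<open>B \<otimes> B\<close>, so a Sweedler
  sum stays in every additive subgroup containing the values of \<open>f\<close> on \<open>B\<close>.
\<close>

lemma sweedler_in_subgroup:
  assumes B: "hopf_subalgebra B K A" and a: "a \<in> B" and f: "bilinear f"
    and H: "additive_subgroup H A" and fH: "\<And>b c. \<lbrakk>b \<in> B; c \<in> B\<rbrakk> \<Longrightarrow> f b c \<in> H"
  shows "sweedler f a \<in> H"
proof -
  let ?B = "A\<lparr>carrier := B\<rparr>" and ?V = "vtensor K A A"
  have sub: "submodule B K A" using B by (simp add: hopf_subalgebra_def is_subalgebra_def)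
  have BA: "b \<in> carrier A" if "b \<in> B" for b
    using subgroup.subset[OF submodule.axioms(1)[OF sub]] that by auto
  interpret BB: vector_tensor K ?B ?B
    by (intro vector_tensor.intro scalar_space_submodule sub)
  note pb = balancedD[OF AA.vpure_balanced]
  have incl: "BB.vbalanced ?V (vpure K A A)"
    by (rule balancedI) (auto simp: pb BA)
  note V = AA.abelian_group_vtensor
  note l = additive_map_comp[OF BB.vtensor_lift_additive[OF V incl]
      AA.vtensor_lift_additive[OF A_group f]]
  obtain t where t: "t \<in> carrier (vtensor K ?B ?B)"
    "comult A a = tensor_lift ?V (vpure K A A) t"
    using B a unfolding hopf_subalgebra_def by blast
  have "t \<in> {t \<in> carrier (vtensor K ?B ?B). tensor_lift A f (tensor_lift ?V (vpure K A A) t) \<in> H}"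
    by (rule BB.vtensor_induct[OF additive_subgroup_vimage[OF BB.abelian_group_vtensor A_group l H] _ t(1)])
      (auto simp: BB.vpure_closed BB.vtensor_lift_pure[OF V incl] AA.vtensor_lift_pure[OF A_group f] BA fH)
  then show ?thesis using t(2) by simp
qed

end

section \<open>Powers of an ideal\<close>

context ring
begin

abbreviation ideal_power :: "'a set \<Rightarrow> 'a set \<Rightarrow> nat \<Rightarrow> 'a set"
  where "ideal_power B J k \<equiv> (ideal_prod (R\<lparr>carrier := B\<rparr>) J ^^ k) J"

lemma ideal_power_carrier:
  assumes J: "J \<subseteq> carrier R" and s: "s \<in> ideal_power B J k"
  shows "s \<in> carrier R"
  using s
proof (induction k arbitrary: s)
  case 0
  then show ?case using J by auto
next
  case (Suc k)
  have "s \<in> ideal_prod (R\<lparr>carrier := B\<rparr>) J (ideal_power B J k)" using Suc(2) by simp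
  then show ?case using J by (induction rule: ideal_prod.induct) (auto simp: Suc(1))
qed

lemma ideal_power_mult_left:
  "\<lbrakk>j \<in> J; s \<in> ideal_power B J k\<rbrakk> \<Longrightarrow> j \<otimes> s \<in> ideal_power B J (Suc k)"
  using ideal_prod.prod[of j J s "ideal_power B J k" "R\<lparr>carrier := B\<rparr>"] by simp

text \<open>
  The iterate multiplies by \<open>J\<close> on the left; associativity moves the new factor to the right.
\<close>

lemma ideal_power_mult_right:
  assumes J: "J \<subseteq> carrier R" and s: "s \<in> ideal_power B J k" and j: "j \<in> J"
  shows "s \<otimes> j \<in> ideal_power B J (Suc k)"
  using s
proof (induction k arbitrary: s)
  case 0
  then show ?case using ideal_power_mult_left[where j = s and s = j and J = J and B = B and k = 0] j by simp
next
  case (Suc k)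
  have jR: "j \<in> carrier R" using j J by blast
  have "s \<in> ideal_prod (R\<lparr>carrier := B\<rparr>) J (ideal_power B J k)" using Suc(2) by simp
  then have "s \<in> carrier R \<and> s \<otimes> j \<in> ideal_power B J (Suc (Suc k))"
  proof (induction rule: ideal_prod.induct)
    case (prod i u)
    have iu: "i \<in> carrier R" "u \<in> carrier R"
      using prod(1) J ideal_power_carrier[OF J prod(2)] by auto
    then show ?case
      using ideal_power_mult_left[OF prod(1) Suc(1)[OF prod(2)]] jR by (simp add: m_assoc)
  next
    case (sum u v)
    then show ?case
      using ideal_prod.sum[of "u \<otimes> j" "R\<lparr>carrier := B\<rparr>" J "ideal_power B J (Suc k)" "v \<otimes> j"] jR
      by (simp add: l_distr)
  qed
  then show ?case by simp
qed

end

section \<open>The projection onto the middle part\<close>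

lemma (in hopf_algebra) counit_additive: "counit A \<in> additive_map A K"
  by (rule additive_mapI) (auto simp: counit_closed counit_add)

lemma (in hopf_algebra) K_group: "abelian_group K"
  by (rule K.abelian_group_axioms)

lemma (in hopf_algebra) counit_zero: "counit A \<zero>\<^bsub>A\<^esub> = \<zero>\<^bsub>K\<^esub>"
  by (rule additive_map_zero[OF A_group K_group counit_additive])

text \<open>The counit is multiplicative with values in a field, so it kills nilpotent elements.\<close>

lemma (in hopf_algebra) counit_nilpotent_ideal:
  assumes J: "nilpotent_ideal J (A\<lparr>carrier := B\<rparr>)" and B: "B \<subseteq> carrier A" and x: "x \<in> J"
  shows "counit A x = \<zero>\<^bsub>K\<^esub>"
proof (rule ccontr)
  let ?P = "A.ideal_power B J"
  assume nz: "counit A x \<noteq> \<zero>\<^bsub>K\<^esub>"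
  have xA: "x \<in> carrier A"
    using J x B ideal.Icarr[of J "A\<lparr>carrier := B\<rparr>" x] by (auto simp: nilpotent_ideal_def)
  have "\<exists>y\<in>?P k. y \<in> carrier A \<and> counit A y \<noteq> \<zero>\<^bsub>K\<^esub>" for k
  proof (induction k)
    case 0
    then show ?case using x xA nz by auto
  next
    case (Suc k)
    then obtain y where y: "y \<in> ?P k" "y \<in> carrier A" "counit A y \<noteq> \<zero>\<^bsub>K\<^esub>" by blast
    have "x \<bullet> y \<in> ?P (Suc k)" by (rule A.ideal_power_mult_left[OF x y(1)])
    moreover have "counit A (x \<bullet> y) \<noteq> \<zero>\<^bsub>K\<^esub>"
      using xA y nz counit_closed K.integral by (auto simp: counit_mult)
    ultimately show ?case using xA y by blast
  qed
  moreover obtain n where "?P n = {\<zero>\<^bsub>A\<^esub>}" using J by (auto simp: nilpotent_ideal_def)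
  ultimately show False using counit_zero by (metis singletonD)
qed

context triangular_hopf_algebra
begin

abbreviation "B\<^sub>0 \<equiv> A\<lparr>carrier := A\<^sub>0\<rparr>"

lemma A0_subring: "subring A\<^sub>0 A" and A0_submodule: "submodule A\<^sub>0 K A"
  using A0_hopf by (auto simp: hopf_subalgebra_def is_subalgebra_def)

lemma Am_subring: "subring A\<^sub>m A" and Am_submodule: "submodule A\<^sub>m K A"
  using Am_subalgebra by (auto simp: is_subalgebra_def)

lemma Ap_subring: "subring A\<^sub>p A" and Ap_submodule: "submodule A\<^sub>p K A"
  using Ap_subalgebra by (auto simp: is_subalgebra_def)

lemma A0_carrier: "a \<in> A\<^sub>0 \<Longrightarrow> a \<in> carrier A" using subringE(1)[OF A0_subring] by blast
lemma Am_carrier: "x \<in> A\<^sub>m \<Longrightarrow> x \<in> carrier A" using subringE(1)[OF Am_subring] by blast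
lemma Ap_carrier: "y \<in> A\<^sub>p \<Longrightarrow> y \<in> carrier A" using subringE(1)[OF Ap_subring] by blast

lemma Jm_Am: "j \<in> J\<^sub>m \<Longrightarrow> j \<in> A\<^sub>m"
  using Jm_nilpotent ideal.Icarr[of J\<^sub>m "A\<lparr>carrier := A\<^sub>m\<rparr>" j] by (simp add: nilpotent_ideal_def)

lemma Jp_Ap: "j \<in> J\<^sub>p \<Longrightarrow> j \<in> A\<^sub>p"
  using Jp_nilpotent ideal.Icarr[of J\<^sub>p "A\<lparr>carrier := A\<^sub>p\<rparr>" j] by (simp add: nilpotent_ideal_def)

lemma Jm_carrier: "j \<in> J\<^sub>m \<Longrightarrow> j \<in> carrier A" using Jm_Am Am_carrier by blast
lemma Jp_carrier: "j \<in> J\<^sub>p \<Longrightarrow> j \<in> carrier A" using Jp_Ap Ap_carrier by blast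

lemma Jm_mult_Am: "\<lbrakk>j \<in> J\<^sub>m; x \<in> A\<^sub>m\<rbrakk> \<Longrightarrow> j \<bullet> x \<in> J\<^sub>m"
  using Jm_nilpotent ideal.I_r_closed[of J\<^sub>m "A\<lparr>carrier := A\<^sub>m\<rparr>" j x] by (simp add: nilpotent_ideal_def)

lemma Jp_mult_Ap: "\<lbrakk>j \<in> J\<^sub>p; x \<in> A\<^sub>p\<rbrakk> \<Longrightarrow> j \<bullet> x \<in> J\<^sub>p"
  using Jp_nilpotent ideal.I_r_closed[of J\<^sub>p "A\<lparr>carrier := A\<^sub>p\<rparr>" j x] by (simp add: nilpotent_ideal_def)

lemma counit_Jm: "j \<in> J\<^sub>m \<Longrightarrow> counit A j = \<zero>\<^bsub>K\<^esub>"
  using counit_nilpotent_ideal[OF Jm_nilpotent subringE(1)[OF Am_subring]] .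

lemma counit_Jp: "j \<in> J\<^sub>p \<Longrightarrow> counit A j = \<zero>\<^bsub>K\<^esub>"
  using counit_nilpotent_ideal[OF Jp_nilpotent subringE(1)[OF Ap_subring]] .

lemma one_A0: "\<one>\<^bsub>A\<^esub> \<in> A\<^sub>0" and one_Am: "\<one>\<^bsub>A\<^esub> \<in> A\<^sub>m" and one_Ap: "\<one>\<^bsub>A\<^esub> \<in> A\<^sub>p"
  using A0_subring Am_subring Ap_subring subringE(3) by blast+

lemma A0_mult: "\<lbrakk>a \<in> A\<^sub>0; b \<in> A\<^sub>0\<rbrakk> \<Longrightarrow> a \<bullet> b \<in> A\<^sub>0" using subringE(6)[OF A0_subring] .

lemma A0_smult: "\<lbrakk>c \<in> carrier K; a \<in> A\<^sub>0\<rbrakk> \<Longrightarrow> c \<star> a \<in> A\<^sub>0"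
  using submodule.smult_closed[OF A0_submodule] .

lemma A0_additive_subgroup: "additive_subgroup A\<^sub>0 A"
  using submodule.axioms(1)[OF A0_submodule] by (rule additive_subgroupI)

lemma counit_scalar_sum:
  assumes "c \<in> carrier K" "j \<in> carrier A" "counit A j = \<zero>\<^bsub>K\<^esub>"
  shows "counit A (c \<star> \<one>\<^bsub>A\<^esub> \<oplus>\<^bsub>A\<^esub> j) = c"
  using assms by (simp add: counit_add counit_smult counit_one)

lemma Am_split:
  assumes "x \<in> A\<^sub>m"
  obtains j where "j \<in> J\<^sub>m" "x = counit A x \<star> \<one>\<^bsub>A\<^esub> \<oplus>\<^bsub>A\<^esub> j"
proof -
  obtain c j where "c \<in> carrier K" "j \<in> J\<^sub>m" "x = c \<star> \<one>\<^bsub>A\<^esub> \<oplus>\<^bsub>A\<^esub> j"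
    using assms unfolding Am_direct_sum(1) set_add_def' scalars_def by blast
  then show ?thesis using that[of j] counit_scalar_sum[of c j] Jm_carrier counit_Jm by simp
qed

lemma Ap_split:
  assumes "y \<in> A\<^sub>p"
  obtains j where "j \<in> J\<^sub>p" "y = counit A y \<star> \<one>\<^bsub>A\<^esub> \<oplus>\<^bsub>A\<^esub> j"
proof -
  obtain c j where "c \<in> carrier K" "j \<in> J\<^sub>p" "y = c \<star> \<one>\<^bsub>A\<^esub> \<oplus>\<^bsub>A\<^esub> j"
    using assms unfolding Ap_direct_sum(1) set_add_def' scalars_def by blast
  then show ?thesis using that[of j] counit_scalar_sum[of c j] Jp_carrier counit_Jp by simp
qed

text \<open>
  Hence \<open>J\<^sub>m\<close> and \<open>J\<^sub>p\<close> are the augmentation ideals: the scalar part of an element is its counit.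
\<close>

lemma Jm_eq_counit_kernel: "\<lbrakk>x \<in> A\<^sub>m; counit A x = \<zero>\<^bsub>K\<^esub>\<rbrakk> \<Longrightarrow> x \<in> J\<^sub>m"
  by (rule Am_split[of x]) (use Jm_carrier smult_l_null in auto)

lemma Jp_eq_counit_kernel: "\<lbrakk>x \<in> A\<^sub>p; counit A x = \<zero>\<^bsub>K\<^esub>\<rbrakk> \<Longrightarrow> x \<in> J\<^sub>p"
  by (rule Ap_split[of x]) (use Jp_carrier smult_l_null in auto)

text \<open>
  The augmentation ideals are stable under the adjoint actions: the counit of
  \<open>\<Sum> a\<^sub>1 j S(a\<^sub>2)\<close> vanishes term by term.
\<close>

lemma left_adjoint_Jm:
  assumes a: "a \<in> A\<^sub>0" and j: "j \<in> J\<^sub>m"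
  shows "left_adjoint A a j \<in> J\<^sub>m"
proof (rule Jm_eq_counit_kernel[OF Am_left_stable[OF a Jm_Am[OF j]]])
  have "left_adjoint A a j \<in> {x \<in> carrier A. counit A x = \<zero>\<^bsub>K\<^esub>}"
    unfolding left_adjoint_def
    by (rule sweedler_in_subgroup[OF A0_hopf a left_adjoint_bilinear[OF Jm_carrier[OF j]]
          additive_subgroup_kernel[OF A_group K_group counit_additive]])
      (simp add: A0_carrier Jm_carrier[OF j] antipode_closed counit_mult counit_Jm[OF j] counit_closed)
  then show "counit A (left_adjoint A a j) = \<zero>\<^bsub>K\<^esub>" by simp
qed

lemma right_adjoint_Jp:
  assumes a: "a \<in> A\<^sub>0" and j: "j \<in> J\<^sub>p"
  shows "right_adjoint A a j \<in> J\<^sub>p"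
proof (rule Jp_eq_counit_kernel[OF Ap_right_stable[OF a Jp_Ap[OF j]]])
  have "right_adjoint A a j \<in> {x \<in> carrier A. counit A x = \<zero>\<^bsub>K\<^esub>}"
    unfolding right_adjoint_def
    by (rule sweedler_in_subgroup[OF A0_hopf a right_adjoint_bilinear[OF Jp_carrier[OF j]]
          additive_subgroup_kernel[OF A_group K_group counit_additive]])
      (simp add: A0_carrier Jp_carrier[OF j] antipode_closed counit_mult counit_Jp[OF j] counit_closed)
  then show "counit A (right_adjoint A a j) = \<zero>\<^bsub>K\<^esub>" by simp
qed

text \<open>The inclusion \<open>A\<^sub>0 J\<^sub>m \<subseteq> J\<^sub>m A\<^sub>0\<close>, tested against additive subgroups.\<close>

lemma A0_Jm_commute:
  assumes H: "additive_subgroup H A" and JH: "\<And>j b. \<lbrakk>j \<in> J\<^sub>m; b \<in> A\<^sub>0\<rbrakk> \<Longrightarrow> j \<bullet> b \<in> H"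
    and a: "a \<in> A\<^sub>0" and j: "j \<in> J\<^sub>m"
  shows "a \<bullet> j \<in> H"
  unfolding mult_eq_left_adjoint(2)[OF Jm_carrier[OF j] A0_carrier[OF a]]
  by (rule sweedler_in_subgroup[OF A0_hopf a mult_eq_left_adjoint(1)[OF Jm_carrier[OF j]] H])
    (rule JH[OF left_adjoint_Jm[OF _ j]])

lemma Jp_A0_commute:
  assumes H: "additive_subgroup H A" and JH: "\<And>b j. \<lbrakk>b \<in> A\<^sub>0; j \<in> J\<^sub>p\<rbrakk> \<Longrightarrow> b \<bullet> j \<in> H"
    and a: "a \<in> A\<^sub>0" and j: "j \<in> J\<^sub>p"
  shows "j \<bullet> a \<in> H"
  unfolding mult_eq_right_adjoint(2)[OF Jp_carrier[OF j] A0_carrier[OF a]]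
  by (rule sweedler_in_subgroup[OF A0_hopf a mult_eq_right_adjoint(1)[OF Jp_carrier[OF j]] H])
    (rule JH[OF _ right_adjoint_Jp[OF _ j]])

text \<open>
  The composite of the inverse of the decomposition with \<open>\<epsilon> \<otimes> id \<otimes> \<epsilon>\<close>.  Since \<open>\<epsilon>\<close>
  vanishes on \<open>J\<^sub>m\<close> and \<open>J\<^sub>p\<close>, it is the projection of \<open>A\<close> onto \<open>A\<^sub>0\<close> along
  \<open>J\<^sub>m A + A\<^sub>0 J\<^sub>p\<close>.
\<close>

definition mid_proj :: "'a \<Rightarrow> 'a"
  where "mid_proj z =
    tensor_lift A (\<lambda>t y. counit A y \<star> tensor_lift A (\<lambda>x a. counit A x \<star> a) t)
      (inv_into (carrier (vtensor K (vtensor K (A\<lparr>carrier := A\<^sub>m\<rparr>) B\<^sub>0)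
                            (A\<lparr>carrier := A\<^sub>p\<rparr>))) (triangular_mult K A) z)"

lemma mid_proj_basic:
  shows "mid_proj \<in> additive_map A A"
    and "z \<in> carrier A \<Longrightarrow> mid_proj z \<in> A\<^sub>0"
    and "\<lbrakk>x \<in> A\<^sub>m; a \<in> A\<^sub>0; y \<in> A\<^sub>p\<rbrakk> \<Longrightarrow>
      mid_proj (x \<bullet> a \<bullet> y) = counit A y \<star> (counit A x \<star> a)"
    and "\<lbrakk>additive_subgroup H A; \<And>x a y. \<lbrakk>x \<in> A\<^sub>m; a \<in> A\<^sub>0; y \<in> A\<^sub>p\<rbrakk> \<Longrightarrow> x \<bullet> a \<bullet> y \<in> H;
      z \<in> carrier A\<rbrakk> \<Longrightarrow> z \<in> H"
proof -
  let ?B = "A\<lparr>carrier := A\<^sub>m\<rparr>" and ?C = "B\<^sub>0" and ?D = "A\<lparr>carrier := A\<^sub>p\<rparr>"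
  let ?V = "vtensor K ?B ?C"
  let ?W = "vtensor K ?V ?D"
  let ?\<mu> = "triangular_mult K A"
  interpret BC: vector_tensor K ?B ?C
    by (intro vector_tensor.intro scalar_space_submodule Am_submodule A0_submodule)
  interpret BCD: vector_tensor K ?V ?D
    by (intro vector_tensor.intro BC.scalar_space_vtensor scalar_space_submodule Ap_submodule)
  note mem = A0_carrier Am_carrier Ap_carrier
  note V = BC.abelian_group_vtensor and W = BCD.abelian_group_vtensor
  have bal1: "BC.vbalanced A (\<lambda>x a. counit A x \<star> a)"
    by (rule balancedI) (auto simp: mem counit_closed counit_add counit_smult smult_closed
        smult_r_distr smult_l_distr smult_assoc1 AA.M.scal_comm)
  note l1 = BC.vtensor_lift_additive[OF A_group bal1]
  let ?l1 = "tensor_lift A (\<lambda>x a. counit A x \<star> a)"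
  have l1p: "?l1 (vpure K ?B ?C x a) = counit A x \<star> a" if "x \<in> A\<^sub>m" "a \<in> A\<^sub>0" for x a
    using BC.vtensor_lift_pure[OF A_group bal1] that by simp
  have l1s: "?l1 (c \<odot>\<^bsub>?V\<^esub> t) = c \<star> ?l1 t" if c: "c \<in> carrier K" and t: "t \<in> carrier ?V" for c t
  proof (rule BC.additive_map_eq_on_vtensors[OF A_group
        additive_map_comp[OF BC.vtensor_smult_additive[OF c] l1] additive_map_comp[OF l1] _ t])
    show "(\<lambda>x. c \<star> x) \<in> additive_map A A"
      using c by (intro additive_mapI) (auto simp: smult_closed smult_r_distr)
    fix m n assume "m \<in> carrier ?B" "n \<in> carrier ?C"
    then show "?l1 (c \<odot>\<^bsub>?V\<^esub> vpure K ?B ?C m n) = c \<star> ?l1 (vpure K ?B ?C m n)"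
      using c BC.M.scal_closed[of c m] BC.vtensor_smult_pure[of c m n]
      by (simp add: l1p mem counit_smult counit_closed smult_assoc1)
  qed
  have bal2: "BCD.vbalanced A (\<lambda>t y. counit A y \<star> ?l1 t)"
    by (rule balancedI)
      (auto simp: mem counit_closed counit_add counit_smult smult_closed l1s
        additive_map_closed[OF l1] additive_map_add[OF l1] smult_r_distr smult_l_distr smult_assoc1
        AA.M.scal_comm)
  note l2 = BCD.vtensor_lift_additive[OF A_group bal2]
  let ?l2 = "tensor_lift A (\<lambda>t y. counit A y \<star> ?l1 t)"
  have l2p: "?l2 (vpure K ?V ?D t y) = counit A y \<star> ?l1 t" if "t \<in> carrier ?V" "y \<in> A\<^sub>p" for t y
    using BCD.vtensor_lift_pure[OF A_group bal2] that by simp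
  have balm: "BC.vbalanced A (\<lambda>x a. x \<bullet> a)"
    by (rule balancedI) (auto simp: mem A.l_distr A.r_distr smult_mult_left smult_mult_right)
  note m1 = BC.vtensor_lift_additive[OF A_group balm]
  let ?m1 = "tensor_lift A (\<lambda>x a. x \<bullet> a)"
  have m1p: "?m1 (vpure K ?B ?C x a) = x \<bullet> a" if "x \<in> A\<^sub>m" "a \<in> A\<^sub>0" for x a
    using BC.vtensor_lift_pure[OF A_group balm] that by simp
  have m1s: "?m1 (c \<odot>\<^bsub>?V\<^esub> t) = c \<star> ?m1 t" if c: "c \<in> carrier K" and t: "t \<in> carrier ?V" for c t
  proof (rule BC.additive_map_eq_on_vtensors[OF A_group
        additive_map_comp[OF BC.vtensor_smult_additive[OF c] m1] additive_map_comp[OF m1] _ t])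
    show "(\<lambda>x. c \<star> x) \<in> additive_map A A"
      using c by (intro additive_mapI) (auto simp: smult_closed smult_r_distr)
    fix m n assume "m \<in> carrier ?B" "n \<in> carrier ?C"
    then show "?m1 (c \<odot>\<^bsub>?V\<^esub> vpure K ?B ?C m n) = c \<star> ?m1 (vpure K ?B ?C m n)"
      using c BC.M.scal_closed[of c m] BC.vtensor_smult_pure[of c m n]
      by (simp add: m1p mem smult_mult_left)
  qed
  have bal\<mu>: "BCD.vbalanced A (\<lambda>t z. ?m1 t \<bullet> z)"
    by (rule balancedI)
      (auto simp: mem m1s additive_map_closed[OF m1] additive_map_add[OF m1] A.l_distr A.r_distr
        smult_mult_left smult_mult_right)
  have \<mu>p: "?\<mu> (vpure K ?V ?D (vpure K ?B ?C x a) y) = x \<bullet> a \<bullet> y"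
    if "x \<in> A\<^sub>m" "a \<in> A\<^sub>0" "y \<in> A\<^sub>p" for x a y
    unfolding triangular_mult_def
    using BCD.vtensor_lift_pure[OF A_group bal\<mu>] that BC.vpure_closed[of x a] by (simp add: m1p)
  have iso: "?\<mu> \<in> lmod_hom K ?W A" and bij: "bij_betw ?\<mu> (carrier ?W) (carrier A)"
    using decomposition by (auto simp: lmod_iso_def)
  have inv: "inv_into (carrier ?W) ?\<mu> (?\<mu> w) = w" if "w \<in> carrier ?W" for w
    using bij that by (simp add: bij_betw_def)
  have inv_add: "inv_into (carrier ?W) ?\<mu> \<in> additive_map A ?W"
  proof (rule additive_mapI)
    fix x assume "x \<in> carrier A"
    then show "inv_into (carrier ?W) ?\<mu> x \<in> carrier ?W"
      using bij by (intro inv_into_into) (simp add: bij_betw_def)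
  next
    fix x y assume "x \<in> carrier A" "y \<in> carrier A"
    then have "x \<in> ?\<mu> ` carrier ?W" "y \<in> ?\<mu> ` carrier ?W"
      using bij by (simp_all add: bij_betw_def)
    then obtain u v where u: "u \<in> carrier ?W" "x = ?\<mu> u" and v: "v \<in> carrier ?W" "y = ?\<mu> v"
      by (elim imageE)
    have "u \<oplus>\<^bsub>?W\<^esub> v \<in> carrier ?W" using u v abelian_group.axioms(1)[OF W]
      by (simp add: abelian_monoid.a_closed)
    then show "inv_into (carrier ?W) ?\<mu> (x \<oplus>\<^bsub>A\<^esub> y)
        = inv_into (carrier ?W) ?\<mu> x \<oplus>\<^bsub>?W\<^esub> inv_into (carrier ?W) ?\<mu> y"
      using inv[of "u \<oplus>\<^bsub>?W\<^esub> v"] u v inv lmod_homD(3)[OF iso u(1) v(1)] by simp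
  qed
  have mp: "mid_proj = (\<lambda>z. ?l2 (inv_into (carrier ?W) ?\<mu> z))"
    by (simp add: mid_proj_def fun_eq_iff)
  show add: "mid_proj \<in> additive_map A A"
    unfolding mp by (rule additive_map_comp[OF inv_add l2])
  show pure: "mid_proj (x \<bullet> a \<bullet> y) = counit A y \<star> (counit A x \<star> a)"
    if "x \<in> A\<^sub>m" "a \<in> A\<^sub>0" "y \<in> A\<^sub>p" for x a y
    unfolding mp \<mu>p[OF that, symmetric] using that
    by (simp add: inv BC.vpure_closed BCD.vpure_closed l2p l1p)
  show span: "z \<in> H"
    if H: "additive_subgroup H A"
      and gen: "\<And>x a y. \<lbrakk>x \<in> A\<^sub>m; a \<in> A\<^sub>0; y \<in> A\<^sub>p\<rbrakk> \<Longrightarrow> x \<bullet> a \<bullet> y \<in> H"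
      and z: "z \<in> carrier A" for H z
  proof -
    note \<mu>a = lmod_homD(1)[OF iso]
    have "w \<in> {w \<in> carrier ?W. ?\<mu> w \<in> H}" if w: "w \<in> carrier ?W" for w
    proof (rule BCD.vtensor_induct[OF additive_subgroup_vimage[OF W A_group \<mu>a H] _ w])
      fix t y assume t: "t \<in> carrier ?V" and y: "y \<in> carrier ?D"
      have qt: "(\<lambda>t. vpure K ?V ?D t y) \<in> additive_map ?V ?W"
        using y balancedD[OF BCD.vpure_balanced] by (intro additive_mapI) auto
      have "t \<in> {t \<in> carrier ?V. ?\<mu> (vpure K ?V ?D t y) \<in> H}"
        by (rule BC.vtensor_induct[OF additive_subgroup_vimage[OF V A_group
                additive_map_comp[OF qt \<mu>a] H] _ t])
          (use y in \<open>auto simp: BC.vpure_closed \<mu>p gen\<close>)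
      then show "vpure K ?V ?D t y \<in> {w \<in> carrier ?W. ?\<mu> w \<in> H}"
        using t y BCD.vpure_closed by simp
    qed
    moreover have "z \<in> ?\<mu> ` carrier ?W" using z bij by (simp add: bij_betw_def)
    then obtain w where "w \<in> carrier ?W" "z = ?\<mu> w" by (elim imageE)
    ultimately show ?thesis by simp
  qed
  show "mid_proj z \<in> A\<^sub>0" if z: "z \<in> carrier A" for z
  proof -
    have "z \<in> {z \<in> carrier A. mid_proj z \<in> A\<^sub>0}"
      by (rule span[OF additive_subgroup_vimage[OF A_group A_group add A0_additive_subgroup] _ z])
        (auto simp: pure mem A0_smult counit_closed)
    then show ?thesis by simp
  qed
qed

lemmas mid_proj_additive = mid_proj_basic(1)
lemmas mid_proj_A0 = mid_proj_basic(2)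
lemmas mid_proj_product = mid_proj_basic(3)

lemma mid_proj_closed: "z \<in> carrier A \<Longrightarrow> mid_proj z \<in> carrier A"
  using A0_carrier mid_proj_A0 by blast

text \<open>
  \<open>A = A\<^sub>0 + J\<^sub>m A + A\<^sub>0 J\<^sub>p\<close>: split \<open>x\<close> and \<open>y\<close> in \<open>x a y\<close> into their scalar parts and
  their parts in \<open>J\<^sub>m\<close> and \<open>J\<^sub>p\<close>.
\<close>

lemma triangular_induct:
  assumes H: "additive_subgroup H A"
    and A0: "\<And>a. a \<in> A\<^sub>0 \<Longrightarrow> a \<in> H"
    and Jm: "\<And>j w. \<lbrakk>j \<in> J\<^sub>m; w \<in> carrier A\<rbrakk> \<Longrightarrow> j \<bullet> w \<in> H"
    and Jp: "\<And>a j. \<lbrakk>a \<in> A\<^sub>0; j \<in> J\<^sub>p\<rbrakk> \<Longrightarrow> a \<bullet> j \<in> H"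
    and z: "z \<in> carrier A"
  shows "z \<in> H"
proof (rule mid_proj_basic(4)[OF H _ z])
  interpret H: additive_subgroup H A by fact
  fix x a y assume x: "x \<in> A\<^sub>m" and a: "a \<in> A\<^sub>0" and y: "y \<in> A\<^sub>p"
  let ?c = "counit A x" and ?d = "counit A y"
  obtain j where j: "j \<in> J\<^sub>m" "x = ?c \<star> \<one>\<^bsub>A\<^esub> \<oplus>\<^bsub>A\<^esub> j" by (rule Am_split[OF x])
  obtain i where i: "i \<in> J\<^sub>p" "y = ?d \<star> \<one>\<^bsub>A\<^esub> \<oplus>\<^bsub>A\<^esub> i" by (rule Ap_split[OF y])
  note mem = A0_carrier[OF a] Am_carrier[OF x] Ap_carrier[OF y] Jm_carrier[OF j(1)] Jp_carrier[OF i(1)]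
  have c: "?c \<in> carrier K" and d: "?d \<in> carrier K" using mem counit_closed by auto
  have ca: "?c \<star> a \<in> A\<^sub>0" using A0_smult[OF c a] .
  have "x \<bullet> a \<bullet> y = (?c \<star> a) \<bullet> y \<oplus>\<^bsub>A\<^esub> j \<bullet> (a \<bullet> y)"
    using mem c by (subst j(2)) (simp add: A.l_distr smult_mult_left A.m_assoc)
  also have "(?c \<star> a) \<bullet> y = ?d \<star> (?c \<star> a) \<oplus>\<^bsub>A\<^esub> (?c \<star> a) \<bullet> i"
    using mem c d A0_carrier[OF ca] by (subst i(2)) (simp add: A.r_distr smult_mult_right)
  finally show "x \<bullet> a \<bullet> y \<in> H"
    using A0[OF A0_smult[OF d ca]] Jp[OF ca i(1)] Jm[OF j(1), of "a \<bullet> y"] mem by simp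
qed

lemma mid_proj_mult_Ap: "\<lbrakk>a \<in> A\<^sub>0; y \<in> A\<^sub>p\<rbrakk> \<Longrightarrow> mid_proj (a \<bullet> y) = counit A y \<star> a"
  using mid_proj_product[OF one_Am, of a y] by (simp add: counit_one A0_carrier)

lemma mid_proj_id: "a \<in> A\<^sub>0 \<Longrightarrow> mid_proj a = a"
  using mid_proj_mult_Ap[OF _ one_Ap, of a] by (simp add: counit_one A0_carrier)

lemma mid_proj_A0_Jp: "\<lbrakk>a \<in> A\<^sub>0; j \<in> J\<^sub>p\<rbrakk> \<Longrightarrow> mid_proj (a \<bullet> j) = \<zero>\<^bsub>A\<^esub>"
  using mid_proj_mult_Ap[OF _ Jp_Ap] by (simp add: counit_Jp A0_carrier smult_l_null)

lemma mid_proj_Jm: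
  assumes j: "j \<in> J\<^sub>m" and w: "w \<in> carrier A"
  shows "mid_proj (j \<bullet> w) = \<zero>\<^bsub>A\<^esub>"
proof -
  note jA = Jm_carrier[OF j]
  have "w \<in> {w \<in> carrier A. mid_proj (j \<bullet> w) = \<zero>\<^bsub>A\<^esub>}"
  proof (rule mid_proj_basic(4)[OF additive_subgroup_kernel[OF A_group A_group
          additive_map_comp[OF mult_left_additive[OF jA] mid_proj_additive]] _ w])
    fix x a y assume x: "x \<in> A\<^sub>m" and a: "a \<in> A\<^sub>0" and y: "y \<in> A\<^sub>p"
    note mem = A0_carrier[OF a] Am_carrier[OF x] Ap_carrier[OF y]
    have jx: "j \<bullet> x \<in> J\<^sub>m" by (rule Jm_mult_Am[OF j x])
    have "mid_proj (j \<bullet> x \<bullet> a \<bullet> y) = \<zero>\<^bsub>A\<^esub>"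
      using mid_proj_product[OF Jm_Am[OF jx] a y] mem
      by (simp add: counit_Jm[OF jx] smult_l_null counit_closed smult_r_null)
    then show "x \<bullet> a \<bullet> y \<in> {w \<in> carrier A. mid_proj (j \<bullet> w) = \<zero>\<^bsub>A\<^esub>}"
      using jA mem by (simp add: A.m_assoc)
  qed
  then show ?thesis by simp
qed

text \<open>
  \<open>J\<^sub>m A\<close> is stable under left multiplication by \<open>A\<^sub>0\<close> because \<open>A\<^sub>0 J\<^sub>m \<subseteq> J\<^sub>m A\<^sub>0\<close>.
\<close>

lemma mid_proj_left_linear:
  assumes a: "a \<in> A\<^sub>0" and z: "z \<in> carrier A"
  shows "mid_proj (a \<bullet> z) = a \<bullet> mid_proj z"
proof -
  note aA = A0_carrier[OF a]
  have "z \<in> {z \<in> carrier A. mid_proj (a \<bullet> z) = a \<bullet> mid_proj z}"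
  proof (rule triangular_induct[OF additive_subgroup_equalizer[OF A_group A_group
          additive_map_comp[OF mult_left_additive[OF aA] mid_proj_additive]
          additive_map_comp[OF mid_proj_additive mult_left_additive[OF aA]]] _ _ _ z])
    fix b assume "b \<in> A\<^sub>0"
    then show "b \<in> {z \<in> carrier A. mid_proj (a \<bullet> z) = a \<bullet> mid_proj z}"
      using A0_mult[OF a] by (simp add: mid_proj_id A0_carrier)
  next
    fix j w assume j: "j \<in> J\<^sub>m" and w: "w \<in> carrier A"
    have "a \<bullet> j \<in> {u \<in> carrier A. mid_proj (u \<bullet> w) = \<zero>\<^bsub>A\<^esub>}"
      by (rule A0_Jm_commute[OF additive_subgroup_kernel[OF A_group A_group
              additive_map_comp[OF mult_right_additive[OF w] mid_proj_additive]] _ a j])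
        (simp add: Jm_carrier A0_carrier w A.m_assoc mid_proj_Jm)
    then show "j \<bullet> w \<in> {z \<in> carrier A. mid_proj (a \<bullet> z) = a \<bullet> mid_proj z}"
      using j w aA by (simp add: Jm_carrier A.m_assoc mid_proj_Jm)
  next
    fix b j assume b: "b \<in> A\<^sub>0" and j: "j \<in> J\<^sub>p"
    then show "b \<bullet> j \<in> {z \<in> carrier A. mid_proj (a \<bullet> z) = a \<bullet> mid_proj z}"
      using mid_proj_A0_Jp[OF A0_mult[OF a b] j] aA
      by (simp add: mid_proj_A0_Jp A0_carrier Jp_carrier A.m_assoc)
  qed
  then show ?thesis by simp
qed

abbreviation nonneg :: "'a set" where "nonneg \<equiv> nonneg_part A A\<^sub>0 A\<^sub>p"

lemma nonneg_induct [consumes 1, case_names mult add]: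
  assumes "b \<in> nonneg"
    and "\<And>a y. \<lbrakk>a \<in> A\<^sub>0; y \<in> A\<^sub>p\<rbrakk> \<Longrightarrow> P (a \<bullet> y)"
    and "\<And>b b'. \<lbrakk>b \<in> carrier A; b' \<in> carrier A; P b; P b'\<rbrakk> \<Longrightarrow> P (b \<oplus>\<^bsub>A\<^esub> b')"
  shows "P b"
proof -
  have "b \<in> carrier A \<and> P b"
    using assms(1) unfolding nonneg_part_def
    by (induction rule: ideal_prod.induct) (auto simp: A0_carrier Ap_carrier assms(2,3))
  then show ?thesis by simp
qed

lemma nonneg_carrier: "b \<in> nonneg \<Longrightarrow> b \<in> carrier A"
  by (induction rule: nonneg_induct) (auto simp: A0_carrier Ap_carrier)

lemma nonneg_A0: "a \<in> A\<^sub>0 \<Longrightarrow> a \<in> nonneg"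
  using ideal_prod.prod[OF _ one_Ap, of a A\<^sub>0 A] by (simp add: nonneg_part_def A0_carrier)

lemma nonneg_Jp: "j \<in> J\<^sub>p \<Longrightarrow> j \<in> nonneg"
  using ideal_prod.prod[OF one_A0 Jp_Ap, of j A] by (simp add: nonneg_part_def Jp_carrier)

text \<open>
  Right multiplication by the nonnegative part acts through the projection.  The only case that
  is not formal is \<open>a j (a' y)\<close> with \<open>j \<in> J\<^sub>p\<close>, where \<open>j a'\<close> is rewritten into
  \<open>A\<^sub>0 J\<^sub>p\<close>.
\<close>

lemma mid_proj_right_linear:
  assumes z: "z \<in> carrier A" and b: "b \<in> nonneg"
  shows "mid_proj (z \<bullet> b) = mid_proj z \<bullet> mid_proj b"
  using b
proof (induction rule: nonneg_induct)
  case (add b b')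
  then show ?case
    using z by (simp add: A.r_distr additive_map_add[OF mid_proj_additive] mid_proj_closed)
next
  case (mult a' y)
  note a' = mult(1) and y = mult(2)
  note a'A = A0_carrier[OF a'] and yA = Ap_carrier[OF y]
  let ?b = "a' \<bullet> y"
  have bA: "?b \<in> carrier A" using a'A yA by simp
  have pb: "mid_proj ?b = counit A y \<star> a'" by (rule mid_proj_mult_Ap[OF a' y])
  have pbA: "mid_proj ?b \<in> carrier A" by (rule mid_proj_closed[OF bA])
  have "z \<in> {z \<in> carrier A. mid_proj (z \<bullet> ?b) = mid_proj z \<bullet> mid_proj ?b}"
    (is "z \<in> ?E")
  proof (rule triangular_induct[OF additive_subgroup_equalizer[OF A_group A_group
          additive_map_comp[OF mult_right_additive[OF bA] mid_proj_additive]
          additive_map_comp[OF mid_proj_additive mult_right_additive[OF pbA]]] _ _ _ z])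
    fix a assume a: "a \<in> A\<^sub>0"
    then show "a \<in> ?E"
      using mid_proj_left_linear[OF a bA] by (simp add: A0_carrier mid_proj_id)
  next
    fix j w assume j: "j \<in> J\<^sub>m" and w: "w \<in> carrier A"
    then show "j \<bullet> w \<in> ?E"
      using mid_proj_Jm[OF j, of "w \<bullet> ?b"] mid_proj_Jm[OF j w] bA pbA
      by (simp add: Jm_carrier A.m_assoc)
  next
    fix a j assume a: "a \<in> A\<^sub>0" and j: "j \<in> J\<^sub>p"
    note aA = A0_carrier[OF a] and jA = Jp_carrier[OF j]
    have "j \<bullet> a' \<in> {u \<in> carrier A. mid_proj (a \<bullet> (u \<bullet> y)) = \<zero>\<^bsub>A\<^esub>}"
    proof (rule Jp_A0_commute[OF additive_subgroup_kernel[OF A_group A_group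
            additive_map_comp[OF mult_right_additive[OF yA]
              additive_map_comp[OF mult_left_additive[OF aA] mid_proj_additive]]] _ a' j])
      fix c i assume c: "c \<in> A\<^sub>0" and i: "i \<in> J\<^sub>p"
      have "a \<bullet> (c \<bullet> i \<bullet> y) = (a \<bullet> c) \<bullet> (i \<bullet> y)"
        using aA A0_carrier[OF c] Jp_carrier[OF i] yA by (simp add: A.m_assoc)
      then show "c \<bullet> i \<in> {u \<in> carrier A. mid_proj (a \<bullet> (u \<bullet> y)) = \<zero>\<^bsub>A\<^esub>}"
        using mid_proj_A0_Jp[OF A0_mult[OF a c] Jp_mult_Ap[OF i y]] A0_carrier[OF c] Jp_carrier[OF i]
        by simp
    qed
    then show "a \<bullet> j \<in> ?E"
      using aA jA a'A yA pbA mid_proj_A0_Jp[OF a j] by (simp add: A.m_assoc)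
  qed
  then show ?case by simp
qed

text \<open>
  Existence comes from \<open>A\<^sub>p = K + J\<^sub>p\<close>; uniqueness holds because the projection fixes
  \<open>A\<^sub>0\<close> and kills \<open>A\<^sub>0 J\<^sub>p\<close>.
\<close>

lemma nonneg_proj_eq:
  assumes b: "b \<in> nonneg"
  shows "nonneg_proj A A\<^sub>0 J\<^sub>p b = mid_proj b"
  unfolding nonneg_proj_def
proof (rule the_equality)
  have "b \<ominus>\<^bsub>A\<^esub> mid_proj b \<in> ideal_prod A A\<^sub>0 J\<^sub>p"
    using b
  proof (induction rule: nonneg_induct)
    case (mult a y)
    obtain j where j: "j \<in> J\<^sub>p" "y = counit A y \<star> \<one>\<^bsub>A\<^esub> \<oplus>\<^bsub>A\<^esub> j" by (rule Ap_split[OF mult(2)])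
    note mem = A0_carrier[OF mult(1)] Jp_carrier[OF j(1)] counit_closed[OF Ap_carrier[OF mult(2)]]
    have ay: "a \<bullet> y = a \<bullet> j \<oplus>\<^bsub>A\<^esub> counit A y \<star> a"
      using mem by (subst j(2)) (simp add: A.r_distr smult_mult_right M.a_comm)
    have "a \<bullet> y \<ominus>\<^bsub>A\<^esub> mid_proj (a \<bullet> y) = a \<bullet> j"
      unfolding mid_proj_mult_Ap[OF mult] unfolding ay using mem
      by (simp add: M.minus_eq M.a_assoc M.r_neg smult_closed)
    then show ?case using ideal_prod.prod[OF mult(1) j(1)] by simp
  next
    case (add b b')
    have "(b \<oplus>\<^bsub>A\<^esub> b') \<ominus>\<^bsub>A\<^esub> mid_proj (b \<oplus>\<^bsub>A\<^esub> b')
        = (b \<ominus>\<^bsub>A\<^esub> mid_proj b) \<oplus>\<^bsub>A\<^esub> (b' \<ominus>\<^bsub>A\<^esub> mid_proj b')"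
      using add(1,2) mid_proj_closed
      by (simp add: additive_map_add[OF mid_proj_additive] M.minus_eq M.minus_add M.a_ac)
    then show ?case using ideal_prod.sum[OF add(3,4)] by simp
  qed
  then show "mid_proj b \<in> A\<^sub>0 \<and> b \<ominus>\<^bsub>A\<^esub> mid_proj b \<in> ideal_prod A A\<^sub>0 J\<^sub>p"
    using mid_proj_A0[OF nonneg_carrier[OF b]] by blast
next
  fix a assume a: "a \<in> A\<^sub>0 \<and> b \<ominus>\<^bsub>A\<^esub> a \<in> ideal_prod A A\<^sub>0 J\<^sub>p"
  have ker: "u \<in> carrier A \<and> mid_proj u = \<zero>\<^bsub>A\<^esub>" if "u \<in> ideal_prod A A\<^sub>0 J\<^sub>p" for u
    using that
    by (induction rule: ideal_prod.induct)
      (auto simp: A0_carrier Jp_carrier mid_proj_A0_Jp additive_map_add[OF mid_proj_additive])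
  have "\<zero>\<^bsub>A\<^esub> = mid_proj b \<ominus>\<^bsub>A\<^esub> a"
    using ker a additive_map_minus[OF A_group A_group mid_proj_additive nonneg_carrier[OF b], of a]
    by (simp add: A0_carrier mid_proj_id)
  then show "a = mid_proj b"
    using a mid_proj_closed[OF nonneg_carrier[OF b]] A0_carrier
      A.r_right_minus_eq[of "mid_proj b" a] by simp
qed

end

section \<open>Standard modules\<close>

lemma lmod_hom_factor:
  assumes M: "left_module R M" and N: "left_module R N" and P: "left_module R P"
    and f: "f \<in> lmod_hom R M N" and onto: "f ` carrier M = carrier N"
    and g: "g \<in> lmod_hom R M P"
    and ker: "\<And>x. \<lbrakk>x \<in> carrier M; f x = \<zero>\<^bsub>N\<^esub>\<rbrakk> \<Longrightarrow> g x = \<zero>\<^bsub>P\<^esub>"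
  obtains h where "h \<in> lmod_hom R N P" "\<And>x. x \<in> carrier M \<Longrightarrow> h (f x) = g x"
proof -
  interpret M: left_module R M by fact
  interpret N: left_module R N by fact
  interpret P: left_module R P by fact
  note fD = lmod_homD[OF f] and gD = lmod_homD[OF g]
  define s where "s = inv_into (carrier M) f"
  have s: "s y \<in> carrier M" "f (s y) = y" if "y \<in> carrier N" for y
    using that onto unfolding s_def by (simp_all add: inv_into_into f_inv_into_f)
  have eq: "g x = g y" if x: "x \<in> carrier M" and y: "y \<in> carrier M" and xy: "f x = f y" for x y
  proof -
    have "f (x \<ominus>\<^bsub>M\<^esub> y) = \<zero>\<^bsub>N\<^esub>"
      using x y xy fD(2) additive_map_minus[OF M.M.abelian_group_axioms N.M.abelian_group_axioms fD(1) x y]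
      by (simp add: N.M.minus_eq N.M.r_neg)
    then have "g (x \<ominus>\<^bsub>M\<^esub> y) = \<zero>\<^bsub>P\<^esub>" using x y by (intro ker) simp_all
    moreover have "g x = g (x \<ominus>\<^bsub>M\<^esub> y) \<oplus>\<^bsub>P\<^esub> g y"
      using x y gD(3)[of "x \<ominus>\<^bsub>M\<^esub> y" y] by (simp add: M.M.minus_eq M.M.a_assoc M.M.l_neg)
    ultimately show ?thesis using gD(2)[OF y] by simp
  qed
  have "(\<lambda>y. g (s y)) \<in> lmod_hom R N P"
  proof (intro lmod_homI additive_mapI)
    fix x y assume x: "x \<in> carrier N" and y: "y \<in> carrier N"
    have "g (s (x \<oplus>\<^bsub>N\<^esub> y)) = g (s x \<oplus>\<^bsub>M\<^esub> s y)"
      using x y s fD(3) by (intro eq) simp_all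
    then show "g (s (x \<oplus>\<^bsub>N\<^esub> y)) = g (s x) \<oplus>\<^bsub>P\<^esub> g (s y)" using x y s gD(3) by simp
  next
    fix r x assume r: "r \<in> carrier R" and x: "x \<in> carrier N"
    have "g (s (r \<odot>\<^bsub>N\<^esub> x)) = g (r \<odot>\<^bsub>M\<^esub> s x)"
      using r x s fD(4) by (intro eq) (simp_all add: M.smult_closed N.smult_closed)
    then show "g (s (r \<odot>\<^bsub>N\<^esub> x)) = r \<odot>\<^bsub>P\<^esub> g (s x)" using r x s gD(4) by simp
  qed (use s gD(2) in blast)
  moreover have "g (s (f x)) = g x" if "x \<in> carrier M" for x
    using that s fD(2) by (intro eq) simp_all
  ultimately show ?thesis using that by simp
qed

locale standard = triangular_hopf_algebra K A A\<^sub>m A\<^sub>0 A\<^sub>p J\<^sub>m J\<^sub>p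
  for K :: "('k, 'x) ring_scheme" and A :: "('k, 'a, 'y) hopf_scheme"
    and A\<^sub>m A\<^sub>0 A\<^sub>p J\<^sub>m J\<^sub>p :: "'a set" +
  fixes V :: "('a, 'v) module"
  assumes V_module: "left_module B\<^sub>0 V"
begin

interpretation V: left_module "B\<^sub>0" V by (rule V_module)

lemma V_group: "abelian_group V" by (rule V.M.abelian_group_axioms)

abbreviation "infl \<equiv> inflation A A\<^sub>0 J\<^sub>p V"
abbreviation "Z \<equiv> standard_module A A\<^sub>0 A\<^sub>p J\<^sub>p V"

lemma infl_simps:
  "carrier infl = carrier V" "\<zero>\<^bsub>infl\<^esub> = \<zero>\<^bsub>V\<^esub>" "x \<oplus>\<^bsub>infl\<^esub> y = x \<oplus>\<^bsub>V\<^esub> y"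
  "b \<in> nonneg \<Longrightarrow> b \<odot>\<^bsub>infl\<^esub> x = mid_proj b \<odot>\<^bsub>V\<^esub> x"
  by (simp_all add: inflation_def nonneg_proj_eq)

lemma A0_smult_closed: "\<lbrakk>a \<in> A\<^sub>0; v \<in> carrier V\<rbrakk> \<Longrightarrow> a \<odot>\<^bsub>V\<^esub> v \<in> carrier V"
  using V.smult_closed by simp

lemma infl_group: "abelian_group infl"
proof (rule abelian_groupI)
  fix x assume "x \<in> carrier infl"
  then show "\<exists>y\<in>carrier infl. y \<oplus>\<^bsub>infl\<^esub> x = \<zero>\<^bsub>infl\<^esub>"
    using V.M.l_neg V.M.a_inv_closed by (auto simp: infl_simps)
qed (auto simp: infl_simps V.M.a_ac)

sublocale T: tensor_factors "A\<lparr>carrier := nonneg\<rparr>" "monoid.mult A" A infl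
proof (intro tensor_factors.intro tensor_factors_axioms.intro A_group infl_group)
  fix b v assume b: "b \<in> carrier (A\<lparr>carrier := nonneg\<rparr>)" and v: "v \<in> carrier infl"
  then show "b \<odot>\<^bsub>infl\<^esub> v \<in> carrier infl"
    using A0_smult_closed[OF mid_proj_A0[OF nonneg_carrier]] by (simp add: infl_simps)
qed (auto simp: nonneg_carrier)

abbreviation tens :: "'a \<Rightarrow> 'v \<Rightarrow> ('a \<times> 'v \<Rightarrow>\<^sub>0 int) set"
  where "tens \<equiv> pure_tensor (A\<lparr>carrier := nonneg\<rparr>) (monoid.mult A) A infl"

lemmas Z_def = standard_module_def[of A A\<^sub>0 A\<^sub>p J\<^sub>p V]

lemma Z_group: "abelian_group Z"
  unfolding Z_def by (rule T.abelian_group_tensor_module)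

lemma Z_induct:
  assumes "additive_subgroup H Z" "\<And>x v. \<lbrakk>x \<in> carrier A; v \<in> carrier V\<rbrakk> \<Longrightarrow> tens x v \<in> H" "t \<in> carrier Z"
  shows "t \<in> H"
  using T.tensor_induct[of H "monoid.mult A" t] assms unfolding Z_def infl_simps by blast

lemma Z_eqI:
  assumes "abelian_group G" "f \<in> additive_map Z G" "g \<in> additive_map Z G"
    and "\<And>x v. \<lbrakk>x \<in> carrier A; v \<in> carrier V\<rbrakk> \<Longrightarrow> f (tens x v) = g (tens x v)" "t \<in> carrier Z"
  shows "f t = g t"
  using T.additive_map_eq_on_tensors[of G f "monoid.mult A" g t] assms
  unfolding Z_def infl_simps by blast

lemma tens_balanced: "balanced (A\<lparr>carrier := nonneg\<rparr>) (monoid.mult A) A infl Z tens"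
  unfolding Z_def by (rule T.pure_tensor_balanced)

lemma tens_closed: "\<lbrakk>x \<in> carrier A; v \<in> carrier V\<rbrakk> \<Longrightarrow> tens x v \<in> carrier Z"
  using balancedD(1)[OF tens_balanced] by (simp add: infl_simps)

lemma tens_add_left: "\<lbrakk>x \<in> carrier A; y \<in> carrier A; v \<in> carrier V\<rbrakk> \<Longrightarrow>
    tens (x \<oplus>\<^bsub>A\<^esub> y) v = tens x v \<oplus>\<^bsub>Z\<^esub> tens y v"
  using balancedD(2)[OF tens_balanced] by (simp add: infl_simps)

lemma tens_add_right: "\<lbrakk>x \<in> carrier A; v \<in> carrier V; w \<in> carrier V\<rbrakk> \<Longrightarrow>
    tens x (v \<oplus>\<^bsub>V\<^esub> w) = tens x v \<oplus>\<^bsub>Z\<^esub> tens x w"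
  using balancedD(3)[OF tens_balanced] by (simp add: infl_simps)

lemma tens_nonneg: "\<lbrakk>x \<in> carrier A; b \<in> nonneg; v \<in> carrier V\<rbrakk> \<Longrightarrow>
    tens (x \<bullet> b) v = tens x (mid_proj b \<odot>\<^bsub>V\<^esub> v)"
  using balancedD(4)[OF tens_balanced] by (simp add: infl_simps)

lemma Z_smult_additive: "a \<in> carrier A \<Longrightarrow> (\<lambda>t. a \<odot>\<^bsub>Z\<^esub> t) \<in> additive_map Z Z"
  unfolding Z_def
  by (rule T.smult_tensor(1)) (auto simp: A.r_distr A.m_assoc nonneg_carrier)

lemma Z_smult_tens: "\<lbrakk>a \<in> carrier A; x \<in> carrier A; v \<in> carrier V\<rbrakk> \<Longrightarrow>
    a \<odot>\<^bsub>Z\<^esub> tens x v = tens (a \<bullet> x) v"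
  unfolding Z_def
  by (rule T.smult_tensor(2)) (auto simp: A.r_distr A.m_assoc nonneg_carrier infl_simps)

lemma Z_module: "left_module A Z"
proof -
  interpret Z: abelian_group Z by (rule Z_group)
  note add = Z_smult_additive
  show ?thesis
  proof (intro left_module.intro left_module_axioms.intro A.ring_axioms Z_group)
    fix a b t assume a: "a \<in> carrier A" and b: "b \<in> carrier A" and t: "t \<in> carrier Z"
    have "(\<lambda>t. a \<odot>\<^bsub>Z\<^esub> t \<oplus>\<^bsub>Z\<^esub> b \<odot>\<^bsub>Z\<^esub> t) \<in> additive_map Z Z"
      using additive_map_closed[OF add] additive_map_add[OF add] a b
      by (intro additive_mapI) (auto simp: Z.a_ac)
    then show "(a \<oplus>\<^bsub>A\<^esub> b) \<odot>\<^bsub>Z\<^esub> t = a \<odot>\<^bsub>Z\<^esub> t \<oplus>\<^bsub>Z\<^esub> b \<odot>\<^bsub>Z\<^esub> t"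
      using a b
      by (intro Z_eqI[OF Z_group add _ _ t]) (auto simp: Z_smult_tens tens_add_left A.l_distr)
    show "(a \<bullet> b) \<odot>\<^bsub>Z\<^esub> t = a \<odot>\<^bsub>Z\<^esub> (b \<odot>\<^bsub>Z\<^esub> t)"
      using a b
      by (intro Z_eqI[OF Z_group add additive_map_comp[OF add add] _ t])
        (auto simp: Z_smult_tens A.m_assoc)
  next
    fix t assume t: "t \<in> carrier Z"
    show "\<one>\<^bsub>A\<^esub> \<odot>\<^bsub>Z\<^esub> t = t"
      by (intro Z_eqI[OF Z_group add _ _ t] additive_mapI) (auto simp: Z_smult_tens)
  qed (use additive_map_closed[OF add] additive_map_add[OF add] in auto)
qed

interpretation Z: left_module A Z by (rule Z_module)

definition \<iota> :: "'v \<Rightarrow> ('a \<times> 'v \<Rightarrow>\<^sub>0 int) set" where "\<iota> v = tens \<one>\<^bsub>A\<^esub> v"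

lemma \<iota>_hom: "\<iota> \<in> lmod_hom B\<^sub>0 V Z"
proof (intro lmod_homI additive_mapI)
  fix a v assume "a \<in> carrier B\<^sub>0" and v: "v \<in> carrier V"
  then have a: "a \<in> A\<^sub>0" by simp
  show "\<iota> (a \<odot>\<^bsub>V\<^esub> v) = a \<odot>\<^bsub>Z\<^esub> \<iota> v"
    using tens_nonneg[OF _ nonneg_A0[OF a] v, of "\<one>\<^bsub>A\<^esub>"] A0_carrier[OF a] v
    by (simp add: \<iota>_def Z_smult_tens mid_proj_id[OF a])
qed (simp_all add: \<iota>_def tens_closed tens_add_right)

lemma \<iota>_closed: "v \<in> carrier V \<Longrightarrow> \<iota> v \<in> carrier Z"
  by (rule lmod_homD(2)[OF \<iota>_hom])

lemma \<iota>_zero: "\<iota> \<zero>\<^bsub>V\<^esub> = \<zero>\<^bsub>Z\<^esub>"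
  by (rule additive_map_zero[OF V_group Z_group lmod_homD(1)[OF \<iota>_hom]])

lemma smult_\<iota>: "\<lbrakk>x \<in> carrier A; v \<in> carrier V\<rbrakk> \<Longrightarrow> x \<odot>\<^bsub>Z\<^esub> \<iota> v = tens x v"
  by (simp add: \<iota>_def Z_smult_tens)

lemma Jp_\<iota>:
  assumes j: "j \<in> J\<^sub>p" and v: "v \<in> carrier V"
  shows "j \<odot>\<^bsub>Z\<^esub> \<iota> v = \<zero>\<^bsub>Z\<^esub>"
proof -
  have "mid_proj j = \<zero>\<^bsub>A\<^esub>" using mid_proj_A0_Jp[OF one_A0 j] Jp_carrier[OF j] by simp
  moreover have "\<zero>\<^bsub>A\<^esub> \<odot>\<^bsub>V\<^esub> v = \<zero>\<^bsub>V\<^esub>" using V.zero_smult[OF v] by simp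
  ultimately show ?thesis
    using tens_nonneg[OF _ nonneg_Jp[OF j] v, of "\<one>\<^bsub>A\<^esub>"] Jp_carrier[OF j] v \<iota>_zero
    by (simp add: \<iota>_def Z_smult_tens)
qed

text \<open>
  Frobenius reciprocity: an \<open>A\<^sub>0\<close>-map into an \<open>A\<close>-module whose image is killed by \<open>J\<^sub>p\<close>
  is linear over the nonnegative part, hence extends to the induced module.
\<close>

lemma Z_universal:
  assumes M: "left_module A M" and h: "h \<in> lmod_hom B\<^sub>0 V M"
    and Jp: "\<And>j v. \<lbrakk>j \<in> J\<^sub>p; v \<in> carrier V\<rbrakk> \<Longrightarrow> j \<odot>\<^bsub>M\<^esub> h v = \<zero>\<^bsub>M\<^esub>"
  obtains F where "F \<in> lmod_hom A Z M" "\<And>v. v \<in> carrier V \<Longrightarrow> F (\<iota> v) = h v"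
proof -
  interpret M: left_module A M by fact
  note hD = lmod_homD[OF h]
  have act: "b \<odot>\<^bsub>M\<^esub> h v = h (mid_proj b \<odot>\<^bsub>V\<^esub> v)" if b: "b \<in> nonneg" and v: "v \<in> carrier V" for b v
  proof -
    have "b \<odot>\<^bsub>M\<^esub> h v = mid_proj b \<odot>\<^bsub>M\<^esub> h v"
      using b
    proof (induction rule: nonneg_induct)
      case (mult a y)
      obtain j where j: "j \<in> J\<^sub>p" "y = counit A y \<star> \<one>\<^bsub>A\<^esub> \<oplus>\<^bsub>A\<^esub> j" by (rule Ap_split[OF mult(2)])
      note mem = A0_carrier[OF mult(1)] Jp_carrier[OF j(1)] counit_closed[OF Ap_carrier[OF mult(2)]] hD(2)[OF v]
      have "a \<bullet> y = counit A y \<star> a \<oplus>\<^bsub>A\<^esub> a \<bullet> j"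
        using mem by (subst j(2)) (simp add: A.r_distr smult_mult_right)
      then show ?case
        using mem Jp[OF j(1) v] unfolding mid_proj_mult_Ap[OF mult]
        by (simp add: M.smult_l_distr M.smult_assoc M.smult_zero M.smult_closed smult_closed)
    next
      case (add b b')
      then show ?case
        using hD(2)[OF v] by (simp add: M.smult_l_distr additive_map_add[OF mid_proj_additive] mid_proj_closed)
    qed
    then show ?thesis using hD(4) mid_proj_A0[OF nonneg_carrier[OF b]] v by simp
  qed
  have bal: "balanced (A\<lparr>carrier := nonneg\<rparr>) (monoid.mult A) A infl M (\<lambda>x v. x \<odot>\<^bsub>M\<^esub> h v)"
    by (rule balancedI)
      (auto simp: infl_simps hD M.smult_closed M.smult_l_distr M.smult_r_distr M.smult_assoc act nonneg_carrier)
  define F where "F = tensor_lift M (\<lambda>x v. x \<odot>\<^bsub>M\<^esub> h v)"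
  have F: "F \<in> additive_map Z M"
    unfolding F_def Z_def by (rule T.tensor_lift_additive[OF M.M.abelian_group_axioms bal])
  have Ft: "F (tens x v) = x \<odot>\<^bsub>M\<^esub> h v" if "x \<in> carrier A" "v \<in> carrier V" for x v
    unfolding F_def using T.tensor_lift_pure[OF M.M.abelian_group_axioms bal] that by (simp add: infl_simps)
  have "F \<in> lmod_hom A Z M"
  proof (rule lmod_homI[OF F])
    fix r t assume r: "r \<in> carrier A" and t: "t \<in> carrier Z"
    show "F (r \<odot>\<^bsub>Z\<^esub> t) = r \<odot>\<^bsub>M\<^esub> F t"
      using r
      by (intro Z_eqI[OF M.M.abelian_group_axioms additive_map_comp[OF Z_smult_additive F]
            additive_map_comp[OF F M.smult_additive] _ t])
        (auto simp: Z_smult_tens Ft M.smult_assoc hD(2))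
  qed
  moreover have "F (\<iota> v) = h v" if "v \<in> carrier V" for v
    using Ft[of "\<one>\<^bsub>A\<^esub>" v] that hD(2) by (simp add: \<iota>_def M.smult_one)
  ultimately show ?thesis by (rule that)
qed

text \<open>
  The additive retraction \<open>x \<otimes> v \<mapsto> p(x) v\<close> of \<open>\<iota>\<close>, with \<open>p\<close> the projection onto \<open>A\<^sub>0\<close>.  It
  identifies \<open>Z(V) / J\<^sub>m Z(V)\<close> with \<open>V\<close>.
\<close>

definition ret :: "('a \<times> 'v \<Rightarrow>\<^sub>0 int) set \<Rightarrow> 'v"
  where "ret = tensor_lift V (\<lambda>x v. mid_proj x \<odot>\<^bsub>V\<^esub> v)"

lemma ret_balanced:
  "balanced (A\<lparr>carrier := nonneg\<rparr>) (monoid.mult A) A infl V (\<lambda>x v. mid_proj x \<odot>\<^bsub>V\<^esub> v)"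
proof (rule balancedI)
  fix m n assume "m \<in> carrier A" "n \<in> carrier infl"
  then show "mid_proj m \<odot>\<^bsub>V\<^esub> n \<in> carrier V"
    using A0_smult_closed mid_proj_A0 by (simp add: infl_simps)
next
  fix m m' n assume "m \<in> carrier A" "m' \<in> carrier A" "n \<in> carrier infl"
  then show "mid_proj (m \<oplus>\<^bsub>A\<^esub> m') \<odot>\<^bsub>V\<^esub> n = mid_proj m \<odot>\<^bsub>V\<^esub> n \<oplus>\<^bsub>V\<^esub> mid_proj m' \<odot>\<^bsub>V\<^esub> n"
    using V.smult_l_distr[of "mid_proj m" "mid_proj m'" n]
    by (simp add: infl_simps additive_map_add[OF mid_proj_additive] mid_proj_A0)
next
  fix m n n' assume "m \<in> carrier A" "n \<in> carrier infl" "n' \<in> carrier infl"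
  then show "mid_proj m \<odot>\<^bsub>V\<^esub> (n \<oplus>\<^bsub>infl\<^esub> n') = mid_proj m \<odot>\<^bsub>V\<^esub> n \<oplus>\<^bsub>V\<^esub> mid_proj m \<odot>\<^bsub>V\<^esub> n'"
    using V.smult_r_distr[of "mid_proj m" n n'] by (simp add: infl_simps mid_proj_A0)
next
  fix m b n assume m: "m \<in> carrier A" and b: "b \<in> carrier (A\<lparr>carrier := nonneg\<rparr>)" and n: "n \<in> carrier infl"
  then show "mid_proj (m \<bullet> b) \<odot>\<^bsub>V\<^esub> n = mid_proj m \<odot>\<^bsub>V\<^esub> (b \<odot>\<^bsub>infl\<^esub> n)"
    using V.smult_assoc[of "mid_proj m" "mid_proj b" n]
    by (simp add: infl_simps mid_proj_right_linear mid_proj_A0 nonneg_carrier)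
qed

lemma ret_additive: "ret \<in> additive_map Z V"
  unfolding ret_def Z_def by (rule T.tensor_lift_additive[OF V_group ret_balanced])

lemma ret_tens: "\<lbrakk>x \<in> carrier A; v \<in> carrier V\<rbrakk> \<Longrightarrow> ret (tens x v) = mid_proj x \<odot>\<^bsub>V\<^esub> v"
  unfolding ret_def using T.tensor_lift_pure[OF V_group ret_balanced] by (simp add: infl_simps)

lemma ret_\<iota>: "v \<in> carrier V \<Longrightarrow> ret (\<iota> v) = v"
  using V.smult_one[of v] by (simp add: \<iota>_def ret_tens mid_proj_id one_A0)

lemma ret_closed: "t \<in> carrier Z \<Longrightarrow> ret t \<in> carrier V"
  by (rule additive_map_closed[OF ret_additive])

lemma ret_hom: "ret \<in> lmod_hom B\<^sub>0 Z V"
proof (rule lmod_homI[OF ret_additive])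
  fix a t assume "a \<in> carrier B\<^sub>0" and t: "t \<in> carrier Z"
  then have a: "a \<in> A\<^sub>0" by simp
  have add: "(\<lambda>v. a \<odot>\<^bsub>V\<^esub> v) \<in> additive_map V V" using V.smult_additive[of a] a by simp
  show "ret (a \<odot>\<^bsub>Z\<^esub> t) = a \<odot>\<^bsub>V\<^esub> ret t"
  proof (rule Z_eqI[OF V_group additive_map_comp[OF Z_smult_additive[OF A0_carrier[OF a]] ret_additive]
        additive_map_comp[OF ret_additive add] _ t])
    fix x v assume "x \<in> carrier A" "v \<in> carrier V"
    then show "ret (a \<odot>\<^bsub>Z\<^esub> tens x v) = a \<odot>\<^bsub>V\<^esub> ret (tens x v)"
      using A0_carrier[OF a] V.smult_assoc[of a "mid_proj x" v] a
      by (simp add: Z_smult_tens ret_tens mid_proj_left_linear mid_proj_A0)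
  qed
qed

lemma ret_Jm:
  assumes j: "j \<in> J\<^sub>m" and t: "t \<in> carrier Z"
  shows "ret (j \<odot>\<^bsub>Z\<^esub> t) = \<zero>\<^bsub>V\<^esub>"
proof -
  have "t \<in> {t \<in> carrier Z. ret (j \<odot>\<^bsub>Z\<^esub> t) = \<zero>\<^bsub>V\<^esub>}"
  proof (rule Z_induct[OF additive_subgroup_kernel[OF Z_group V_group
          additive_map_comp[OF Z_smult_additive[OF Jm_carrier[OF j]] ret_additive]] _ t])
    fix x v assume "x \<in> carrier A" "v \<in> carrier V"
    then show "tens x v \<in> {t \<in> carrier Z. ret (j \<odot>\<^bsub>Z\<^esub> t) = \<zero>\<^bsub>V\<^esub>}"
      using Jm_carrier[OF j] V.zero_smult[of v]
      by (simp add: Z_smult_tens ret_tens tens_closed mid_proj_Jm[OF j])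
  qed
  then show ?thesis by simp
qed

text \<open>\<open>Z(V) = \<iota>(V) + J\<^sub>m Z(V)\<close>, with the component in \<open>\<iota>(V)\<close> computed by the retraction.\<close>

lemma Z_span:
  assumes H: "additive_subgroup H Z"
    and JH: "\<And>j t. \<lbrakk>j \<in> J\<^sub>m; t \<in> carrier Z\<rbrakk> \<Longrightarrow> j \<odot>\<^bsub>Z\<^esub> t \<in> H" and t: "t \<in> carrier Z"
  shows "t \<ominus>\<^bsub>Z\<^esub> \<iota> (ret t) \<in> H"
proof -
  interpret H: additive_subgroup H Z by fact
  let ?d = "\<lambda>t. t \<ominus>\<^bsub>Z\<^esub> \<iota> (ret t)"
  note \<iota>r = additive_map_comp[OF ret_additive lmod_homD(1)[OF \<iota>_hom]]
  have d: "?d \<in> additive_map Z Z"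
    using additive_map_closed[OF \<iota>r] additive_map_add[OF \<iota>r]
    by (intro additive_mapI) (auto simp: Z.M.minus_eq Z.M.minus_add Z.M.a_ac)
  have "t \<in> {t \<in> carrier Z. ?d t \<in> H}"
  proof (rule Z_induct[OF additive_subgroup_vimage[OF Z_group Z_group d H] _ t])
    fix x v assume x: "x \<in> carrier A" and v: "v \<in> carrier V"
    have tv: "(\<lambda>x. tens x v) \<in> additive_map A Z"
      using v by (intro additive_mapI) (auto simp: tens_closed tens_add_left)
    have "x \<in> {x \<in> carrier A. ?d (tens x v) \<in> H}"
    proof (rule triangular_induct[OF additive_subgroup_vimage[OF A_group Z_group
            additive_map_comp[OF tv d] H] _ _ _ x])
      fix a assume a: "a \<in> A\<^sub>0"
      have "tens a v = \<iota> (ret (tens a v))"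
        using smult_\<iota>[OF A0_carrier[OF a] v] lmod_homD(4)[OF \<iota>_hom, of a v] a v
        by (simp add: ret_tens A0_carrier mid_proj_id)
      moreover have "tens a v \<in> carrier Z" using A0_carrier[OF a] v by (rule tens_closed)
      ultimately have "?d (tens a v) = \<zero>\<^bsub>Z\<^esub>" by (metis Z.M.minus_eq Z.M.r_neg)
      then show "a \<in> {x \<in> carrier A. ?d (tens x v) \<in> H}" using A0_carrier[OF a] H.zero_closed by simp
    next
      fix j w assume j: "j \<in> J\<^sub>m" and w: "w \<in> carrier A"
      have jw: "tens (j \<bullet> w) v = j \<odot>\<^bsub>Z\<^esub> tens w v"
        using Z_smult_tens[OF Jm_carrier[OF j] w v] by simp
      have "?d (tens (j \<bullet> w) v) = j \<odot>\<^bsub>Z\<^esub> tens w v"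
        unfolding jw using ret_Jm[OF j tens_closed[OF w v]] Z.smult_closed[OF Jm_carrier[OF j] tens_closed[OF w v]]
        by (simp add: \<iota>_zero Z.M.minus_eq)
      then show "j \<bullet> w \<in> {x \<in> carrier A. ?d (tens x v) \<in> H}"
        using JH[OF j tens_closed[OF w v]] Jm_carrier[OF j] w by simp
    next
      fix a j assume a: "a \<in> A\<^sub>0" and j: "j \<in> J\<^sub>p"
      have "tens (a \<bullet> j) v = a \<odot>\<^bsub>Z\<^esub> (j \<odot>\<^bsub>Z\<^esub> \<iota> v)"
        using A0_carrier[OF a] Jp_carrier[OF j] v by (simp add: smult_\<iota> Z_smult_tens)
      then have "tens (a \<bullet> j) v = \<zero>\<^bsub>Z\<^esub>"
        using Jp_\<iota>[OF j v] Z.smult_zero A0_carrier[OF a] by simp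
      then have "?d (tens (a \<bullet> j) v) = \<zero>\<^bsub>Z\<^esub>"
        using additive_map_zero[OF Z_group V_group ret_additive] \<iota>_zero by (simp add: Z.M.minus_eq)
      then show "a \<bullet> j \<in> {x \<in> carrier A. ?d (tens x v) \<in> H}"
        using A0_carrier[OF a] Jp_carrier[OF j] H.zero_closed by simp
    qed
    then show "tens x v \<in> {t \<in> carrier Z. ?d t \<in> H}" using tens_closed[OF x v] by simp
  qed
  then show ?thesis by simp
qed

text \<open>
  Subtracting from \<open>n \<in> N\<close> its component outside \<open>\<iota>(V)\<close> shows that \<open>H\<close> contains \<open>\<iota>(V)\<close>.
\<close>

lemma Z_covered:
  assumes H: "additive_subgroup H Z"
    and JH: "\<And>j t. \<lbrakk>j \<in> J\<^sub>m; t \<in> carrier Z\<rbrakk> \<Longrightarrow> j \<odot>\<^bsub>Z\<^esub> t \<in> H"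
    and N: "N \<subseteq> H" "ret ` N = carrier V" and t: "t \<in> carrier Z"
  shows "t \<in> H"
proof -
  interpret H: additive_subgroup H Z by fact
  have "ret t \<in> ret ` N" using N(2) ret_closed[OF t] by simp
  then obtain n where n: "n \<in> N" "ret n = ret t" by auto
  have nZ: "n \<in> carrier Z" using n N(1) H.a_subset by blast
  have \<iota>Z: "\<iota> (ret t) \<in> carrier Z" by (rule \<iota>_closed[OF ret_closed[OF t]])
  have "n \<ominus>\<^bsub>Z\<^esub> \<iota> (ret t) \<in> H" using Z_span[OF H JH nZ] n(2) by simp
  then have "\<ominus>\<^bsub>Z\<^esub> (n \<ominus>\<^bsub>Z\<^esub> \<iota> (ret t)) \<oplus>\<^bsub>Z\<^esub> n \<in> H" using n(1) N(1) by (intro H.a_closed H.a_inv_closed) auto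
  then have "\<iota> (ret t) \<in> H"
    using nZ \<iota>Z by (simp add: Z.M.minus_eq Z.M.minus_add Z.M.a_assoc Z.M.l_neg Z.M.a_comm Z.M.r_neg2)
  then have "(t \<ominus>\<^bsub>Z\<^esub> \<iota> (ret t)) \<oplus>\<^bsub>Z\<^esub> \<iota> (ret t) \<in> H" using Z_span[OF H JH t] by (rule H.a_closed[rotated])
  then show ?thesis using t \<iota>Z by (simp add: Z.M.minus_eq Z.M.a_assoc Z.M.l_neg)
qed

end


locale simple_standard = standard K A A\<^sub>m A\<^sub>0 A\<^sub>p J\<^sub>m J\<^sub>p V
  for K :: "('k, 'x) ring_scheme" and A :: "('k, 'a, 'y) hopf_scheme"
    and A\<^sub>m A\<^sub>0 A\<^sub>p J\<^sub>m J\<^sub>p :: "'a set" and V :: "('a, 'v) module" +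
  assumes V_simple: "simple_module B\<^sub>0 V"
begin

interpretation V: left_module "B\<^sub>0" V by (rule V_module)
interpretation Z: left_module A Z by (rule Z_module)

text \<open>
  A Nakayama argument.  If \<open>ret\<close> does not vanish on \<open>N\<close>, then it maps \<open>N\<close> onto \<open>V\<close>, that is
  \<open>Z = N + J\<^sub>m Z\<close>; descending through the powers of \<open>J\<^sub>m\<close>, which are eventually zero, all
  of \<open>J\<^sub>m Z\<close> and then all of \<open>Z\<close> lies in \<open>N\<close>.
\<close>

lemma proper_submodule_ret:
  assumes N: "submodule N A Z" and proper: "N \<noteq> carrier Z" and n: "n \<in> N"
  shows "ret n = \<zero>\<^bsub>V\<^esub>"
proof (rule ccontr)
  assume nz: "ret n \<noteq> \<zero>\<^bsub>V\<^esub>"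
  let ?P = "A.ideal_power A\<^sub>m J\<^sub>m"
  note ND = Z.submoduleD[OF N]
  have ZB: "left_module B\<^sub>0 Z" by (rule left_module_restrict[OF Z_module A0_subring])
  have "submodule N B\<^sub>0 Z"
    using N A0_carrier unfolding submodule_def submodule_axioms_def by simp
  from submodule_image[OF ZB V_module ret_hom this]
  have "ret ` N = {\<zero>\<^bsub>V\<^esub>} \<or> ret ` N = carrier V" by (rule simple_moduleD(3)[OF V_simple])
  then have onto: "ret ` N = carrier V" using n nz by blast
  have JA: "J\<^sub>m \<subseteq> carrier A" using Jm_carrier by blast
  have PA: "s \<in> carrier A" if "s \<in> ?P k" for s k
    by (rule A.ideal_power_carrier[OF JA that])
  have PJ: "s \<bullet> j \<in> ?P (Suc k)" if "s \<in> ?P k" "j \<in> J\<^sub>m" for s j k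
    by (rule A.ideal_power_mult_right[OF JA that])
  \<comment> \<open>Multiply \<open>Z = N + J\<^sub>m Z\<close> by an element of \<open>J\<^sub>m\<^sup>k\<^sup>+\<^sup>1\<close>.\<close>
  have step: "\<forall>s\<in>?P k. \<forall>t\<in>carrier Z. s \<odot>\<^bsub>Z\<^esub> t \<in> N"
    if IH: "\<forall>s\<in>?P (Suc k). \<forall>t\<in>carrier Z. s \<odot>\<^bsub>Z\<^esub> t \<in> N" for k
  proof (intro ballI)
    fix s t assume s: "s \<in> ?P k" and t: "t \<in> carrier Z"
    have "t \<in> {t \<in> carrier Z. s \<odot>\<^bsub>Z\<^esub> t \<in> N}"
    proof (rule Z_covered[OF additive_subgroup_vimage[OF Z_group Z_group Z_smult_additive[OF PA[OF s]]
            ND(1)] _ _ onto t])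
      fix j u assume j: "j \<in> J\<^sub>m" and u: "u \<in> carrier Z"
      have "s \<odot>\<^bsub>Z\<^esub> (j \<odot>\<^bsub>Z\<^esub> u) = (s \<bullet> j) \<odot>\<^bsub>Z\<^esub> u"
        using Z.smult_assoc[OF PA[OF s] Jm_carrier[OF j] u] by simp
      moreover have "(s \<bullet> j) \<odot>\<^bsub>Z\<^esub> u \<in> N" using IH PJ[OF s j] u by blast
      ultimately show "j \<odot>\<^bsub>Z\<^esub> u \<in> {t \<in> carrier Z. s \<odot>\<^bsub>Z\<^esub> t \<in> N}"
        using Z.smult_closed[OF Jm_carrier[OF j] u] by simp
    qed (use ND(2,5) PA[OF s] in auto)
    then show "s \<odot>\<^bsub>Z\<^esub> t \<in> N" by simp
  qed
  obtain m where m: "?P m = {\<zero>\<^bsub>A\<^esub>}" using Jm_nilpotent by (auto simp: nilpotent_ideal_def)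
  have "\<forall>s\<in>?P m. \<forall>t\<in>carrier Z. s \<odot>\<^bsub>Z\<^esub> t \<in> N" unfolding m using Z.zero_smult ND(3) by simp
  then have "\<forall>s\<in>?P 0. \<forall>t\<in>carrier Z. s \<odot>\<^bsub>Z\<^esub> t \<in> N"
  proof (induction m)
    case (Suc m)
    show ?case by (rule Suc(1)[OF step[OF Suc(2)]])
  qed
  then have "t \<in> N" if "t \<in> carrier Z" for t
    using Z_covered[OF ND(1) _ subset_refl onto that] by simp
  then show False using proper ND(2) by blast
qed

text \<open>The largest submodule inside the kernel of \<open>ret\<close> is therefore the largest proper one.\<close>

definition rad :: "('a \<times> 'v \<Rightarrow>\<^sub>0 int) set set"
  where "rad = {t \<in> carrier Z. \<forall>x\<in>carrier A. ret (x \<odot>\<^bsub>Z\<^esub> t) = \<zero>\<^bsub>V\<^esub>}"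

lemma rad_ret: "t \<in> rad \<Longrightarrow> ret t = \<zero>\<^bsub>V\<^esub>"
  using Z.smult_one[of t] bspec[of "carrier A" "\<lambda>x. ret (x \<odot>\<^bsub>Z\<^esub> t) = \<zero>\<^bsub>V\<^esub>" "\<one>\<^bsub>A\<^esub>"]
  by (simp add: rad_def)

lemma \<iota>_not_rad: "\<lbrakk>v \<in> carrier V; v \<noteq> \<zero>\<^bsub>V\<^esub>\<rbrakk> \<Longrightarrow> \<iota> v \<notin> rad"
  using rad_ret[of "\<iota> v"] ret_\<iota>[of v] by auto

lemma rad_submodule: "submodule rad A Z"
proof (rule Z.submoduleI)
  have ret0: "ret \<zero>\<^bsub>Z\<^esub> = \<zero>\<^bsub>V\<^esub>" by (rule additive_map_zero[OF Z_group V_group ret_additive])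
  show "\<zero>\<^bsub>Z\<^esub> \<in> rad" using ret0 Z.smult_zero by (simp add: rad_def)
  fix x y assume "x \<in> rad" "y \<in> rad"
  then show "x \<oplus>\<^bsub>Z\<^esub> y \<in> rad"
    by (simp add: rad_def Z.smult_r_distr Z.smult_closed additive_map_add[OF ret_additive])
next
  fix a x assume "a \<in> carrier A" "x \<in> rad"
  then show "a \<odot>\<^bsub>Z\<^esub> x \<in> rad"
    by (simp add: rad_def Z.smult_closed flip: Z.smult_assoc)
qed (simp add: rad_def)

lemma rad_proper: "rad \<noteq> carrier Z"
proof -
  obtain v where "v \<in> carrier V" "v \<noteq> \<zero>\<^bsub>V\<^esub>" using simple_module_nonzero[OF V_simple] .
  then show ?thesis using \<iota>_not_rad[of v] \<iota>_closed[of v] by auto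
qed

lemma proper_submodule_rad:
  assumes N: "submodule N A Z" and proper: "N \<noteq> carrier Z"
  shows "N \<subseteq> rad"
proof
  fix n assume n: "n \<in> N"
  show "n \<in> rad"
    using Z.submoduleD(2)[OF N n] proper_submodule_ret[OF N proper Z.submoduleD(5)[OF N _ n]]
    by (simp add: rad_def)
qed

lemma rad_maximal: "maximal_submodule rad A Z"
  using rad_submodule rad_proper proper_submodule_rad unfolding maximal_submodule_def by blast

lemma standard_radical_eq: "standard_radical A A\<^sub>0 A\<^sub>p J\<^sub>p V = rad"
  unfolding standard_radical_def
proof (rule the_equality)
  show "maximal_submodule rad A Z" by (rule rad_maximal)
next
  fix N assume N: "maximal_submodule N A Z"
  then have sub: "submodule N A Z" and proper: "N \<noteq> carrier Z" unfolding maximal_submodule_def by blast+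
  have "N \<subseteq> rad" by (rule proper_submodule_rad[OF sub proper])
  then show "N = rad"
    using N rad_submodule rad_proper unfolding maximal_submodule_def by blast
qed

abbreviation "L \<equiv> standard_head A A\<^sub>0 A\<^sub>p J\<^sub>p V"

lemma L_eq: "L = quotient_module Z rad"
  by (simp add: standard_head_def standard_radical_eq)

lemma L_simple: "simple_module A L"
  unfolding L_eq by (rule simple_quotient[OF Z_module rad_maximal])

lemma L_module: "left_module A L"
  by (rule simple_moduleD(1)[OF L_simple])

definition \<pi> :: "('a \<times> 'v \<Rightarrow>\<^sub>0 int) set \<Rightarrow> ('a \<times> 'v \<Rightarrow>\<^sub>0 int) set set"
  where "\<pi> t = rad +>\<^bsub>Z\<^esub> t"

lemma \<pi>_hom: "\<pi> \<in> lmod_hom A Z L" and \<pi>_onto: "\<pi> ` carrier Z = carrier L"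
  and \<pi>_zero_iff: "t \<in> carrier Z \<Longrightarrow> \<pi> t = \<zero>\<^bsub>L\<^esub> \<longleftrightarrow> t \<in> rad"
proof -
  have \<pi>: "\<pi> = (\<lambda>t. rad +>\<^bsub>Z\<^esub> t)" by (simp add: \<pi>_def fun_eq_iff)
  show "\<pi> \<in> lmod_hom A Z L" "\<pi> ` carrier Z = carrier L"
    "t \<in> carrier Z \<Longrightarrow> \<pi> t = \<zero>\<^bsub>L\<^esub> \<longleftrightarrow> t \<in> rad"
    using quotient_module_proj[OF Z_module rad_submodule] unfolding \<pi> L_eq by simp_all
qed

text \<open>
  The copy of \<open>V\<close> that \<open>L(V)\<close> contains: its image consists of vectors killed by \<open>J\<^sub>p\<close>.
\<close>

definition \<eta> :: "'v \<Rightarrow> ('a \<times> 'v \<Rightarrow>\<^sub>0 int) set set" where "\<eta> v = \<pi> (\<iota> v)"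

lemma restrict_hom: "h \<in> lmod_hom A M N \<Longrightarrow> h \<in> lmod_hom B\<^sub>0 M N"
  by (simp add: lmod_hom_def A0_carrier)

lemma \<eta>_hom: "\<eta> \<in> lmod_hom B\<^sub>0 V L"
  unfolding \<eta>_def[abs_def] by (rule lmod_hom_comp[OF \<iota>_hom restrict_hom[OF \<pi>_hom]])

lemma \<eta>_nonzero: "\<lbrakk>v \<in> carrier V; v \<noteq> \<zero>\<^bsub>V\<^esub>\<rbrakk> \<Longrightarrow> \<eta> v \<noteq> \<zero>\<^bsub>L\<^esub>"
  unfolding \<eta>_def using \<pi>_zero_iff[OF \<iota>_closed] \<iota>_not_rad by blast

lemma Jp_\<eta>: "\<lbrakk>j \<in> J\<^sub>p; v \<in> carrier V\<rbrakk> \<Longrightarrow> j \<odot>\<^bsub>L\<^esub> \<eta> v = \<zero>\<^bsub>L\<^esub>"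
  using lmod_homD(4)[OF \<pi>_hom Jp_carrier \<iota>_closed] Jp_\<iota> lmod_hom_zero[OF Z_module L_module \<pi>_hom]
  by (simp add: \<eta>_def)

lemma L_ret:
  obtains r where "r \<in> lmod_hom B\<^sub>0 L V" "\<And>t. t \<in> carrier Z \<Longrightarrow> r (\<pi> t) = ret t"
  by (rule lmod_hom_factor[OF left_module_restrict[OF Z_module A0_subring]
        left_module_restrict[OF L_module A0_subring] V_module restrict_hom[OF \<pi>_hom] \<pi>_onto ret_hom])
    (use \<pi>_zero_iff rad_ret that in blast)+

text \<open>
  Among simple modules, \<open>L(V)\<close> is recognised by a nonzero image of \<open>V\<close> killed by \<open>J\<^sub>p\<close>.
  The induced map \<open>Z(V) \<rightarrow> M\<close> has a proper kernel, which therefore lies in the radical; so it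
  cannot map the radical onto \<open>M\<close>, as \<open>V\<close> would then meet the radical, and it factors
  through \<open>L(V)\<close>.
\<close>

lemma L_unique:
  assumes M: "simple_module A M" and h: "h \<in> lmod_hom B\<^sub>0 V M"
    and Jp: "\<And>j v. \<lbrakk>j \<in> J\<^sub>p; v \<in> carrier V\<rbrakk> \<Longrightarrow> j \<odot>\<^bsub>M\<^esub> h v = \<zero>\<^bsub>M\<^esub>"
    and v: "v \<in> carrier V" "h v \<noteq> \<zero>\<^bsub>M\<^esub>"
  obtains f where "f \<in> lmod_iso A L M"
proof -
  have MM: "left_module A M" by (rule simple_moduleD(1)[OF M])
  interpret M: left_module A M by (rule MM)
  obtain F where F: "F \<in> lmod_hom A Z M" and F\<iota>: "\<And>v. v \<in> carrier V \<Longrightarrow> F (\<iota> v) = h v"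
    using Z_universal[OF MM h Jp] by blast
  have "{t \<in> carrier Z. F t = \<zero>\<^bsub>M\<^esub>} \<noteq> carrier Z" using F\<iota>[OF v(1)] v(2) \<iota>_closed[OF v(1)] by force
  then have ker: "{t \<in> carrier Z. F t = \<zero>\<^bsub>M\<^esub>} \<subseteq> rad"
    by (rule proper_submodule_rad[OF submodule_kernel[OF Z_module MM F]])
  have "F ` rad \<noteq> carrier M"
  proof
    assume "F ` rad = carrier M"
    then have "F (\<iota> v) \<in> F ` rad" using lmod_homD(2)[OF F \<iota>_closed[OF v(1)]] by simp
    then obtain r where r: "r \<in> rad" "F r = F (\<iota> v)" by auto
    have rZ: "r \<in> carrier Z" by (rule Z.submoduleD(2)[OF rad_submodule r(1)])
    note \<iota>Z = \<iota>_closed[OF v(1)]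
    have "F (\<iota> v \<ominus>\<^bsub>Z\<^esub> r) = \<zero>\<^bsub>M\<^esub>"
      using additive_map_minus[OF Z_group M.M.abelian_group_axioms lmod_homD(1)[OF F] \<iota>Z rZ] r(2)
        lmod_homD(2)[OF F \<iota>Z] by (simp add: M.M.minus_eq M.M.r_neg)
    then have "\<iota> v \<ominus>\<^bsub>Z\<^esub> r \<in> rad" using ker \<iota>Z rZ by auto
    then have "(\<iota> v \<ominus>\<^bsub>Z\<^esub> r) \<oplus>\<^bsub>Z\<^esub> r \<in> rad" using r(1) by (rule Z.submoduleD(4)[OF rad_submodule])
    then have "\<iota> v \<in> rad" using \<iota>Z rZ by (simp add: Z.M.minus_eq Z.M.a_assoc Z.M.l_neg)
    moreover have "v \<noteq> \<zero>\<^bsub>V\<^esub>"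
      using v(2) additive_map_zero[OF V_group M.M.abelian_group_axioms lmod_homD(1)[OF h]] by auto
    ultimately show False using \<iota>_not_rad[OF v(1)] by blast
  qed
  then have Frad: "F ` rad = {\<zero>\<^bsub>M\<^esub>}"
    using simple_moduleD(3)[OF M submodule_image[OF Z_module MM F rad_submodule]] by blast
  have "F t = \<zero>\<^bsub>M\<^esub>" if "t \<in> carrier Z" "\<pi> t = \<zero>\<^bsub>L\<^esub>" for t
  proof -
    have "t \<in> rad" using \<pi>_zero_iff that by blast
    then show ?thesis using Frad by blast
  qed
  from lmod_hom_factor[OF Z_module L_module MM \<pi>_hom \<pi>_onto F this]
  obtain f where f: "f \<in> lmod_hom A L M" and f\<pi>: "\<And>t. t \<in> carrier Z \<Longrightarrow> f (\<pi> t) = F t" by metis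
  have "f (\<eta> v) \<noteq> \<zero>\<^bsub>M\<^esub>" using f\<pi>[OF \<iota>_closed[OF v(1)]] F\<iota>[OF v(1)] v(2) by (simp add: \<eta>_def)
  from simple_module_hom_iso[OF L_simple M f lmod_homD(2)[OF \<eta>_hom v(1)] this]
  show ?thesis by (rule that)
qed

end

section \<open>Dependence of the head on the simple module\<close>

context triangular_hopf_algebra
begin

lemma simple_standardI:
  assumes "simple_module B\<^sub>0 V"
  shows "simple_standard K A A\<^sub>m A\<^sub>0 A\<^sub>p J\<^sub>m J\<^sub>p V"
  using assms simple_moduleD(1)[OF assms] triangular_hopf_algebra_axioms
  by (intro simple_standard.intro standard.intro standard_axioms.intro simple_standard_axioms.intro)

text \<open>
  The retraction of \<open>Z(V)\<close> onto \<open>V\<close> descends to \<open>L(V)\<close> and kills \<open>J\<^sub>m L(V)\<close>.  If the composite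
  \<open>V \<rightarrow> L(V) \<cong> L(W) \<rightarrow> W\<close> were zero, then \<open>L(V) \<rightarrow> W\<close> would vanish on \<open>V + J\<^sub>m L(V) = L(V)\<close>.
\<close>

lemma standard_head_iso_imp_iso:
  assumes V: "simple_module B\<^sub>0 V" and W: "simple_module B\<^sub>0 W"
    and f: "f \<in> lmod_iso A (standard_head A A\<^sub>0 A\<^sub>p J\<^sub>p V) (standard_head A A\<^sub>0 A\<^sub>p J\<^sub>p W)"
  obtains g where "g \<in> lmod_iso B\<^sub>0 V W"
proof -
  interpret V: simple_standard K A A\<^sub>m A\<^sub>0 A\<^sub>p J\<^sub>m J\<^sub>p V by (rule simple_standardI[OF V])
  interpret W: simple_standard K A A\<^sub>m A\<^sub>0 A\<^sub>p J\<^sub>m J\<^sub>p W by (rule simple_standardI[OF W])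
  have fh: "f \<in> lmod_hom A V.L W.L" and bij: "bij_betw f (carrier V.L) (carrier W.L)"
    using f by (auto simp: lmod_iso_def)
  obtain r where r: "r \<in> lmod_hom B\<^sub>0 W.L W"
    and r\<pi>: "\<And>t. t \<in> carrier W.Z \<Longrightarrow> r (W.\<pi> t) = W.ret t" using W.L_ret by metis
  define \<phi> where "\<phi> t = r (f (V.\<pi> t))" for t
  have \<phi>: "\<phi> \<in> lmod_hom B\<^sub>0 V.Z W"
    unfolding \<phi>_def[abs_def]
    by (rule lmod_hom_comp[OF lmod_hom_comp[OF V.restrict_hom[OF V.\<pi>_hom] V.restrict_hom[OF fh]] r])
  note \<phi>_add = lmod_homD(1)[OF \<phi>]
  have f\<pi>: "f (V.\<pi> t) \<in> carrier W.L" if "t \<in> carrier V.Z" for t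
    using that lmod_homD(2)[OF fh] lmod_homD(2)[OF V.\<pi>_hom] by blast
  have rJ: "r (j \<odot>\<^bsub>W.L\<^esub> m) = \<zero>\<^bsub>W\<^esub>" if j: "j \<in> J\<^sub>m" and m: "m \<in> carrier W.L" for j m
  proof -
    have "m \<in> W.\<pi> ` carrier W.Z" using m W.\<pi>_onto by simp
    then obtain t where t: "t \<in> carrier W.Z" "m = W.\<pi> t" by (elim imageE)
    have "j \<odot>\<^bsub>W.Z\<^esub> t \<in> carrier W.Z"
      using left_module.smult_closed[OF W.Z_module Jm_carrier[OF j] t(1)] .
    then show ?thesis
      using t lmod_homD(4)[OF W.\<pi>_hom Jm_carrier[OF j] t(1)] r\<pi>[of "j \<odot>\<^bsub>W.Z\<^esub> t"] W.ret_Jm[OF j t(1)]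
      by simp
  qed
  have "\<exists>v\<in>carrier V. \<phi> (V.\<iota> v) \<noteq> \<zero>\<^bsub>W\<^esub>"
  proof (rule ccontr)
    assume "\<not> ?thesis"
    then have zero: "\<phi> (V.\<iota> v) = \<zero>\<^bsub>W\<^esub>" if "v \<in> carrier V" for v using that by simp
    let ?H = "{t \<in> carrier V.Z. \<phi> t = \<zero>\<^bsub>W\<^esub>}"
    interpret H: additive_subgroup ?H V.Z
      by (rule additive_subgroup_kernel[OF V.Z_group W.V_group \<phi>_add])
    have JH: "j \<odot>\<^bsub>V.Z\<^esub> t \<in> ?H" if j: "j \<in> J\<^sub>m" and t: "t \<in> carrier V.Z" for j t
    proof -
      have "\<phi> (j \<odot>\<^bsub>V.Z\<^esub> t) = r (j \<odot>\<^bsub>W.L\<^esub> f (V.\<pi> t))"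
        unfolding \<phi>_def lmod_homD(4)[OF V.\<pi>_hom Jm_carrier[OF j] t]
        by (simp only: lmod_homD(4)[OF fh Jm_carrier[OF j] lmod_homD(2)[OF V.\<pi>_hom t]])
      moreover have "r (j \<odot>\<^bsub>W.L\<^esub> f (V.\<pi> t)) = \<zero>\<^bsub>W\<^esub>"
        by (rule rJ[OF j f\<pi>[OF t]])
      moreover have "j \<odot>\<^bsub>V.Z\<^esub> t \<in> carrier V.Z"
        by (rule left_module.smult_closed[OF V.Z_module Jm_carrier[OF j] t])
      ultimately have "\<phi> (j \<odot>\<^bsub>V.Z\<^esub> t) = \<zero>\<^bsub>W\<^esub>" "j \<odot>\<^bsub>V.Z\<^esub> t \<in> carrier V.Z" by (simp_all only:)
      then show ?thesis by (intro CollectI conjI)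
    qed
    have onto: "V.ret ` V.\<iota> ` carrier V = carrier V"
      unfolding image_image using V.ret_\<iota> by (simp cong: image_cong)
    have sub: "V.\<iota> ` carrier V \<subseteq> ?H"
    proof (rule image_subsetI)
      fix v assume "v \<in> carrier V"
      then show "V.\<iota> v \<in> ?H" using zero V.\<iota>_closed by (intro CollectI conjI)
    qed
    have vanish: "\<phi> t = \<zero>\<^bsub>W\<^esub>" if "t \<in> carrier V.Z" for t
    proof -
      have "t \<in> ?H" by (rule V.Z_covered[OF H.additive_subgroup_axioms JH sub onto that])
      then show ?thesis by (elim CollectE conjE)
    qed
    obtain w where w: "w \<in> carrier W" "w \<noteq> \<zero>\<^bsub>W\<^esub>" using simple_module_nonzero[OF W] .
    have "W.\<eta> w \<in> f ` carrier V.L"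
      using bij lmod_homD(2)[OF W.\<eta>_hom w(1)] by (simp add: bij_betw_def)
    then obtain m where m: "m \<in> carrier V.L" "W.\<eta> w = f m" by (elim imageE)
    have "m \<in> V.\<pi> ` carrier V.Z" unfolding V.\<pi>_onto by (rule m(1))
    then obtain t where t: "t \<in> carrier V.Z" "m = V.\<pi> t" by (elim imageE)
    have "\<phi> t = r (W.\<pi> (W.\<iota> w))" using m(2) unfolding \<phi>_def t(2) W.\<eta>_def by (simp only:)
    also have "\<dots> = w" unfolding r\<pi>[OF W.\<iota>_closed[OF w(1)]] by (rule W.ret_\<iota>[OF w(1)])
    finally have "\<phi> t = w" .
    then show False using vanish[OF t(1)] w(2) by simp
  qed
  then obtain v where "v \<in> carrier V" "\<phi> (V.\<iota> v) \<noteq> \<zero>\<^bsub>W\<^esub>" by (elim bexE)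
  from simple_module_hom_iso[OF V W lmod_hom_comp[OF V.\<iota>_hom \<phi>] this] show ?thesis by (rule that)
qed

text \<open>\<open>L(W)\<close> contains a copy of \<open>V\<close> killed by \<open>J\<^sub>p\<close>, namely the image of \<open>W \<cong> V\<close>.\<close>

lemma standard_head_iso:
  assumes V: "simple_module B\<^sub>0 V" and W: "simple_module B\<^sub>0 W"
    and g: "g \<in> lmod_iso B\<^sub>0 V W"
  obtains f where "f \<in> lmod_iso A (standard_head A A\<^sub>0 A\<^sub>p J\<^sub>p V) (standard_head A A\<^sub>0 A\<^sub>p J\<^sub>p W)"
proof -
  interpret V: simple_standard K A A\<^sub>m A\<^sub>0 A\<^sub>p J\<^sub>m J\<^sub>p V by (rule simple_standardI[OF V])
  interpret W: simple_standard K A A\<^sub>m A\<^sub>0 A\<^sub>p J\<^sub>m J\<^sub>p W by (rule simple_standardI[OF W])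
  have gh: "g \<in> lmod_hom B\<^sub>0 V W" and bij: "bij_betw g (carrier V) (carrier W)"
    using g by (auto simp: lmod_iso_def)
  note gD = lmod_homD(2)[OF gh]
  obtain w where w: "w \<in> carrier W" "w \<noteq> \<zero>\<^bsub>W\<^esub>" using simple_module_nonzero[OF W] .
  have "w \<in> g ` carrier V" using w(1) bij by (simp add: bij_betw_def)
  then obtain v where v: "v \<in> carrier V" "w = g v" by (elim imageE)
  show ?thesis
  proof (rule V.L_unique[OF W.L_simple lmod_hom_comp[OF gh W.\<eta>_hom] _ v(1)])
    show "W.\<eta> (g v) \<noteq> \<zero>\<^bsub>W.L\<^esub>" using W.\<eta>_nonzero[OF w] unfolding v(2) .
    fix j v assume "j \<in> J\<^sub>p" "v \<in> carrier V"
    then show "j \<odot>\<^bsub>W.L\<^esub> W.\<eta> (g v) = \<zero>\<^bsub>W.L\<^esub>" by (intro W.Jp_\<eta> gD)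
  qed (rule that)
qed

section \<open>Highest weight vectors\<close>

lemma scalars_subfield: "subfield (scalars K A) A"
proof (rule A.subfield_iff(1))
  let ?s = "\<lambda>c. c \<star> \<one>\<^bsub>A\<^esub>"
  show sub: "scalars K A \<subseteq> carrier A" by (auto simp: scalars_def smult_closed)
  have mult: "?s c \<bullet> ?s d = ?s (c \<otimes>\<^bsub>K\<^esub> d)" if "c \<in> carrier K" "d \<in> carrier K" for c d
    using that by (simp add: smult_mult_left smult_closed smult_assoc1)
  have minus: "\<ominus>\<^bsub>A\<^esub> ?s c = ?s (\<ominus>\<^bsub>K\<^esub> c)" if "c \<in> carrier K" for c
    using that by (simp add: smult_l_minus)
  have subring: "subring (scalars K A) A"
  proof (rule A.subringI[OF sub])
    show "\<one>\<^bsub>A\<^esub> \<in> scalars K A" unfolding scalars_def by (rule image_eqI[of _ _ "\<one>\<^bsub>K\<^esub>"]) auto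
  next
    fix h assume "h \<in> scalars K A"
    then show "\<ominus>\<^bsub>A\<^esub> h \<in> scalars K A" using minus by (auto simp: scalars_def)
  next
    fix h h' assume "h \<in> scalars K A" "h' \<in> scalars K A"
    then obtain c d where c: "c \<in> carrier K" "h = ?s c" and d: "d \<in> carrier K" "h' = ?s d"
      by (auto simp: scalars_def)
    show "h \<bullet> h' \<in> scalars K A" using c d mult by (auto simp: scalars_def)
    have "h \<oplus>\<^bsub>A\<^esub> h' = ?s (c \<oplus>\<^bsub>K\<^esub> d)" using c d by (simp add: smult_l_distr)
    then show "h \<oplus>\<^bsub>A\<^esub> h' \<in> scalars K A" using c d by (auto simp: scalars_def)
  qed
  interpret S: ring "A\<lparr>carrier := scalars K A\<rparr>" by (rule A.subring_is_ring[OF subring])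
  have one_nz: "\<one>\<^bsub>A\<^esub> \<noteq> \<zero>\<^bsub>A\<^esub>" using counit_one counit_zero K.one_not_zero by metis
  show "field (A\<lparr>carrier := scalars K A\<rparr>)"
  proof (rule cring.cring_fieldI2)
    show "cring (A\<lparr>carrier := scalars K A\<rparr>)"
    proof (intro cring.intro comm_monoid.intro comm_monoid_axioms.intro S.ring_axioms S.monoid_axioms)
      fix x y assume "x \<in> carrier (A\<lparr>carrier := scalars K A\<rparr>)" "y \<in> carrier (A\<lparr>carrier := scalars K A\<rparr>)"
      then show "x \<otimes>\<^bsub>A\<lparr>carrier := scalars K A\<rparr>\<^esub> y = y \<otimes>\<^bsub>A\<lparr>carrier := scalars K A\<rparr>\<^esub> x"
        using mult K.m_comm by (auto simp: scalars_def)
    qed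
    show "\<zero>\<^bsub>A\<lparr>carrier := scalars K A\<rparr>\<^esub> \<noteq> \<one>\<^bsub>A\<lparr>carrier := scalars K A\<rparr>\<^esub>" using one_nz by simp
    fix a assume "a \<in> carrier (A\<lparr>carrier := scalars K A\<rparr>)" "a \<noteq> \<zero>\<^bsub>A\<lparr>carrier := scalars K A\<rparr>\<^esub>"
    then obtain c where c: "c \<in> carrier K" "a = ?s c" and nz: "a \<noteq> \<zero>\<^bsub>A\<^esub>" by (auto simp: scalars_def)
    have "c \<noteq> \<zero>\<^bsub>K\<^esub>" using c nz smult_l_null by auto
    then have i: "inv\<^bsub>K\<^esub> c \<in> carrier K" "c \<otimes>\<^bsub>K\<^esub> inv\<^bsub>K\<^esub> c = \<one>\<^bsub>K\<^esub>"
      using c K.field_Units by auto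
    have "a \<bullet> ?s (inv\<^bsub>K\<^esub> c) = \<one>\<^bsub>A\<^esub>" using mult[OF c(1) i(1)] c i by simp
    then show "\<exists>b\<in>carrier (A\<lparr>carrier := scalars K A\<rparr>). a \<otimes>\<^bsub>A\<lparr>carrier := scalars K A\<rparr>\<^esub> b = \<one>\<^bsub>A\<lparr>carrier := scalars K A\<rparr>\<^esub>"
      using i by (auto simp: scalars_def)
  qed
qed

lemma finite_dimension_over_scalars:
  assumes "finite_dimensional K A"
  shows "A.finite_dimension (scalars K A) (carrier A)"
proof -
  obtain S where S: "finite S" "S \<subseteq> carrier A"
    and gen: "\<And>x. x \<in> carrier A \<Longrightarrow> \<exists>c\<in>S \<rightarrow> carrier K. x = (\<Oplus>\<^bsub>A\<^esub>s\<in>S. c s \<star> s)"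
    using assms unfolding finite_dimensional_def by blast
  obtain us where us: "set us = S" using finite_list[OF S(1)] by blast
  note F = scalars_subfield
  have usA: "set us \<subseteq> carrier A" using us S by simp
  note span = A.Span_subgroup_props[OF F usA] A.Span_smult_closed[OF F usA]
  have sum: "(\<Oplus>\<^bsub>A\<^esub>s\<in>S'. c s \<star> s) \<in> A.Span (scalars K A) us"
    if "finite S'" "S' \<subseteq> S" "c \<in> S \<rightarrow> carrier K" for S' c
    using that
  proof (induction S' rule: finite_induct)
    case empty
    then show ?case using span(2) by (simp del: A.Span.simps)
  next
    case (insert s S')
    have sA: "s \<in> carrier A" "c s \<in> carrier K" using insert.prems S by auto
    have "s \<in> A.Span (scalars K A) us" using A.Span_base_incl[OF F usA] us insert.prems by blast
    moreover have "c s \<star> \<one>\<^bsub>A\<^esub> \<in> scalars K A" using sA by (simp add: scalars_def)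
    ultimately have "(c s \<star> \<one>\<^bsub>A\<^esub>) \<bullet> s \<in> A.Span (scalars K A) us" by (rule span(5)[rotated])
    moreover have "(c s \<star> \<one>\<^bsub>A\<^esub>) \<bullet> s = c s \<star> s" using sA by (simp add: smult_mult_left)
    moreover have "(\<Oplus>\<^bsub>A\<^esub>s\<in>insert s S'. c s \<star> s) = c s \<star> s \<oplus>\<^bsub>A\<^esub> (\<Oplus>\<^bsub>A\<^esub>s\<in>S'. c s \<star> s)"
      using insert sA S by (intro M.finsum_insert) (auto simp: smult_closed Pi_iff subset_iff)
    ultimately show ?case using insert span(3) by (simp del: A.Span.simps)
  qed
  have "carrier A \<subseteq> A.Span (scalars K A) us"
  proof
    fix x assume "x \<in> carrier A"
    then obtain c where "c \<in> S \<rightarrow> carrier K" "x = (\<Oplus>\<^bsub>A\<^esub>s\<in>S. c s \<star> s)" using gen by blast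
    then show "x \<in> A.Span (scalars K A) us" using sum[OF S(1) subset_refl] by simp
  qed
  then have "A.Span (scalars K A) us = carrier A" using span(1) by blast
  then show ?thesis using A.Span_finite_dimension[OF F usA] by simp
qed

text \<open>The powers of \<open>J\<^sub>p\<close> eventually kill \<open>M\<close>; the last one that does not produces such a vector.\<close>

lemma highest_weight_vector:
  assumes M: "left_module A M" and m: "m \<in> carrier M" "m \<noteq> \<zero>\<^bsub>M\<^esub>"
  obtains w where "w \<in> carrier M" "w \<noteq> \<zero>\<^bsub>M\<^esub>" "\<And>j. j \<in> J\<^sub>p \<Longrightarrow> j \<odot>\<^bsub>M\<^esub> w = \<zero>\<^bsub>M\<^esub>"
proof -
  interpret M: left_module A M by fact
  let ?P = "A.ideal_power A\<^sub>p J\<^sub>p"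
  have JA: "J\<^sub>p \<subseteq> carrier A" using Jp_carrier by blast
  have PA: "s \<in> carrier A" if "s \<in> ?P k" for s k
    by (rule A.ideal_power_carrier[OF JA that])
  let ?Q = "\<lambda>k. \<forall>s\<in>?P k. \<forall>x\<in>carrier M. s \<odot>\<^bsub>M\<^esub> x = \<zero>\<^bsub>M\<^esub>"
  have "\<exists>n. ?Q n"
  proof -
    obtain n where n: "?P n = {\<zero>\<^bsub>A\<^esub>}" using Jp_nilpotent by (auto simp: nilpotent_ideal_def)
    have "?Q n" unfolding n using M.zero_smult by simp
    then show ?thesis by blast
  qed
  then have least: "?Q (LEAST n. ?Q n)" by (rule LeastI_ex)
  show ?thesis
  proof (cases "LEAST n. ?Q n")
    case 0
    then have "\<forall>s\<in>J\<^sub>p. \<forall>x\<in>carrier M. s \<odot>\<^bsub>M\<^esub> x = \<zero>\<^bsub>M\<^esub>" using least by simp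
    then show ?thesis using that[OF m] m(1) by blast
  next
    case (Suc k)
    then have "\<not> ?Q k" using not_less_Least[of k ?Q] by simp
    then obtain s x where s: "s \<in> ?P k" and x: "x \<in> carrier M" and nz: "s \<odot>\<^bsub>M\<^esub> x \<noteq> \<zero>\<^bsub>M\<^esub>" by blast
    show ?thesis
    proof (rule that[OF M.smult_closed[OF PA[OF s] x] nz])
      fix j assume j: "j \<in> J\<^sub>p"
      have "j \<bullet> s \<in> ?P (Suc k)" by (rule A.ideal_power_mult_left[OF j s])
      then have "(j \<bullet> s) \<odot>\<^bsub>M\<^esub> x = \<zero>\<^bsub>M\<^esub>" using least x unfolding Suc by blast
      then show "j \<odot>\<^bsub>M\<^esub> (s \<odot>\<^bsub>M\<^esub> x) = \<zero>\<^bsub>M\<^esub>" using M.smult_assoc[OF Jp_carrier[OF j] PA[OF s] x] by simp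
    qed
  qed
qed

text \<open>
  Take a nonzero \<open>w\<close> killed by \<open>J\<^sub>p\<close> and a left ideal \<open>I\<close> of \<open>A\<^sub>0\<close> of least dimension with
  \<open>I w \<noteq> 0\<close>.  A submodule of \<open>I w\<close> is \<open>J w\<close> for a left ideal \<open>J \<subseteq> I\<close>, so \<open>I w\<close> is
  simple; and \<open>J\<^sub>p I w \<subseteq> A\<^sub>0 J\<^sub>p w = 0\<close>.
\<close>

lemma simple_highest_weight_submodule:
  assumes M: "simple_module A M" and fin: "finite_dimensional K A"
  obtains W where "simple_module B\<^sub>0 (M\<lparr>carrier := W\<rparr>)" "W \<subseteq> carrier M"
    "\<And>j w. \<lbrakk>j \<in> J\<^sub>p; w \<in> W\<rbrakk> \<Longrightarrow> j \<odot>\<^bsub>M\<^esub> w = \<zero>\<^bsub>M\<^esub>"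
proof -
  interpret M: left_module A M by (rule simple_moduleD[OF M])
  let ?F = "scalars K A" and ?B = "B\<^sub>0"
  interpret MB: left_module ?B M by (rule left_module_restrict[OF M.left_module_axioms A0_subring])
  obtain m where "m \<in> carrier M" "m \<noteq> \<zero>\<^bsub>M\<^esub>" using simple_module_nonzero[OF M] .
  then obtain w where w: "w \<in> carrier M" "w \<noteq> \<zero>\<^bsub>M\<^esub>" and Jw: "\<And>j. j \<in> J\<^sub>p \<Longrightarrow> j \<odot>\<^bsub>M\<^esub> w = \<zero>\<^bsub>M\<^esub>"
    using highest_weight_vector[OF M.left_module_axioms] by metis
  define left_ideal where "left_ideal I \<longleftrightarrow> I \<subseteq> A\<^sub>0 \<and> additive_subgroup I A \<and>
    (\<forall>a\<in>A\<^sub>0. \<forall>x\<in>I. a \<bullet> x \<in> I)" for I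
  define C where "C = {I. left_ideal I \<and> (\<exists>a\<in>I. a \<odot>\<^bsub>M\<^esub> w \<noteq> \<zero>\<^bsub>M\<^esub>)}"
  have "A\<^sub>0 \<in> C"
    using M.smult_one[OF w(1)] w(2) one_A0 A0_additive_subgroup A0_mult
    unfolding C_def left_ideal_def by force
  then obtain I where I: "I \<in> C" and min: "\<And>I'. I' \<in> C \<Longrightarrow> A.dim ?F I \<le> A.dim ?F I'"
    using ex_has_least_nat[of "\<lambda>I. I \<in> C" _ "A.dim ?F"] by blast
  have IL: "left_ideal I" using I by (simp add: C_def)
  have IA0: "I \<subseteq> A\<^sub>0" and Isub: "additive_subgroup I A"
    and Imult: "\<And>a x. \<lbrakk>a \<in> A\<^sub>0; x \<in> I\<rbrakk> \<Longrightarrow> a \<bullet> x \<in> I"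
    using IL by (auto simp: left_ideal_def)
  have IA: "I \<subseteq> carrier A" using IA0 A0_carrier by blast
  interpret I: additive_subgroup I A by (rule Isub)
  note F = scalars_subfield
  have fd: "A.finite_dimension ?F J" if "left_ideal J" for J
  proof (rule A.subalbegra_incl_imp_finite_dimension[OF F finite_dimension_over_scalars[OF fin]])
    have J: "J \<subseteq> A\<^sub>0" "additive_subgroup J A" "\<And>a x. \<lbrakk>a \<in> A\<^sub>0; x \<in> J\<rbrakk> \<Longrightarrow> a \<bullet> x \<in> J"
      using that by (auto simp: left_ideal_def)
    have "?F \<subseteq> A\<^sub>0" using A0_smult[OF _ one_A0] by (auto simp: scalars_def)
    then show "subalgebra ?F J A"
      using J by (intro subalgebra.intro subalgebra_axioms.intro) (auto simp: additive_subgroup_def)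
    show "J \<subseteq> carrier A" using J A0_carrier by blast
  qed
  have dims: "A.dimension (A.dim ?F J) ?F J" if "left_ideal J" for J
    using A.finite_dimensionE[OF F fd[OF that]] by (simp add: over_def)
  \<comment> \<open>A basis of \<open>J\<close> has at least as many elements as one of \<open>I\<close>, hence is a basis of \<open>I\<close>.\<close>
  have minimal: "J = I" if J: "J \<in> C" "J \<subseteq> I" for J
  proof -
    have JL: "left_ideal J" using J by (simp add: C_def)
    obtain us where us: "A.independent ?F us" "length us = A.dim ?F J" "A.Span ?F us = J" "set us \<subseteq> carrier A"
      using A.exists_base[OF F dims[OF JL]] by blast
    have usJ: "set us \<subseteq> J" using A.Span_base_incl[OF F us(4)] us(3) by simp
    have "length us \<le> A.dim ?F I"
      using A.independent_length_le_dimension[OF F dims[OF IL] us(1)] usJ J(2) by blast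
    then have "length us = A.dim ?F I" using us(2) min[OF J(1)] by simp
    then have "A.Span ?F us = I"
      using A.independent_length_eq_dimension[OF F dims[OF IL] us(1)] usJ J(2) by blast
    then show ?thesis using us(3) by simp
  qed
  define W where "W = (\<lambda>a. a \<odot>\<^bsub>M\<^esub> w) ` I"
  note act = M.smult_additive_left[OF w(1)]
  have WM: "W \<subseteq> carrier M" using IA M.smult_closed[OF _ w(1)] by (auto simp: W_def)
  have Wsub: "submodule W ?B M"
  proof (rule MB.submoduleI[OF WM])
    show "\<zero>\<^bsub>M\<^esub> \<in> W" unfolding W_def using M.zero_smult[OF w(1)] I.zero_closed by (intro image_eqI[of _ _ "\<zero>\<^bsub>A\<^esub>"]) auto
  next
    fix x y assume "x \<in> W" "y \<in> W"
    then obtain a b where a: "a \<in> I" "x = a \<odot>\<^bsub>M\<^esub> w" and b: "b \<in> I" "y = b \<odot>\<^bsub>M\<^esub> w" by (auto simp: W_def)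
    have "x \<oplus>\<^bsub>M\<^esub> y = (a \<oplus>\<^bsub>A\<^esub> b) \<odot>\<^bsub>M\<^esub> w" using a b IA w(1) by (simp add: M.smult_l_distr subset_iff)
    then show "x \<oplus>\<^bsub>M\<^esub> y \<in> W" unfolding W_def using a b by (intro image_eqI[of _ _ "a \<oplus>\<^bsub>A\<^esub> b"]) auto
  next
    fix a x assume a: "a \<in> carrier ?B" and "x \<in> W"
    then obtain b where b: "b \<in> I" "x = b \<odot>\<^bsub>M\<^esub> w" by (auto simp: W_def)
    have "a \<odot>\<^bsub>M\<^esub> x = (a \<bullet> b) \<odot>\<^bsub>M\<^esub> w" using a b IA w(1) A0_carrier by (simp add: M.smult_assoc subset_iff)
    then show "a \<odot>\<^bsub>M\<^esub> x \<in> W" unfolding W_def using Imult[OF _ b(1)] a by (intro image_eqI[of _ _ "a \<bullet> b"]) auto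
  qed
  have "simple_module ?B (M\<lparr>carrier := W\<rparr>)"
    unfolding simple_module_def
  proof (intro conjI allI impI)
    show WB: "left_module ?B (M\<lparr>carrier := W\<rparr>)" by (rule MB.left_module_submodule[OF Wsub])
    obtain a where "a \<in> I" "a \<odot>\<^bsub>M\<^esub> w \<noteq> \<zero>\<^bsub>M\<^esub>" using I by (auto simp: C_def)
    then show "carrier (M\<lparr>carrier := W\<rparr>) \<noteq> {\<zero>\<^bsub>M\<lparr>carrier := W\<rparr>\<^esub>}" by (auto simp: W_def)
    fix N assume N: "submodule N ?B (M\<lparr>carrier := W\<rparr>)"
    note ND = left_module.submoduleD[OF WB N, simplified]
    have NM: "additive_subgroup N M"
      using ND(2-4) WM MB.smult_minus_one ND(5)[OF subringE(5)[OF A0_subring one_A0]] M.smult_minus_one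
      by (intro M.M.additive_subgroupI') (auto simp: subset_iff)
    \<comment> \<open>Submodules of \<open>I w\<close> correspond to the left ideals inside \<open>I\<close>: here \<open>N = J w\<close>.\<close>
    define J where "J = {a \<in> carrier A. a \<odot>\<^bsub>M\<^esub> w \<in> N} \<inter> I"
    have Jin: "a \<in> J \<longleftrightarrow> a \<in> I \<and> a \<odot>\<^bsub>M\<^esub> w \<in> N" for a using IA by (auto simp: J_def)
    have "additive_subgroup J A"
    proof -
      interpret P: additive_subgroup "{a \<in> carrier A. a \<odot>\<^bsub>M\<^esub> w \<in> N}" A
        by (rule additive_subgroup_vimage[OF A_group M.M.abelian_group_axioms act NM])
      show ?thesis unfolding J_def using I.a_subset by (intro additive_subgroupI') (auto simp del: mem_Collect_eq)
    qed
    moreover have "a \<bullet> x \<in> J" if a: "a \<in> A\<^sub>0" and x: "x \<in> J" for a x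
      using Imult[OF a] ND(5)[OF a] M.smult_assoc[OF A0_carrier[OF a] _ w(1)] x IA by (auto simp: Jin)
    ultimately have JL: "left_ideal J" using IA0 by (auto simp: left_ideal_def Jin)
    show "N = {\<zero>\<^bsub>M\<lparr>carrier := W\<rparr>\<^esub>} \<or> N = carrier (M\<lparr>carrier := W\<rparr>)"
    proof (cases "\<exists>a\<in>J. a \<odot>\<^bsub>M\<^esub> w \<noteq> \<zero>\<^bsub>M\<^esub>")
      case True
      then have "J = I" using JL by (intro minimal) (auto simp: C_def Jin)
      then have "W \<subseteq> N" using Jin by (auto simp: W_def)
      then show ?thesis using ND(2) by auto
    next
      case False
      have zero: "x = \<zero>\<^bsub>M\<^esub>" if x: "x \<in> N" for x
      proof -
        obtain a where "a \<in> I" "x = a \<odot>\<^bsub>M\<^esub> w" using ND(2)[OF x] by (auto simp: W_def)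
        then show ?thesis using False x Jin by blast
      qed
      have "N = {\<zero>\<^bsub>M\<^esub>}"
      proof (intro equalityI subsetI)
        fix x assume "x \<in> N"
        then show "x \<in> {\<zero>\<^bsub>M\<^esub>}" unfolding singleton_iff by (rule zero)
      next
        fix x assume "x \<in> {\<zero>\<^bsub>M\<^esub>}"
        then show "x \<in> N" using ND(3) by (simp only: singleton_iff)
      qed
      then show ?thesis by simp
    qed
  qed
  moreover have "j \<odot>\<^bsub>M\<^esub> x = \<zero>\<^bsub>M\<^esub>" if j: "j \<in> J\<^sub>p" and x: "x \<in> W" for j x
  proof -
    obtain a where a: "a \<in> I" "x = a \<odot>\<^bsub>M\<^esub> w" using x by (auto simp: W_def)
    have aA0: "a \<in> A\<^sub>0" using a IA0 by blast
    have "j \<bullet> a \<in> {u \<in> carrier A. u \<odot>\<^bsub>M\<^esub> w = \<zero>\<^bsub>M\<^esub>}"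
    proof (rule Jp_A0_commute[OF additive_subgroup_kernel[OF A_group M.M.abelian_group_axioms act] _ aA0 j])
      fix b i assume b: "b \<in> A\<^sub>0" and i: "i \<in> J\<^sub>p"
      then show "b \<bullet> i \<in> {u \<in> carrier A. u \<odot>\<^bsub>M\<^esub> w = \<zero>\<^bsub>M\<^esub>}"
        using M.smult_assoc[OF A0_carrier[OF b] Jp_carrier[OF i] w(1)] Jw[OF i] M.smult_zero
        by (simp add: A0_carrier Jp_carrier)
    qed
    then show ?thesis using a(2) M.smult_assoc[OF Jp_carrier[OF j] A0_carrier[OF aA0] w(1)] by simp
  qed
  ultimately show ?thesis using that[OF _ WM] by blast
qed

lemma simple_module_is_standard_head:
  fixes M :: "('a, 'u) module"
  assumes M: "simple_module A M" and fin: "finite_dimensional K A"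
  obtains V :: "('a, 'u) module" and f where "simple_module B\<^sub>0 V"
    "f \<in> lmod_iso A (standard_head A A\<^sub>0 A\<^sub>p J\<^sub>p V) M"
proof -
  obtain W where W: "simple_module B\<^sub>0 (M\<lparr>carrier := W\<rparr>)" "W \<subseteq> carrier M"
    and JW: "\<And>j w. \<lbrakk>j \<in> J\<^sub>p; w \<in> W\<rbrakk> \<Longrightarrow> j \<odot>\<^bsub>M\<^esub> w = \<zero>\<^bsub>M\<^esub>"
    using simple_highest_weight_submodule[OF M fin] by metis
  let ?V = "M\<lparr>carrier := W\<rparr>"
  interpret V: simple_standard K A A\<^sub>m A\<^sub>0 A\<^sub>p J\<^sub>m J\<^sub>p ?V by (rule simple_standardI[OF W(1)])
  have incl: "(\<lambda>x. x) \<in> lmod_hom B\<^sub>0 ?V M" using W(2) by (auto simp: lmod_hom_def)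
  obtain v where v: "v \<in> carrier ?V" "v \<noteq> \<zero>\<^bsub>?V\<^esub>" using simple_module_nonzero[OF W(1)] .
  have v': "v \<noteq> \<zero>\<^bsub>M\<^esub>" using v(2) by simp
  have JV: "j \<odot>\<^bsub>M\<^esub> x = \<zero>\<^bsub>M\<^esub>" if "j \<in> J\<^sub>p" "x \<in> carrier ?V" for j x using JW that by simp
  obtain f where "f \<in> lmod_iso A V.L M" by (rule V.L_unique[OF M incl JV v(1) v'])
  then show ?thesis using that[OF W(1)] by blast
qed

end

section \<open>The bijection\<close>

theorem theorem3p3:
  fixes K :: "('k, 'x) ring_scheme"
    and A :: "('k, 'a, 'y) hopf_scheme"
    and A\<^sub>m A\<^sub>0 A\<^sub>p J\<^sub>m J\<^sub>p :: "'a set"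
    and emb :: "'a \<Rightarrow> 'u"
  assumes "characteristic_zero K"
    and "contains_roots_of_unity K"
    and "triangular_hopf_algebra K A A\<^sub>m A\<^sub>0 A\<^sub>p J\<^sub>m J\<^sub>p"
    and "finite_dimensional K A"
    and universe_large: "inj_on emb (carrier A)"
  shows "(\<forall>V :: ('a, 'u) module. simple_module (A\<lparr>carrier := A\<^sub>0\<rparr>) V \<longrightarrow>
            simple_module A (standard_head A A\<^sub>0 A\<^sub>p J\<^sub>p V)) \<and>
         (\<exists>\<Phi>. bij_betw \<Phi>
                 (simple_classes (A\<lparr>carrier := A\<^sub>0\<rparr>) :: ('a, 'u) module set set)
                 (simple_classes A :: ('a, 'u) module set set) \<and>
              (\<forall>V :: ('a, 'u) module. simple_module (A\<lparr>carrier := A\<^sub>0\<rparr>) V \<longrightarrow>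
                 \<Phi> (iso_class (A\<lparr>carrier := A\<^sub>0\<rparr>) V) =
                 iso_class A (standard_head A A\<^sub>0 A\<^sub>p J\<^sub>p V)))"
proof -
  interpret triangular_hopf_algebra K A A\<^sub>m A\<^sub>0 A\<^sub>p J\<^sub>m J\<^sub>p by fact
  let ?B = "A\<lparr>carrier := A\<^sub>0\<rparr>"
  let ?L = "\<lambda>V :: ('a, 'u) module. standard_head A A\<^sub>0 A\<^sub>p J\<^sub>p V"
  let ?cB = "\<lambda>V :: ('a, 'u) module. iso_class ?B V :: ('a, 'u) module set"
  let ?cL = "\<lambda>V. iso_class A (?L V) :: ('a, 'u) module set"
  have L: "simple_module A (?L V)" if "simple_module ?B V" for V
    by (rule simple_standard.L_simple[OF simple_standardI[OF that]])
  note lm = simple_moduleD(1)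
  \<comment> \<open>The elements of \<open>L(V)\<close> are cosets of formal sums; only a copy over \<open>'u\<close> can show that its class
    belongs to a simple module and is nonempty.\<close>
  have copy: "\<exists>N :: ('a, 'u) module. simple_module A N \<and> N \<in> ?cL V \<and> ?cL V = iso_class A N"
    if V: "simple_module ?B V" for V
  proof -
    obtain N :: "('a, 'u) module" and f where N: "left_module A N" and f: "f \<in> lmod_iso A (?L V) N"
      by (rule simple_module_copy[OF L[OF V] universe_large])
    have eq: "?cL V = iso_class A N" by (rule iso_class_eq[OF lm[OF L[OF V]] f])
    show ?thesis using simple_module_iso[OF L[OF V] N f] eq iso_class_self[OF N] by auto
  qed
  have class_cong: "?cL V = ?cL W"
    if V: "simple_module ?B V" and W: "simple_module ?B W" and eq: "?cB V = ?cB W" for V W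
  proof -
    obtain g where "g \<in> lmod_iso ?B V W"
      by (rule iso_class_eq_iso[OF lm[OF V] lm[OF W] iso_class_self[OF lm[OF V]] eq])
    then obtain f where f: "f \<in> lmod_iso A (?L V) (?L W)" by (rule standard_head_iso[OF V W])
    show ?thesis by (rule iso_class_eq[OF lm[OF L[OF V]] f])
  qed
  have class_inj: "?cB V = ?cB W"
    if V: "simple_module ?B V" and W: "simple_module ?B W" and eq: "?cL V = ?cL W" for V W
  proof -
    obtain N :: "('a, 'u) module" where N: "N \<in> ?cL V" using copy[OF V] by blast
    obtain f where "f \<in> lmod_iso A (?L V) (?L W)"
      by (rule iso_class_eq_iso[OF lm[OF L[OF V]] lm[OF L[OF W]] N eq])
    then obtain g where g: "g \<in> lmod_iso ?B V W" by (rule standard_head_iso_imp_iso[OF V W])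
    show ?thesis by (rule iso_class_eq[OF lm[OF V] g])
  qed
  define \<Phi> where "\<Phi> C = ?cL (SOME V. simple_module ?B V \<and> C = ?cB V)" for C
  have \<Phi>: "\<Phi> (?cB V) = ?cL V" if V: "simple_module ?B V" for V
  proof -
    let ?W = "SOME W. simple_module ?B W \<and> ?cB V = ?cB W"
    have "simple_module ?B ?W \<and> ?cB V = ?cB ?W" by (rule someI[of _ V]) (simp add: V)
    then show ?thesis unfolding \<Phi>_def using class_cong[OF V, of ?W] by simp
  qed
  have "bij_betw \<Phi> (simple_classes ?B) (simple_classes A)"
  proof (rule bij_betw_imageI[OF inj_onI subset_antisym[OF subsetI subsetI]])
    fix C D :: "('a, 'u) module set"
    assume "C \<in> simple_classes ?B" "D \<in> simple_classes ?B" and eq: "\<Phi> C = \<Phi> D"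
    then obtain V W where V: "simple_module ?B V" "C = ?cB V" and W: "simple_module ?B W" "D = ?cB W"
      unfolding simple_classes_def by blast
    show "C = D" using class_inj[OF V(1) W(1)] eq unfolding V(2) W(2) \<Phi>[OF V(1)] \<Phi>[OF W(1)] by blast
  next
    fix D assume "D \<in> \<Phi> ` (simple_classes ?B :: ('a, 'u) module set set)"
    then obtain V where V: "simple_module ?B V" "D = \<Phi> (?cB V)" unfolding simple_classes_def by blast
    then show "D \<in> simple_classes A" using copy[OF V(1)] \<Phi>[OF V(1)] unfolding simple_classes_def by auto
  next
    fix D assume "D \<in> (simple_classes A :: ('a, 'u) module set set)"
    then obtain M :: "('a, 'u) module" where M: "simple_module A M" "D = iso_class A M"
      unfolding simple_classes_def by blast
    obtain V :: "('a, 'u) module" and f where V: "simple_module ?B V" and f: "f \<in> lmod_iso A (?L V) M"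
      by (rule simple_module_is_standard_head[OF M(1) assms(4)])
    have "?cL V = iso_class A M" by (rule iso_class_eq[OF lm[OF L[OF V]] f])
    then have "D = \<Phi> (?cB V)" using M(2) \<Phi>[OF V] by simp
    then show "D \<in> \<Phi> ` (simple_classes ?B :: ('a, 'u) module set set)" using V unfolding simple_classes_def by blast
  qed
  then show ?thesis using L \<Phi> by blast
qed

end
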